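(* Let $\gamma(u)=(u(0),u(1))\in\mathbb{C}^2$ for $u\in H^1((0,1))$, $B=\begin{bmatrix}1&1\\1&1\end{bmatrix}$, and let $A$ be the operator on $L^2((0,1))$ associated with the form $a(u,v)=\int_0^1u'\overline{v'}\,dx+\langle B\gamma(u),\gamma(v)\rangle_{\mathbb{C}^2}$, $u,v\in H^1((0,1))$. Then: (i) $\sigma(-A)\subseteq(-\infty,0)$ and $R(0,-A)\gg_{\mathbf{1}}0$; (ii) the semigroup $(e^{-tA})_{t\ge0}$ is individually eventually strongly positive with respect to $\mathbf{1}$; (iii) the semigroup $(e^{-tA})_{t\ge0}$ is not positive.
   Context: The operator associated with $a$: $u\in D(A)$ iff $u\in H^1((0,1))$ and there is $f\in L^2$ with $a(u,v)=\langle f,v\rangle$ for all $v\in H^1$, and then $Au=f$. $\mathbf{1}$ is the constant function one; $g\gg_{\mathbf{1}}0$ means $g\ge c\mathbf{1}$ a.e. for some $c>0$; $T\gg_{\mathbf{1}}0$ means $Tf\gg_{\mathbf{1}}0$ whenever $f\ge0$, $f\ne0$. Individually eventually strongly positive with respect to $\mathbf{1}$: for each $f\ge0$, $f\ne0$, there is $t_0>0$ with $e^{-tA}f\gg_{\mathbf{1}}0$ for all $t\ge t_0$. *)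

theory Defs
  imports "HOL-Analysis.Analysis"
begin

text \<open>Complex-valued functions on the interval (0,1), handled through representatives
  of type real => complex; all equalities in L2 are understood almost everywhere
  with respect to Lebesgue measure on the unit interval.\<close>

abbreviation I01 :: "real measure" where
  "I01 \<equiv> lebesgue_on {0..1}"

definition L2 :: "(real \<Rightarrow> complex) \<Rightarrow> bool" where
  "L2 f \<longleftrightarrow> f \<in> borel_measurable I01 \<and> integrable I01 (\<lambda>x. (cmod (f x))^2)"

definition ae_eq :: "(real \<Rightarrow> complex) \<Rightarrow> (real \<Rightarrow> complex) \<Rightarrow> bool" where
  "ae_eq f g \<longleftrightarrow> (AE x in I01. f x = g x)"

definition L2_inner :: "(real \<Rightarrow> complex) \<Rightarrow> (real \<Rightarrow> complex) \<Rightarrow> complex" where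
  "L2_inner f g = (LINT x|I01. f x * cnj (g x))"

definition L2_norm :: "(real \<Rightarrow> complex) \<Rightarrow> real" where
  "L2_norm f = sqrt (LINT x|I01. (cmod (f x))^2)"

text \<open>H1 u w: u is the (absolutely continuous) representative of an element of H^1((0,1))
  whose weak derivative is w, i.e. u(x) = u(0) + integral of w over [0,x], with w in L2.\<close>
definition H1 :: "(real \<Rightarrow> complex) \<Rightarrow> (real \<Rightarrow> complex) \<Rightarrow> bool" where
  "H1 u w \<longleftrightarrow> L2 w \<and> (\<forall>x\<in>{0..1}. u x = u 0 + (LINT t|lebesgue_on {0..x}. w t))"

definition trace :: "(real \<Rightarrow> complex) \<Rightarrow> nat \<Rightarrow> complex" where
  "trace u i = (if i = 0 then u 0 else u 1)"

definition Bmat :: "nat \<Rightarrow> nat \<Rightarrow> complex" where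
  "Bmat i j = 1"

definition form_a :: "(real \<Rightarrow> complex) \<Rightarrow> (real \<Rightarrow> complex) \<Rightarrow>
    (real \<Rightarrow> complex) \<Rightarrow> (real \<Rightarrow> complex) \<Rightarrow> complex" where
  "form_a u u' v v' = L2_inner u' v'
     + (\<Sum>i\<in>{0,1}. (\<Sum>j\<in>{0,1}. Bmat i j * trace u j) * cnj (trace v i))"

text \<open>The operator A associated with the form, as a relation: opA f g means
  f \<in> D(A) and A f = g (as L2 classes).\<close>
definition opA :: "(real \<Rightarrow> complex) \<Rightarrow> (real \<Rightarrow> complex) \<Rightarrow> bool" where
  "opA f g \<longleftrightarrow> L2 f \<and> L2 g \<and>
     (\<exists>u u'. H1 u u' \<and> ae_eq f u \<and>
        (\<forall>v v'. H1 v v' \<longrightarrow> form_a u u' v v' = L2_inner g v))"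

definition resolvent_set_negA :: "complex set" where
  "resolvent_set_negA = {z.
     (\<forall>g. L2 g \<longrightarrow> (\<exists>f h. opA f h \<and> ae_eq (\<lambda>x. z * f x + h x) g)) \<and>
     (\<forall>f h. opA f h \<and> ae_eq (\<lambda>x. z * f x + h x) (\<lambda>x. 0) \<longrightarrow> ae_eq f (\<lambda>x. 0)) \<and>
     (\<exists>C. \<forall>f h. opA f h \<longrightarrow> L2_norm f \<le> C * L2_norm (\<lambda>x. z * f x + h x))}"

definition spectrum_negA :: "complex set" where
  "spectrum_negA = - resolvent_set_negA"

definition nonneg :: "(real \<Rightarrow> complex) \<Rightarrow> bool" where
  "nonneg f \<longleftrightarrow> (AE x in I01. Im (f x) = 0 \<and> Re (f x) \<ge> 0)"

definition strongly_pos :: "(real \<Rightarrow> complex) \<Rightarrow> bool" where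
  "strongly_pos g \<longleftrightarrow> (\<exists>c>0. AE x in I01. Im (g x) = 0 \<and> Re (g x) \<ge> c)"

definition C0_semigroup_gen_negA :: "(real \<Rightarrow> (real \<Rightarrow> complex) \<Rightarrow> (real \<Rightarrow> complex)) \<Rightarrow> bool" where
  "C0_semigroup_gen_negA T \<longleftrightarrow>
     (\<forall>t\<ge>0. \<forall>f. L2 f \<longrightarrow> L2 (T t f)) \<and>
     (\<forall>t\<ge>0. \<forall>f g. L2 f \<and> L2 g \<and> ae_eq f g \<longrightarrow> ae_eq (T t f) (T t g)) \<and>
     (\<forall>t\<ge>0. \<forall>f g a b. L2 f \<and> L2 g \<longrightarrow>
        ae_eq (T t (\<lambda>x. a * f x + b * g x)) (\<lambda>x. a * T t f x + b * T t g x)) \<and>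
     (\<forall>t\<ge>0. \<exists>C. \<forall>f. L2 f \<longrightarrow> L2_norm (T t f) \<le> C * L2_norm f) \<and>
     (\<forall>f. L2 f \<longrightarrow> ae_eq (T 0 f) f) \<and>
     (\<forall>s\<ge>0. \<forall>t\<ge>0. \<forall>f. L2 f \<longrightarrow> ae_eq (T (s + t) f) (T s (T t f))) \<and>
     (\<forall>f. L2 f \<longrightarrow> ((\<lambda>t. L2_norm (\<lambda>x. T t f x - f x)) \<longlongrightarrow> 0) (at_right 0)) \<and>
     (\<forall>f h. L2 f \<and> L2 h \<longrightarrow>
        (((\<lambda>t. L2_norm (\<lambda>x. (T t f x - f x) / of_real t - h x)) \<longlongrightarrow> 0) (at_right 0)
          \<longleftrightarrow> opA f (\<lambda>x. - h x)))"

end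

theory Submission
  imports Defs "HOL-Complex_Analysis.Great_Picard" "HOL-Real_Asymp.Real_Asymp"
begin

text \<open>The inverse of \<open>A\<close> is the integral operator with kernel \<open>(1 - \<bar>x - y\<bar>) / 2\<close>, which is positive
  almost everywhere; this gives the strong positivity of the resolvent at 0. As a compact, injective, positive
  self-adjoint operator it has an orthonormal basis of real eigenfunctions, in which \<open>A\<close> is multiplication by the
  eigenvalues \<open>lam n\<close>. Spectrum, semigroup and its uniqueness are read off from coordinates. Positivity of the
  kernel makes the lowest eigenvalue simple with an eigenfunction bounded below by a positive constant, and
  \<open>exp (lam 0 * t) T t f\<close> converges uniformly to the projection of \<open>f\<close> to this eigenfunction. Finally, positivity of the
  semigroup would entail positivity of \<open>R(z, -A)\<close> for all \<open>z > 0\<close>, which fails for \<open>z = 100\<close>.\<close>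

subsection \<open>Compact positive operators\<close>

text \<open>The obstacle to positivity is the off-diagonal part of B: its entries are positive, so
  the boundary form can be positive on functions of disjoint support near the two end points,
  whereas the inverse of \<open>A\<close> keeps a nonnegative kernel. No eigenvalue is computed.
  Only \<open>\<kappa> \<longlonglongrightarrow> 0\<close>, the gap below the top eigenvalue of the
  inverse and the positive ground state enter. Decay in L2 alone gives no pointwise lower bound; the
  remainder is therefore written as the Green operator applied to a small L2 function, since this
  operator maps L2 into bounded functions. The theorem speaks of every \<open>T\<close> satisfying
  the semigroup axioms, and these hold only up to null sets. Hence uniqueness has to be proved, and
  all identities are reduced to identities between coordinates, which are numbers. As the kernel is
  real, a real Hilbert space of classes suffices: a complex function is handled by its real and
  imaginary parts. The Laplace transform behind the failure of positivity is replaced by a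
  monotonicity argument for a scalar series of exponentials.\<close>

locale compact_positive_operator =
  fixes K :: "'a::{real_inner,complete_space} \<Rightarrow> 'a"
  assumes linear: "linear K"
    and symmetric: "K x \<bullet> y = x \<bullet> K y"
    and nonneg: "0 \<le> K x \<bullet> x"
    and injective: "K x = 0 \<Longrightarrow> x = 0"
    and compact: "(\<And>n. norm (X n) \<le> 1) \<Longrightarrow> \<exists>r l. strict_mono (r::nat \<Rightarrow> nat) \<and> (\<lambda>n. K (X (r n))) \<longlonglongrightarrow> l"
    and infinite_dim: "finite S \<Longrightarrow> span S \<noteq> (UNIV :: 'a set)"
begin

lemmas K_simps = linear_add[OF linear] linear_diff[OF linear] linear_scale[OF linear] linear_0[OF linear]

text \<open>Otherwise vectors \<open>X n\<close> of norm at most 1 with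
  \<open>norm (K (X n)) > Suc n\<close> exist, and no subsequence of \<open>K (X n)\<close> can
  converge.\<close>

lemma bounded: "\<exists>B>0. \<forall>x. norm (K x) \<le> B * norm x"
proof -
  have "\<exists>B>0. \<forall>x. norm x \<le> 1 \<longrightarrow> norm (K x) \<le> B"
  proof (rule ccontr)
    assume neg: "\<not> (\<exists>B>0. \<forall>x. norm x \<le> 1 \<longrightarrow> norm (K x) \<le> B)"
    have "\<exists>x. norm x \<le> 1 \<and> norm (K x) > real (Suc n)" for n
      using neg by (metis not_le of_nat_0_less_iff zero_less_Suc)
    then obtain X where X: "\<And>n. norm (X n) \<le> 1" "\<And>n. norm (K (X n)) > real (Suc n)" by metis
    obtain r l where r: "strict_mono (r::nat \<Rightarrow> nat)" and l: "(\<lambda>n. K (X (r n))) \<longlonglongrightarrow> l"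
      using compact X(1) by blast
    have "Bseq (\<lambda>n. K (X (r n)))" using l convergentI convergent_imp_Bseq by blast
    then obtain B where B: "\<And>n. norm (K (X (r n))) \<le> B" by (auto simp: Bseq_def)
    obtain n where "real n > B" using reals_Archimedean2 by blast
    moreover have "real n \<le> real (r n)" using seq_suble[OF r] by simp
    ultimately show False using B[of n] X(2)[of "r n"] by simp
  qed
  then obtain B where B: "B > 0" "\<And>x. norm x \<le> 1 \<Longrightarrow> norm (K x) \<le> B" by blast
  have "norm (K x) \<le> B * norm x" for x
  proof (cases "x = 0")
    case False
    have "norm (K (inverse (norm x) *\<^sub>R x)) \<le> B" using False by (intro B(2)) simp
    then show ?thesis using False by (simp add: K_simps field_simps)
  qed (simp add: K_simps)
  then show ?thesis using B(1) by blast
qed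

lemma bounded_linear: "bounded_linear K"
proof -
  obtain B where "\<And>x. norm (K x) \<le> B * norm x" using bounded by blast
  then show ?thesis
    by (intro bounded_linear_intro[of _ B]) (auto simp: K_simps mult.commute)
qed

lemma Cauchy_Schwarz: "(K x \<bullet> y)\<^sup>2 \<le> (K x \<bullet> x) * (K y \<bullet> y)"
proof (cases "K y \<bullet> y = 0")
  case True
  have "K x \<bullet> y = 0"
  proof (rule ccontr)
    assume nz: "K x \<bullet> y \<noteq> 0"
    \<comment> \<open>As \<open>K y \<bullet> y = 0\<close>, the form at \<open>x + t y\<close> is
      affine in \<open>t\<close> with nonzero slope; this \<open>t\<close> makes its value
      -1.\<close>
    define t where "t = - (K x \<bullet> x + 1) / (2 * (K x \<bullet> y))"
    have "0 \<le> K (x + t *\<^sub>R y) \<bullet> (x + t *\<^sub>R y)" by (rule nonneg)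
    also have "\<dots> = K x \<bullet> x + 2 * t * (K x \<bullet> y)"
      using True symmetric[of y x]
      by (simp add: K_simps inner_add_left inner_add_right algebra_simps inner_commute)
    also have "\<dots> = -1" using nz by (simp add: t_def field_simps)
    finally show False by simp
  qed
  then show ?thesis using True by simp
next
  case False
  then have pos: "K y \<bullet> y > 0" using nonneg[of y] by simp
  \<comment> \<open>The minimizer of the quadratic polynomial in \<open>t\<close>.\<close>
  define t where "t = - (K x \<bullet> y) / (K y \<bullet> y)"
  have "0 \<le> K (x + t *\<^sub>R y) \<bullet> (x + t *\<^sub>R y)" by (rule nonneg)
  also have "\<dots> = K x \<bullet> x + 2 * t * (K x \<bullet> y) + t\<^sup>2 * (K y \<bullet> y)"
    using symmetric[of y x]
    by (simp add: K_simps inner_add_left inner_add_right algebra_simps inner_commute power2_eq_square)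
  also have "\<dots> = K x \<bullet> x - (K x \<bullet> y)\<^sup>2 / (K y \<bullet> y)"
    using pos by (simp add: t_def field_simps power2_eq_square)
  finally show ?thesis using pos by (simp add: field_simps)
qed

text \<open>Cauchy--Schwarz tested with \<open>K x\<close> turns \<open>K x \<bullet> x = 0\<close>
  into \<open>K x = 0\<close>, so injectivity upgrades semidefiniteness to definiteness.\<close>

lemma positive: "x \<noteq> 0 \<Longrightarrow> 0 < K x \<bullet> x"
proof (rule ccontr)
  assume "x \<noteq> 0" and "\<not> 0 < K x \<bullet> x"
  then have "K x \<bullet> x = 0" using nonneg[of x] by simp
  then have "K x \<bullet> K x = 0" using Cauchy_Schwarz[of x "K x"] by simp
  then show False using injective \<open>x \<noteq> 0\<close> by simp
qed

text \<open>Cauchy--Schwarz for the form \<open>K x \<bullet> y\<close> gives \<open>\<parallel>K x\<parallel>\<^sup>2 \<le> \<kappa> (K x \<bullet> x)\<close>, hence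
  \<open>\<parallel>K x - \<kappa> x\<parallel>\<^sup>2 \<le> \<kappa> (\<kappa> \<parallel>x\<parallel>\<^sup>2 - K x \<bullet> x)\<close>.\<close>
lemma almost_eigenvector:
  assumes bound: "\<And>y. y \<in> M \<Longrightarrow> K y \<bullet> y \<le> \<kappa> * (norm y)\<^sup>2" and M: "x \<in> M" "K x \<in> M"
  shows "(norm (K x - \<kappa> *\<^sub>R x))\<^sup>2 \<le> \<kappa> * (\<kappa> * (norm x)\<^sup>2 - K x \<bullet> x)"
proof -
  have le: "(norm (K x))\<^sup>2 \<le> \<kappa> * (K x \<bullet> x)"
  proof (cases "K x = 0")
    case False
    have "((norm (K x))\<^sup>2)\<^sup>2 = (K x \<bullet> K x)\<^sup>2" by (simp add: power2_norm_eq_inner)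
    also have "\<dots> \<le> (K x \<bullet> x) * (K (K x) \<bullet> K x)" by (rule Cauchy_Schwarz)
    also have "\<dots> \<le> (K x \<bullet> x) * (\<kappa> * (norm (K x))\<^sup>2)"
      by (intro mult_left_mono bound M nonneg)
    finally have "(norm (K x))\<^sup>2 * (norm (K x))\<^sup>2 \<le> (norm (K x))\<^sup>2 * (\<kappa> * (K x \<bullet> x))"
      by (simp add: power2_eq_square algebra_simps)
    then show ?thesis by (rule mult_left_le_imp_le) (use False in simp)
  qed simp
  have "(norm (K x - \<kappa> *\<^sub>R x))\<^sup>2 = (norm (K x))\<^sup>2 - 2 * \<kappa> * (K x \<bullet> x) + \<kappa>\<^sup>2 * (norm x)\<^sup>2"
    unfolding power2_norm_eq_inner
    by (simp add: inner_diff_left inner_diff_right inner_commute algebra_simps power2_eq_square)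
  then show ?thesis using le by (simp add: algebra_simps power2_eq_square)
qed

text \<open>The right-hand side of \<open>almost_eigenvector\<close> vanishes. An energy comparison
  is thereby enough to recognize an eigenvector, which is how absolute values of eigenfunctions are
  treated later.\<close>

lemma maximizer_eigenvector:
  assumes "\<And>y. K y \<bullet> y \<le> \<kappa> * (norm y)\<^sup>2" and "K x \<bullet> x = \<kappa> * (norm x)\<^sup>2"
  shows "K x = \<kappa> *\<^sub>R x"
  using almost_eigenvector[of UNIV \<kappa> x] assms by simp

text \<open>The quotient of \<open>K y \<bullet> y\<close> and \<open>(norm y)\<^sup>2\<close> is
  maximized over the orthogonal complement of \<open>S\<close>, which is invariant by symmetry and
  nontrivial by \<open>infinite_dim\<close>. A maximizing sequence consists of almost eigenvectors,
  and compactness makes a subsequence converge to a true one.\<close>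

lemma next_eigenvector:
  assumes S: "finite S" "\<And>s. s \<in> S \<Longrightarrow> \<exists>c. K s = c *\<^sub>R s"
    and ort: "\<And>s t. s \<in> S \<Longrightarrow> t \<in> S \<Longrightarrow> s \<bullet> t = (if s = t then 1 else 0)"
  shows "\<exists>e \<kappa>. norm e = 1 \<and> (\<forall>s\<in>S. e \<bullet> s = 0) \<and> 0 < \<kappa> \<and> K e = \<kappa> *\<^sub>R e
    \<and> (\<forall>y. (\<forall>s\<in>S. y \<bullet> s = 0) \<longrightarrow> K y \<bullet> y \<le> \<kappa> * (norm y)\<^sup>2)"
proof -
  define M where "M = {x. \<forall>s\<in>S. x \<bullet> s = 0}"
  have KM: "K x \<in> M" if "x \<in> M" for x
    using that S(2) by (fastforce simp: M_def symmetric)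
  define R where "R = {K x \<bullet> x | x. x \<in> M \<and> norm x = 1}"
  define \<kappa> where "\<kappa> = Sup R"
  obtain B where B: "B > 0" "\<And>x. norm (K x) \<le> B * norm x" using bounded by blast
  have "bdd_above R"
  proof (rule bdd_aboveI)
    fix r assume "r \<in> R"
    then obtain x where x: "r = K x \<bullet> x" "norm x = 1" by (auto simp: R_def)
    have "r \<le> norm (K x) * norm x" using x norm_cauchy_schwarz by blast
    then show "r \<le> B" using x B(2)[of x] by simp
  qed
  \<comment> \<open>A vector outside \<open>span S\<close> minus its projection to
    \<open>span S\<close> is a nonzero element of \<open>M\<close>.\<close>
  obtain z where z: "z \<notin> span S" using infinite_dim[OF S(1)] by blast
  define x0 where "x0 = z - (\<Sum>s\<in>S. (z \<bullet> s) *\<^sub>R s)"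
  have "(\<Sum>s\<in>S. (z \<bullet> s) *\<^sub>R s) \<in> span S" by (intro span_sum span_scale span_base)
  then have "x0 \<noteq> 0" using z by (auto simp: x0_def)
  moreover have "x0 \<bullet> s = 0" if "s \<in> S" for s
  proof -
    have "(\<Sum>t\<in>S. (z \<bullet> t) * (t \<bullet> s)) = (\<Sum>t\<in>S. if t = s then z \<bullet> s else 0)"
      by (intro sum.cong) (use ort that in auto)
    then show ?thesis using S(1) that by (simp add: x0_def inner_diff_left inner_sum_left)
  qed
  ultimately have x0: "x0 \<noteq> 0" "x0 \<in> M" by (simp_all add: M_def)
  define x1 where "x1 = inverse (norm x0) *\<^sub>R x0"
  have x1: "x1 \<in> M" "norm x1 = 1" using x0 by (auto simp: x1_def M_def)
  then have ne: "K x1 \<bullet> x1 \<in> R" by (auto simp: R_def)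
  then have "K x1 \<bullet> x1 \<le> \<kappa>" unfolding \<kappa>_def by (rule cSup_upper) fact
  moreover have "x1 \<noteq> 0" using x1(2) by auto
  ultimately have \<kappa>0: "\<kappa> > 0" using positive[of x1] by linarith
  have bound: "K y \<bullet> y \<le> \<kappa> * (norm y)\<^sup>2" if "y \<in> M" for y
  proof (cases "y = 0")
    case False
    define z where "z = inverse (norm y) *\<^sub>R y"
    have "z \<in> M" "norm z = 1" using that False by (auto simp: z_def M_def)
    then have "K z \<bullet> z \<le> \<kappa>" unfolding \<kappa>_def
      by (intro cSup_upper) (auto simp: R_def \<open>bdd_above R\<close>[unfolded R_def])
    then show ?thesis using False by (simp add: z_def K_simps field_simps power2_eq_square)
  qed (simp add: K_simps)
  have "\<exists>x. x \<in> M \<and> norm x = 1 \<and> K x \<bullet> x > \<kappa> - inverse (real (Suc n))" for n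
  proof -
    have "\<exists>r\<in>R. \<kappa> - inverse (real (Suc n)) < r"
      using ne \<open>bdd_above R\<close> unfolding \<kappa>_def by (subst less_cSup_iff[symmetric]) auto
    then show ?thesis by (auto simp: R_def)
  qed
  then obtain X where X: "\<And>n. X n \<in> M" "\<And>n. norm (X n) = 1"
    "\<And>n. K (X n) \<bullet> X n > \<kappa> - inverse (real (Suc n))" by metis
  obtain r l where r: "strict_mono (r::nat \<Rightarrow> nat)" and l: "(\<lambda>n. K (X (r n))) \<longlonglongrightarrow> l"
    using compact[of X] X(2) by auto
  have "(\<lambda>n. \<kappa> * inverse (real (Suc (r n)))) \<longlonglongrightarrow> 0"
    using LIMSEQ_subseq_LIMSEQ[OF LIMSEQ_inverse_real_of_nat r]
    by (auto simp: o_def intro!: tendsto_mult_right_zero)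
  moreover have "(norm (K (X (r n)) - \<kappa> *\<^sub>R X (r n)))\<^sup>2 \<le> \<kappa> * inverse (real (Suc (r n)))" for n
  proof -
    have "(norm (K (X (r n)) - \<kappa> *\<^sub>R X (r n)))\<^sup>2 \<le> \<kappa> * (\<kappa> * (norm (X (r n)))\<^sup>2 - K (X (r n)) \<bullet> X (r n))"
      by (rule almost_eigenvector[of M]) (use bound X KM in auto)
    also have "\<dots> \<le> \<kappa> * inverse (real (Suc (r n)))"
      using X(3)[of "r n"] X(2) \<kappa>0 by (intro mult_left_mono) auto
    finally show ?thesis .
  qed
  ultimately have "(\<lambda>n. (norm (K (X (r n)) - \<kappa> *\<^sub>R X (r n)))\<^sup>2) \<longlonglongrightarrow> 0"
    by (elim Lim_null_comparison[rotated]) simp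
  then have "(\<lambda>n. sqrt ((norm (K (X (r n)) - \<kappa> *\<^sub>R X (r n)))\<^sup>2)) \<longlonglongrightarrow> sqrt 0"
    by (intro tendsto_intros)
  then have "(\<lambda>n. K (X (r n)) - \<kappa> *\<^sub>R X (r n)) \<longlonglongrightarrow> 0"
    by (simp add: tendsto_norm_zero_iff)
  \<comment> \<open>Compactness controls only \<open>K (X (r n))\<close>. Since the difference from
    \<open>\<kappa> *\<^sub>R X (r n)\<close> tends to 0 and \<open>\<kappa> > 0\<close>, the
    vectors \<open>X (r n)\<close> themselves converge.\<close>
  from tendsto_diff[OF l this] have "(\<lambda>n. \<kappa> *\<^sub>R X (r n)) \<longlonglongrightarrow> l" by simp
  from tendsto_scaleR[OF tendsto_const[of "inverse \<kappa>"] this]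
  have lim: "(\<lambda>n. X (r n)) \<longlonglongrightarrow> inverse \<kappa> *\<^sub>R l" using \<kappa>0 by simp
  define e where "e = inverse \<kappa> *\<^sub>R l"
  have lim: "(\<lambda>n. X (r n)) \<longlonglongrightarrow> e" using lim by (simp add: e_def)
  have "(\<lambda>n. K (X (r n))) \<longlonglongrightarrow> K e"
    by (rule bounded_linear.tendsto[OF bounded_linear lim])
  then have "K e = l" using l LIMSEQ_unique by blast
  then have Ke: "K e = \<kappa> *\<^sub>R e" using \<kappa>0 by (simp add: e_def)
  have ne1: "norm e = 1" using tendsto_norm[OF lim] X(2) by (simp add: LIMSEQ_const_iff)
  have "e \<bullet> s = 0" if "s \<in> S" for s
  proof -
    have "(\<lambda>n. X (r n) \<bullet> s) \<longlonglongrightarrow> e \<bullet> s" by (intro tendsto_intros lim)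
    moreover have "X (r n) \<bullet> s = 0" for n using X(1) that by (auto simp: M_def)
    ultimately show ?thesis by (simp add: LIMSEQ_const_iff)
  qed
  moreover have "\<forall>y. (\<forall>s\<in>S. y \<bullet> s = 0) \<longrightarrow> K y \<bullet> y \<le> \<kappa> * (norm y)\<^sup>2" using bound by (simp add: M_def)
  ultimately show ?thesis using ne1 \<kappa>0 Ke by blast
qed

text \<open>The leading eigenvector is prescribed rather than chosen, so that the sequence can start
  with a positive ground state. The others come from \<open>next_eigenvector\<close> by
  course-of-values recursion.\<close>

lemma eigensequence:
  assumes e: "norm e = 1" "K e = \<mu> *\<^sub>R e" "0 < \<mu>" "\<And>y. K y \<bullet> y \<le> \<mu> * (norm y)\<^sup>2"
  obtains \<phi> :: "nat \<Rightarrow> 'a" and \<kappa> :: "nat \<Rightarrow> real" where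
    "\<phi> 0 = e" "\<kappa> 0 = \<mu>" "\<And>m n. \<phi> m \<bullet> \<phi> n = (if m = n then 1 else 0)"
    "\<And>n. 0 < \<kappa> n" "\<And>n. K (\<phi> n) = \<kappa> n *\<^sub>R \<phi> n"
    "\<And>n y. (\<And>i. i < n \<Longrightarrow> y \<bullet> \<phi> i = 0) \<Longrightarrow> K y \<bullet> y \<le> \<kappa> n * (norm y)\<^sup>2"
proof -
  \<comment> \<open>\<open>P f n x\<close> reads \<open>f\<close> only below \<open>n\<close>, as
    the recursion demands; the clause for \<open>n = 0\<close> pins the first vector to
    \<open>e\<close>.\<close>
  define P where "P f n x \<longleftrightarrow> norm x = 1 \<and> (\<forall>i<n. x \<bullet> f i = 0) \<and> (n = 0 \<longrightarrow> x = e) \<and>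
    (\<exists>\<kappa>>0. K x = \<kappa> *\<^sub>R x \<and> (\<forall>y. (\<forall>i<n. y \<bullet> f i = 0) \<longrightarrow> K y \<bullet> y \<le> \<kappa> * (norm y)\<^sup>2))"
    for f :: "nat \<Rightarrow> 'a" and n x
  have "\<exists>f. \<forall>n. P f n (f n)"
  proof (rule dependent_wellorder_choice)
    fix r :: 'a and f g :: "nat \<Rightarrow> 'a" and n :: nat
    assume "\<And>m. m < n \<Longrightarrow> f m = g m"
    then show "P f n r = P g n r" by (simp add: P_def cong: conj_cong imp_cong)
  next
    fix n and f :: "nat \<Rightarrow> 'a" assume IH: "\<And>m. m < n \<Longrightarrow> P f m (f m)"
    show "\<exists>x. P f n x"
    proof (cases "n = 0")
      case True
      then show ?thesis using e by (intro exI[of _ e]) (auto simp: P_def)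
    next
      case False
      have "\<exists>e \<kappa>. norm e = 1 \<and> (\<forall>s\<in>f ` {..<n}. e \<bullet> s = 0) \<and> 0 < \<kappa> \<and> K e = \<kappa> *\<^sub>R e
        \<and> (\<forall>y. (\<forall>s\<in>f ` {..<n}. y \<bullet> s = 0) \<longrightarrow> K y \<bullet> y \<le> \<kappa> * (norm y)\<^sup>2)"
      proof (rule next_eigenvector)
        fix s assume "s \<in> f ` {..<n}"
        then obtain m where "m < n" "s = f m" by auto
        then show "\<exists>c. K s = c *\<^sub>R s" using IH[of m] unfolding P_def by blast
      next
        fix s t assume "s \<in> f ` {..<n}" "t \<in> f ` {..<n}"
        then obtain i j where ij: "i < n" "j < n" "s = f i" "t = f j" by auto
        then have P: "P f i (f i)" "P f j (f j)" using IH by auto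
        consider "i < j" | "i = j" | "j < i" by linarith
        then show "s \<bullet> t = (if s = t then 1 else 0)"
        proof cases
          case 1
          then have "f j \<bullet> f i = 0" "norm (f j) = 1" using P by (simp_all add: P_def)
          then show ?thesis using ij by (auto simp: inner_commute)
        next
          case 2
          then show ?thesis using P ij by (simp add: P_def norm_eq_1)
        next
          case 3
          then have "f i \<bullet> f j = 0" "norm (f i) = 1" using P by (simp_all add: P_def)
          then show ?thesis using ij by auto
        qed
      qed simp
      then obtain x \<mu> where "norm x = 1" "\<forall>s\<in>f ` {..<n}. x \<bullet> s = 0" "0 < \<mu>" "K x = \<mu> *\<^sub>R x"
        "\<forall>y. (\<forall>s\<in>f ` {..<n}. y \<bullet> s = 0) \<longrightarrow> K y \<bullet> y \<le> \<mu> * (norm y)\<^sup>2" by blast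
      then have "P f n x" unfolding P_def using False
        by (intro conjI exI[of _ \<mu>]) auto
      then show ?thesis by blast
    qed
  qed
  then obtain \<phi> where \<phi>: "\<And>n. P \<phi> n (\<phi> n)" by blast
  then have "\<forall>n. \<exists>\<kappa>>0. K (\<phi> n) = \<kappa> *\<^sub>R \<phi> n \<and> (\<forall>y. (\<forall>i<n. y \<bullet> \<phi> i = 0) \<longrightarrow> K y \<bullet> y \<le> \<kappa> * (norm y)\<^sup>2)"
    by (auto simp: P_def)
  then obtain \<kappa> where \<kappa>: "\<And>n. 0 < \<kappa> n" "\<And>n. K (\<phi> n) = \<kappa> n *\<^sub>R \<phi> n"
    "\<And>n y. (\<And>i. i < n \<Longrightarrow> y \<bullet> \<phi> i = 0) \<Longrightarrow> K y \<bullet> y \<le> \<kappa> n * (norm y)\<^sup>2" by metis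
  have 0: "\<phi> 0 = e" using \<phi>[of 0] by (simp add: P_def)
  have ort: "\<phi> m \<bullet> \<phi> n = (if m = n then 1 else 0)" for m n
  proof -
    consider "m < n" | "m = n" | "n < m" by linarith
    then show ?thesis
      using \<phi>[of m] \<phi>[of n] by cases (auto simp: P_def inner_commute norm_eq_1)
  qed
  have "\<kappa> 0 *\<^sub>R e = \<mu> *\<^sub>R e" using \<kappa>(2)[of 0] e(2) 0 by metis
  moreover have "e \<noteq> 0" using e(1) by auto
  ultimately have "\<kappa> 0 = \<mu>" by auto
  then show ?thesis using that 0 ort \<kappa> by blast
qed

end

section \<open>Orthonormal sequences in Hilbert spaces\<close>

lemma orthonormal_norm_sum:
  fixes \<phi> :: "nat \<Rightarrow> 'a::real_inner"
  assumes ort: "\<And>m n. \<phi> m \<bullet> \<phi> n = (if m = n then 1 else 0)" and "finite A"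
  shows "(norm (\<Sum>n\<in>A. a n *\<^sub>R \<phi> n))\<^sup>2 = (\<Sum>n\<in>A. (a n)\<^sup>2)"
  unfolding power2_norm_eq_inner
  using \<open>finite A\<close> by (simp add: inner_sum_left inner_sum_right
      ort power2_eq_square if_distrib cong: if_cong)

lemma Bessel_finite:
  fixes \<phi> :: "nat \<Rightarrow> 'a::real_inner"
  assumes ort: "\<And>m n. \<phi> m \<bullet> \<phi> n = (if m = n then 1 else 0)"
  shows "(norm (x - (\<Sum>n<N. (x \<bullet> \<phi> n) *\<^sub>R \<phi> n)))\<^sup>2 = (norm x)\<^sup>2 - (\<Sum>n<N. (x \<bullet> \<phi> n)\<^sup>2)"
proof -
  define p where "p = (\<Sum>n<N. (x \<bullet> \<phi> n) *\<^sub>R \<phi> n)"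
  have pp: "(norm p)\<^sup>2 = (\<Sum>n<N. (x \<bullet> \<phi> n)\<^sup>2)"
    unfolding p_def by (rule orthonormal_norm_sum[OF ort]) simp
  have xp: "x \<bullet> p = (\<Sum>n<N. (x \<bullet> \<phi> n)\<^sup>2)"
    by (simp add: p_def inner_sum_right power2_eq_square)
  have "(norm (x - p))\<^sup>2 = (norm x)\<^sup>2 - 2 * (x \<bullet> p) + (norm p)\<^sup>2"
    unfolding power2_norm_eq_inner by (simp add: inner_diff_left inner_diff_right inner_commute)
  then show ?thesis using pp xp by (simp add: p_def)
qed

lemma Bessel_summable:
  fixes \<phi> :: "nat \<Rightarrow> 'a::real_inner"
  assumes ort: "\<And>m n. \<phi> m \<bullet> \<phi> n = (if m = n then 1 else 0)"
  shows "summable (\<lambda>n. (x \<bullet> \<phi> n)\<^sup>2)"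
proof (rule summableI_nonneg_bounded)
  show "(\<Sum>n<N. (x \<bullet> \<phi> n)\<^sup>2) \<le> (norm x)\<^sup>2" for N
    using Bessel_finite[OF ort, of x N] zero_le_power2[of "norm (x - (\<Sum>n<N. (x \<bullet> \<phi> n) *\<^sub>R \<phi> n))"]
    by linarith
qed simp

text \<open>The squared norm of a block of the series is the corresponding block of the convergent
  sum of \<open>(a n)\<^sup>2\<close>, so the partial sums are Cauchy; continuity of the inner
  product gives the coordinates of the limit.\<close>

lemma Riesz_Fischer:
  fixes \<phi> :: "nat \<Rightarrow> 'a::{real_inner,complete_space}"
  assumes ort: "\<And>m n. \<phi> m \<bullet> \<phi> n = (if m = n then 1 else 0)" and a: "summable (\<lambda>n. (a n)\<^sup>2)"
  obtains x where "(\<lambda>n. a n *\<^sub>R \<phi> n) sums x" "\<And>n. x \<bullet> \<phi> n = a n"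
proof -
  have "Cauchy (\<lambda>N. \<Sum>n<N. a n *\<^sub>R \<phi> n)"
  proof (rule CauchyI)
    fix e :: real assume e: "e > 0"
    then have "e\<^sup>2 > 0" by simp
    with a obtain N where N: "\<And>m n. m \<ge> N \<Longrightarrow> norm (\<Sum>k=m..<n. (a k)\<^sup>2) < e\<^sup>2"
      unfolding summable_Cauchy by blast
    have lt: "norm ((\<Sum>i<n. a i *\<^sub>R \<phi> i) - (\<Sum>i<m. a i *\<^sub>R \<phi> i)) < e" if "N \<le> m" "m \<le> n" for m n
    proof -
      have "(\<Sum>i<n. a i *\<^sub>R \<phi> i) - (\<Sum>i<m. a i *\<^sub>R \<phi> i) = (\<Sum>i=m..<n. a i *\<^sub>R \<phi> i)"
        using that by (simp add: sum_diff_nat_ivl lessThan_atLeast0)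
      then have "(norm ((\<Sum>i<n. a i *\<^sub>R \<phi> i) - (\<Sum>i<m. a i *\<^sub>R \<phi> i)))\<^sup>2 = (\<Sum>i=m..<n. (a i)\<^sup>2)"
        by (simp add: orthonormal_norm_sum[OF ort])
      also have "\<dots> < e\<^sup>2" using N[OF that(1), of n] by (simp add: sum_nonneg)
      finally show ?thesis using e by (metis power2_less_imp_less less_imp_le)
    qed
    show "\<exists>M. \<forall>m\<ge>M. \<forall>n\<ge>M. norm ((\<Sum>i<m. a i *\<^sub>R \<phi> i) - (\<Sum>i<n. a i *\<^sub>R \<phi> i)) < e"
    proof (intro exI[of _ N] allI impI)
      fix m n assume mn: "N \<le> m" "N \<le> n"
      show "norm ((\<Sum>i<m. a i *\<^sub>R \<phi> i) - (\<Sum>i<n. a i *\<^sub>R \<phi> i)) < e"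
      proof (cases "m \<le> n")
        case True
        then show ?thesis using lt[OF mn(1) True] by (simp only: norm_minus_commute)
      qed (use lt[of n m] mn in simp)
    qed
  qed
  then obtain x where x: "(\<lambda>n. a n *\<^sub>R \<phi> n) sums x"
    using Cauchy_convergent convergent_def sums_def by blast
  have "x \<bullet> \<phi> m = a m" for m
  proof -
    have "(\<lambda>n. (a n *\<^sub>R \<phi> n) \<bullet> \<phi> m) sums (x \<bullet> \<phi> m)"
      by (rule bounded_linear.sums[OF bounded_linear_inner_left x])
    then have "(\<lambda>n. if n = m then a n else 0) sums (x \<bullet> \<phi> m)"
      by (simp add: ort if_distrib cong: if_cong)
    moreover have "(\<lambda>n. if n = m then a n else 0) sums a m"
      using sums_single[of m a] by simp
    ultimately show ?thesis by (rule sums_unique2)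
  qed
  then show ?thesis using that x by blast
qed

section \<open>Completeness of the eigenvectors delivered by \<open>eigensequence\<close>\<close>

context compact_positive_operator
begin

context
  fixes \<phi> :: "nat \<Rightarrow> 'a" and \<kappa> :: "nat \<Rightarrow> real"
  assumes ort: "\<And>m n. \<phi> m \<bullet> \<phi> n = (if m = n then 1 else 0)"
    and \<kappa>_pos: "\<And>n. 0 < \<kappa> n" and eigen: "\<And>n. K (\<phi> n) = \<kappa> n *\<^sub>R \<phi> n"
    and max: "\<And>n y. (\<And>i. i < n \<Longrightarrow> y \<bullet> \<phi> i = 0) \<Longrightarrow> K y \<bullet> y \<le> \<kappa> n * (norm y)\<^sup>2"
begin

lemma eigenvalues_decreasing: "m \<le> n \<Longrightarrow> \<kappa> n \<le> \<kappa> m"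
  using max[of m "\<phi> n"] eigen[of n] ort by (simp add: power2_norm_eq_inner)

text \<open>A decreasing positive sequence that does not tend to 0 stays above some
  \<open>c > 0\<close>. Then the images of distinct \<open>\<phi> n\<close> are more than
  \<open>c\<close> apart, by Pythagoras, and no subsequence of them is Cauchy.\<close>

lemma eigenvalues_tendsto_0: "\<kappa> \<longlonglongrightarrow> 0"
proof (rule ccontr)
  assume not0: "\<not> \<kappa> \<longlonglongrightarrow> 0"
  have "\<exists>c>0. \<forall>n. c \<le> \<kappa> n"
  proof (rule ccontr)
    assume neg: "\<not> (\<exists>c>0. \<forall>n. c \<le> \<kappa> n)"
    have "\<kappa> \<longlonglongrightarrow> 0"
    proof (rule LIMSEQ_I)
      fix r :: real assume "0 < r"
      then obtain N where "\<kappa> N < r" using neg by (meson not_le)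
      then show "\<exists>no. \<forall>n\<ge>no. norm (\<kappa> n - 0) < r"
        using eigenvalues_decreasing \<kappa>_pos by (intro exI[of _ N]) (force simp: abs_of_pos)
    qed
    with not0 show False by simp
  qed
  then obtain c where c: "c > 0" "\<And>n. c \<le> \<kappa> n" by blast
  obtain r l where r: "strict_mono (r::nat \<Rightarrow> nat)" and l: "(\<lambda>n. K (\<phi> (r n))) \<longlonglongrightarrow> l"
    using compact[of \<phi>] ort by (auto simp: norm_eq_sqrt_inner)
  from l have "Cauchy (\<lambda>n. K (\<phi> (r n)))" by (rule LIMSEQ_imp_Cauchy)
  then obtain N where N: "\<And>m n. m \<ge> N \<Longrightarrow> n \<ge> N \<Longrightarrow> norm (K (\<phi> (r m)) - K (\<phi> (r n))) < c"
    using c(1) by (meson CauchyD)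
  let ?m = "r N" and ?n = "r (Suc N)"
  have neq: "?m \<noteq> ?n" using r by (simp add: strict_mono_eq)
  have "(norm (K (\<phi> ?m) - K (\<phi> ?n)))\<^sup>2 = (\<kappa> ?m)\<^sup>2 + (\<kappa> ?n)\<^sup>2"
    unfolding power2_norm_eq_inner
    using neq by (simp add: eigen inner_diff_left inner_diff_right ort power2_eq_square)
  moreover have "c\<^sup>2 \<le> (\<kappa> ?m)\<^sup>2" using c by (intro power_mono) auto
  moreover have "(norm (K (\<phi> ?m) - K (\<phi> ?n)))\<^sup>2 < c\<^sup>2"
    using N[of N "Suc N"] by (intro power_strict_mono) auto
  ultimately show False using zero_le_power2[of "\<kappa> ?n"] by linarith
qed

text \<open>Such an \<open>x\<close> is admissible in the maximum property of every
  \<open>n\<close>, so \<open>K x \<bullet> x\<close> is at most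
  \<open>\<kappa> n * (norm x)\<^sup>2\<close>, which tends to 0.\<close>

lemma orthogonal_imp_zero: "(\<And>n. x \<bullet> \<phi> n = 0) \<Longrightarrow> x = 0"
proof (rule ccontr)
  assume x: "\<And>n. x \<bullet> \<phi> n = 0" and "x \<noteq> 0"
  have "K x \<bullet> x \<le> \<kappa> n * (norm x)\<^sup>2" for n using max x by blast
  moreover have "(\<lambda>n. \<kappa> n * (norm x)\<^sup>2) \<longlonglongrightarrow> 0 * (norm x)\<^sup>2"
    by (intro tendsto_intros eigenvalues_tendsto_0)
  ultimately have "K x \<bullet> x \<le> 0 * (norm x)\<^sup>2"
    by (intro LIMSEQ_le_const) auto
  then show False using positive[OF \<open>x \<noteq> 0\<close>] by simp
qed

text \<open>The series converges by Bessel and Riesz--Fischer, and \<open>x\<close> minus its sum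
  has only zero coordinates.\<close>

lemma expansion: "(\<lambda>n. (x \<bullet> \<phi> n) *\<^sub>R \<phi> n) sums x"
proof -
  obtain y where y: "(\<lambda>n. (x \<bullet> \<phi> n) *\<^sub>R \<phi> n) sums y" "\<And>n. y \<bullet> \<phi> n = x \<bullet> \<phi> n"
    using Riesz_Fischer[OF ort Bessel_summable[OF ort, of x]] by blast
  have "x - y = 0" by (rule orthogonal_imp_zero) (simp add: inner_diff_left y)
  then show ?thesis using y(1) by simp
qed

end

end

subsection \<open>The real Hilbert space L2(0,1)\<close>

definition square_integrable :: "(real \<Rightarrow> real) \<Rightarrow> bool" where
  "square_integrable f \<longleftrightarrow> f \<in> borel_measurable I01 \<and> integrable I01 (\<lambda>x. (f x)\<^sup>2)"

lemma finite_measure_I01: "finite_measure I01"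
  by (rule finite_measure_lebesgue_on) simp

interpretation I01: finite_measure I01
  by (rule finite_measure_I01)

lemma measure_I01 [simp]: "measure I01 {0..1} = 1"
  by (simp add: measure_restrict_space)

lemma square_integrableD [measurable_dest]: "square_integrable f \<Longrightarrow> f \<in> borel_measurable I01"
  by (simp add: square_integrable_def)

lemma integrable_square: "square_integrable f \<Longrightarrow> integrable I01 (\<lambda>x. (f x)\<^sup>2)"
  by (simp add: square_integrable_def)

lemma integrable_mult_square:
  assumes "square_integrable f" "square_integrable g"
  shows "integrable I01 (\<lambda>x. f x * g x)"
proof (rule Bochner_Integration.integrable_bound)
  show "integrable I01 (\<lambda>x. (f x)\<^sup>2 + (g x)\<^sup>2)"
    using assms by (intro Bochner_Integration.integrable_add integrable_square)
  show "(\<lambda>x. f x * g x) \<in> borel_measurable I01" using assms by (intro borel_measurable_times square_integrableD)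
  have "\<bar>f x * g x\<bar> \<le> (f x)\<^sup>2 + (g x)\<^sup>2" for x
    using sum_squares_bound[of "\<bar>f x\<bar>" "\<bar>g x\<bar>"] zero_le_power2[of "f x"] zero_le_power2[of "g x"]
      abs_ge_zero[of "f x * g x"] unfolding abs_mult power2_abs by linarith
  then show "AE x in I01. norm (f x * g x) \<le> norm ((f x)\<^sup>2 + (g x)\<^sup>2)" by (intro AE_I2) simp
qed

lemma square_integrable_bounded:
  assumes "f \<in> borel_measurable I01" "\<And>x. x \<in> {0..1} \<Longrightarrow> \<bar>f x\<bar> \<le> B"
  shows "square_integrable f"
proof -
  have "integrable I01 (\<lambda>x. (f x)\<^sup>2)"
  proof (rule I01.integrable_const_bound[of _ "B\<^sup>2"])
    show "AE x in I01. norm ((f x)\<^sup>2) \<le> B\<^sup>2"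
      using assms(2) by (intro AE_I2) (simp add: abs_le_square_iff[symmetric], force)
  qed (use assms(1) in measurable)
  then show ?thesis using assms(1) by (simp add: square_integrable_def)
qed

lemma square_integrable_const [simp]: "square_integrable (\<lambda>x. c)"
  by (rule square_integrable_bounded[of _ "\<bar>c\<bar>"]) auto

lemma square_integrable_integrable: "square_integrable f \<Longrightarrow> integrable I01 f"
  using integrable_mult_square[OF _ square_integrable_const[of 1], of f] by simp

lemma square_integrable_add [simp]:
  assumes "square_integrable f" "square_integrable g"
  shows "square_integrable (\<lambda>x. f x + g x)"
proof -
  have "integrable I01 (\<lambda>x. (f x)\<^sup>2 + 2 * (f x * g x) + (g x)\<^sup>2)"
    using assms by (intro Bochner_Integration.integrable_add integrable_square integrable_mult_right integrable_mult_square)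
  then show ?thesis using assms
    by (auto simp: square_integrable_def power2_sum algebra_simps)
qed

lemma square_integrable_scale [simp]:
  assumes "square_integrable f" shows "square_integrable (\<lambda>x. c * f x)"
  using assms by (auto simp: square_integrable_def power_mult_distrib)

lemma square_integrable_uminus [simp]: "square_integrable f \<Longrightarrow> square_integrable (\<lambda>x. - f x)"
  using square_integrable_scale[of f "-1"] by simp

lemma square_integrable_diff [simp]:
  "square_integrable f \<Longrightarrow> square_integrable g \<Longrightarrow> square_integrable (\<lambda>x. f x - g x)"
  using square_integrable_add[of f "\<lambda>x. - g x"] by simp

lemma square_integrable_abs [simp]: "square_integrable f \<Longrightarrow> square_integrable (\<lambda>x. \<bar>f x\<bar>)"
  by (auto simp: square_integrable_def)

\<comment> \<open>Passing to classes modulo null sets makes the inner product definite, as the class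
  \<open>real_inner\<close> requires. The relation is partial because representatives have the full
  function type and must be restricted to square integrable ones.\<close>
quotient_type rL2 = "real \<Rightarrow> real" / partial:
  "\<lambda>f g. square_integrable f \<and> square_integrable g \<and> (AE x in I01. f x = g x)"
proof (rule part_equivpI)
  show "\<exists>f. square_integrable f \<and> square_integrable f \<and> (AE x in I01. f x = f x)"
    by (intro exI[of _ "\<lambda>x. 0"]) simp
  show "symp (\<lambda>f g. square_integrable f \<and> square_integrable g \<and> (AE x in I01. f x = g x))"
    by (auto simp: symp_def eq_commute)
  show "transp (\<lambda>f g. square_integrable f \<and> square_integrable g \<and> (AE x in I01. f x = g x))"
  proof (rule transpI, intro conjI; (elim conjE)?)
    fix f g h :: "real \<Rightarrow> real"
    assume "AE x in I01. f x = g x" "AE x in I01. g x = h x"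
    then show "AE x in I01. f x = h x" by eventually_elim simp
  qed
qed

lemma rL2_cases: obtains f where "square_integrable f" "x = abs_rL2 f"
  using that[of "rep_rL2 x"] Quotient3_abs_rep[OF Quotient3_rL2, of x]
    Quotient3_rep_reflp[OF Quotient3_rL2, of x] by simp

lemma abs_rL2_eq_iff:
  "square_integrable f \<Longrightarrow> square_integrable g \<Longrightarrow> abs_rL2 f = abs_rL2 g \<longleftrightarrow> (AE x in I01. f x = g x)"
  using Quotient3_rel[OF Quotient3_rL2, of f g] by simp

instantiation rL2 :: real_inner
begin

lift_definition zero_rL2 :: rL2 is "\<lambda>x. 0" by simp
lift_definition plus_rL2 :: "rL2 \<Rightarrow> rL2 \<Rightarrow> rL2" is "\<lambda>f g x. f x + g x" by auto
lift_definition minus_rL2 :: "rL2 \<Rightarrow> rL2 \<Rightarrow> rL2" is "\<lambda>f g x. f x - g x" by auto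
lift_definition uminus_rL2 :: "rL2 \<Rightarrow> rL2" is "\<lambda>f x. - f x" by auto
lift_definition scaleR_rL2 :: "real \<Rightarrow> rL2 \<Rightarrow> rL2" is "\<lambda>c f x. c * f x" by auto
lift_definition inner_rL2 :: "rL2 \<Rightarrow> rL2 \<Rightarrow> real" is "\<lambda>f g. LINT x|I01. f x * g x"
  by (intro integral_cong_AE) auto
definition norm_rL2 :: "rL2 \<Rightarrow> real" where "norm_rL2 x = sqrt (x \<bullet> x)"
definition sgn_rL2 :: "rL2 \<Rightarrow> rL2" where "sgn_rL2 x = inverse (norm x) *\<^sub>R x"
definition dist_rL2 :: "rL2 \<Rightarrow> rL2 \<Rightarrow> real" where "dist_rL2 x y = norm (x - y)"
definition uniformity_rL2 :: "(rL2 \<times> rL2) filter" where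
  "uniformity_rL2 = (INF e\<in>{0<..}. principal {(x, y). dist x y < e})"
definition open_rL2 :: "rL2 set \<Rightarrow> bool" where
  "open_rL2 U \<longleftrightarrow> (\<forall>x\<in>U. eventually (\<lambda>(x', y). x' = x \<longrightarrow> y \<in> U) uniformity)"

instance
proof
  fix x y z :: rL2 and a b :: real
  obtain f where f: "square_integrable f" "x = abs_rL2 f" by (rule rL2_cases)
  obtain g where g: "square_integrable g" "y = abs_rL2 g" by (rule rL2_cases)
  obtain h where h: "square_integrable h" "z = abs_rL2 h" by (rule rL2_cases)
  note simps = zero_rL2_def plus_rL2.abs_eq minus_rL2.abs_eq uminus_rL2.abs_eq scaleR_rL2.abs_eq
    inner_rL2.abs_eq f g h
  show "x + y + z = x + (y + z)" by (simp add: simps add.assoc)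
  show "x + y = y + x" by (simp add: simps add.commute)
  show "0 + x = x" by (simp add: simps)
  show "- x + x = 0" by (simp add: simps)
  show "x - y = x + - y" by (simp add: simps)
  show "a *\<^sub>R (x + y) = a *\<^sub>R x + a *\<^sub>R y" by (simp add: simps distrib_left)
  show "(a + b) *\<^sub>R x = a *\<^sub>R x + b *\<^sub>R x" by (simp add: simps distrib_right)
  show "a *\<^sub>R b *\<^sub>R x = (a * b) *\<^sub>R x" by (simp add: simps mult.assoc)
  show "1 *\<^sub>R x = x" by (simp add: simps)
  show "x \<bullet> y = y \<bullet> x" by (simp add: simps mult.commute)
  show "(x + y) \<bullet> z = x \<bullet> z + y \<bullet> z"
    using f g h by (simp add: simps distrib_right integrable_mult_square)
  show "(a *\<^sub>R x) \<bullet> y = a * (x \<bullet> y)"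
    using f g by (simp add: simps mult.assoc)
  show "0 \<le> x \<bullet> x" by (simp add: simps)
  have "(LINT x|I01. f x * f x) = 0 \<longleftrightarrow> (AE x in I01. f x = 0)"
    using f by (subst integral_nonneg_eq_0_iff_AE) (auto simp: integrable_mult_square)
  then show "x \<bullet> x = 0 \<longleftrightarrow> x = 0"
    using f by (simp add: simps abs_rL2_eq_iff)
  show "norm x = sqrt (x \<bullet> x)" by (simp add: norm_rL2_def)
  show "sgn x = inverse (norm x) *\<^sub>R x" by (simp add: sgn_rL2_def)
  show "dist x y = norm (x - y)" by (simp add: dist_rL2_def)
qed (rule uniformity_rL2_def open_rL2_def)+

end

lemma inner_abs_rL2:
  "square_integrable f \<Longrightarrow> square_integrable g \<Longrightarrow> abs_rL2 f \<bullet> abs_rL2 g = (LINT x|I01. f x * g x)"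
  by (simp add: inner_rL2.abs_eq)

lemma norm_abs_rL2:
  "square_integrable f \<Longrightarrow> (norm (abs_rL2 f))\<^sup>2 = (LINT x|I01. (f x)\<^sup>2)"
  unfolding power2_norm_eq_inner by (simp add: inner_abs_rL2 power2_eq_square)

lemma abs_rL2_add: "square_integrable f \<Longrightarrow> square_integrable g \<Longrightarrow>
    abs_rL2 (\<lambda>x. f x + g x) = abs_rL2 f + abs_rL2 g"
  by (simp add: plus_rL2.abs_eq)

lemma abs_rL2_diff: "square_integrable f \<Longrightarrow> square_integrable g \<Longrightarrow>
    abs_rL2 (\<lambda>x. f x - g x) = abs_rL2 f - abs_rL2 g"
  by (simp add: minus_rL2.abs_eq)

lemma abs_rL2_scale: "square_integrable f \<Longrightarrow> abs_rL2 (\<lambda>x. c * f x) = c *\<^sub>R abs_rL2 f"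
  by (simp add: scaleR_rL2.abs_eq)

lemma abs_rL2_eq_0_iff: "square_integrable f \<Longrightarrow> abs_rL2 f = 0 \<longleftrightarrow> (AE x in I01. f x = 0)"
  by (simp add: zero_rL2_def abs_rL2_eq_iff)

text \<open>Cauchy--Schwarz against the constant 1, whose norm is 1 on the unit interval.\<close>

lemma integral_abs_le_norm:
  assumes "square_integrable f" shows "(LINT x|I01. \<bar>f x\<bar>) \<le> norm (abs_rL2 f)"
proof -
  have "(LINT x|I01. \<bar>f x\<bar>) = abs_rL2 (\<lambda>x. \<bar>f x\<bar>) \<bullet> abs_rL2 (\<lambda>x. 1)"
    using assms by (simp add: inner_abs_rL2)
  also have "\<dots> \<le> norm (abs_rL2 (\<lambda>x. \<bar>f x\<bar>)) * norm (abs_rL2 (\<lambda>x. 1))"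
    by (rule norm_cauchy_schwarz)
  also have "norm (abs_rL2 (\<lambda>x. 1)) = 1"
    using norm_abs_rL2[of "\<lambda>x. 1"]
    by (simp add: power2_eq_1_iff) (use norm_ge_zero[of "abs_rL2 (\<lambda>x. 1)"] in linarith)
  also have "norm (abs_rL2 (\<lambda>x. \<bar>f x\<bar>)) = norm (abs_rL2 f)"
  proof (rule power2_eq_imp_eq)
    show "(norm (abs_rL2 (\<lambda>x. \<bar>f x\<bar>)))\<^sup>2 = (norm (abs_rL2 f))\<^sup>2"
      using assms by (simp add: norm_abs_rL2)
  qed simp_all
  finally show ?thesis by simp
qed

lemma norm_rL2_bounded:
  assumes "square_integrable f" "\<And>x. x \<in> {0..1} \<Longrightarrow> \<bar>f x\<bar> \<le> B"
  shows "norm (abs_rL2 f) \<le> B"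
proof (rule power2_le_imp_le)
  have "(norm (abs_rL2 f))\<^sup>2 \<le> (LINT x|I01. B\<^sup>2)"
    unfolding norm_abs_rL2[OF assms(1)]
    using assms by (intro integral_mono integrable_square)
      (auto simp: abs_le_square_iff[symmetric], force)
  then show "(norm (abs_rL2 f))\<^sup>2 \<le> B\<^sup>2" by simp
  show "0 \<le> B" using assms(2)[of 0] by simp
qed

text \<open>The L1 norms of the increments are dominated by their L2 norms and hence summable. By
  monotone convergence the increments are absolutely summable almost everywhere, and the sequence
  telescopes.\<close>

lemma AE_convergent_of_summable_norm:
  assumes F: "\<And>k. square_integrable (u k)"
    and le: "\<And>k. norm (abs_rL2 (u (Suc k)) - abs_rL2 (u k)) \<le> (1/2) ^ k"
  shows "AE x in I01. convergent (\<lambda>k. u k x)"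
proof -
  define h where "h k x = u (Suc k) x - u k x" for k x
  have h: "square_integrable (h k)" for k using F by (simp add: h_def[abs_def])
  have int: "(\<integral>\<^sup>+x. ennreal \<bar>h k x\<bar> \<partial>I01) \<le> ennreal ((1/2) ^ k)" for k
  proof -
    have "(\<integral>\<^sup>+x. ennreal \<bar>h k x\<bar> \<partial>I01) = ennreal (LINT x|I01. \<bar>h k x\<bar>)"
      using square_integrable_integrable[OF h] by (intro nn_integral_eq_integral) auto
    also have "(LINT x|I01. \<bar>h k x\<bar>) \<le> (1/2) ^ k"
      using integral_abs_le_norm[OF h[of k]] le[of k] F by (simp add: h_def[abs_def] abs_rL2_diff)
    finally show ?thesis by (simp add: ennreal_leI)
  qed
  have "(\<integral>\<^sup>+x. (\<Sum>k. ennreal \<bar>h k x\<bar>) \<partial>I01) = (\<Sum>k. \<integral>\<^sup>+x. ennreal \<bar>h k x\<bar> \<partial>I01)"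
    using square_integrableD[OF h] by (intro nn_integral_suminf) measurable
  also have "\<dots> \<le> (\<Sum>k. ennreal ((1/2) ^ k))" by (intro suminf_le int) auto
  also have "\<dots> < \<infinity>" by (simp add: ennreal_suminf_neq_top less_top summable_geometric)
  finally have "(\<integral>\<^sup>+x. (\<Sum>k. ennreal \<bar>h k x\<bar>) \<partial>I01) \<noteq> \<infinity>" by simp
  then have "AE x in I01. (\<Sum>k. ennreal \<bar>h k x\<bar>) \<noteq> \<infinity>"
    using square_integrableD[OF h] by (intro nn_integral_noteq_infinite) measurable
  then show ?thesis
  proof eventually_elim
    case (elim x)
    then have "summable (\<lambda>k. \<bar>h k x\<bar>)" by (intro summable_suminf_not_top) auto
    then have "summable (\<lambda>k. h k x)" by (rule summable_rabs_cancel)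
    then have "convergent (\<lambda>n. \<Sum>k<n. h k x)" by (simp add: summable_iff_convergent)
    moreover have "(\<Sum>k<n. h k x) = u n x - u 0 x" for n
      unfolding h_def by (rule sum_lessThan_telescope)
    ultimately have "convergent (\<lambda>n. u n x - u 0 x)" by simp
    from convergent_add[OF this convergent_const[of "u 0 x"]] show ?case by simp
  qed
qed

text \<open>A rapidly Cauchy choice of indices has an almost everywhere limit, and Fatou's lemma
  shows that the whole sequence converges to it in norm.\<close>

instance rL2 :: complete_space
proof
  fix X :: "nat \<Rightarrow> rL2" assume C: "Cauchy X"
  have "\<exists>f. square_integrable f \<and> X n = abs_rL2 f" for n using rL2_cases by blast
  then obtain F where F: "\<And>n. square_integrable (F n)" "\<And>n. X n = abs_rL2 (F n)" by metis
  have "\<exists>N. \<forall>m\<ge>N. \<forall>n\<ge>N. norm (X m - X n) < e" if "e > 0" for e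
    using CauchyD[OF C that] .
  then obtain N where N: "\<And>e m n. e > 0 \<Longrightarrow> m \<ge> N e \<Longrightarrow> n \<ge> N e \<Longrightarrow> norm (X m - X n) < e" by metis
  \<comment> \<open>The maximum over all \<open>j \<le> k\<close> puts both \<open>r k\<close> and
    \<open>r (Suc k)\<close> beyond the threshold for \<open>(1/2) ^ k\<close>. Using
    \<open>max k (r k)\<close> as the index in \<open>u\<close> also puts \<open>u k\<close> beyond
    any threshold below \<open>k\<close>.\<close>
  define r where "r k = (MAX j\<in>{..k}. N ((1/2) ^ j))" for k
  have r_ge: "N ((1/2) ^ k) \<le> r k" "N ((1/2) ^ k) \<le> r (Suc k)" for k
    unfolding r_def by (rule Max_ge; simp)+
  define u where "u k = F (max k (r k))" for k
  have u: "square_integrable (u k)" for k by (simp add: u_def F)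
  have uX: "abs_rL2 (u k) = X (max k (r k))" for k by (simp add: u_def F)
  have "AE x in I01. convergent (\<lambda>k. u k x)"
  proof (rule AE_convergent_of_summable_norm[OF u])
    fix k show "norm (abs_rL2 (u (Suc k)) - abs_rL2 (u k)) \<le> (1/2) ^ k"
      unfolding uX by (intro less_imp_le[OF N]) (use r_ge[of k] in auto)
  qed
  moreover define f where "f x = lim (\<lambda>k. u k x)" for x
  ultimately have lim: "AE x in I01. (\<lambda>k. u k x) \<longlonglongrightarrow> f x"
    by (simp add: convergent_LIMSEQ_iff)
  have f [measurable]: "f \<in> borel_measurable I01"
    unfolding f_def using square_integrableD[OF u] by (intro borel_measurable_lim_metric)
  have um [measurable]: "u k \<in> borel_measurable I01" for k using u by (rule square_integrableD)
  \<comment> \<open>Fatou: the distance from \<open>u k\<close> to the almost everywhere limit is at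
    most the lower limit of its distances to \<open>u j\<close>.\<close>
  have key: "square_integrable (\<lambda>x. f x - u k x) \<and> norm (abs_rL2 (\<lambda>x. f x - u k x)) \<le> e"
    if e: "e > 0" and k: "k \<ge> N e" for e k
  proof -
    have "(\<integral>\<^sup>+x. ennreal ((f x - u k x)\<^sup>2) \<partial>I01) = (\<integral>\<^sup>+x. liminf (\<lambda>j. ennreal ((u j x - u k x)\<^sup>2)) \<partial>I01)"
    proof (rule nn_integral_cong_AE, use lim in eventually_elim)
      fix x assume "(\<lambda>k. u k x) \<longlonglongrightarrow> f x"
      then have "(\<lambda>j. ennreal ((u j x - u k x)\<^sup>2)) \<longlonglongrightarrow> ennreal ((f x - u k x)\<^sup>2)"
        by (intro tendsto_intros)
      then show "ennreal ((f x - u k x)\<^sup>2) = liminf (\<lambda>j. ennreal ((u j x - u k x)\<^sup>2))"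
        using lim_imp_Liminf[OF sequentially_bot] by (metis (lifting))
    qed
    also have "\<dots> \<le> liminf (\<lambda>j. \<integral>\<^sup>+x. ennreal ((u j x - u k x)\<^sup>2) \<partial>I01)"
      by (rule nn_integral_liminf) measurable
    also have "\<dots> \<le> ennreal (e\<^sup>2)"
    proof -
      have "(\<integral>\<^sup>+x. ennreal ((u j x - u k x)\<^sup>2) \<partial>I01) \<le> ennreal (e\<^sup>2)" if "j \<ge> N e" for j
      proof -
        have "(\<integral>\<^sup>+x. ennreal ((u j x - u k x)\<^sup>2) \<partial>I01) = ennreal (LINT x|I01. (u j x - u k x)\<^sup>2)"
          using u by (intro nn_integral_eq_integral integrable_square) auto
        also have "(LINT x|I01. (u j x - u k x)\<^sup>2) = (norm (X (max j (r j)) - X (max k (r k))))\<^sup>2"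
          using u by (simp add: norm_abs_rL2[symmetric] abs_rL2_diff uX)
        also have "\<dots> \<le> e\<^sup>2"
          using that k by (intro power_mono less_imp_le[OF N[OF e]]) auto
        finally show ?thesis by (simp add: ennreal_leI)
      qed
      then have "eventually (\<lambda>j. (\<integral>\<^sup>+x. ennreal ((u j x - u k x)\<^sup>2) \<partial>I01) \<le> ennreal (e\<^sup>2)) sequentially"
        by (auto simp: eventually_sequentially)
      from Liminf_mono[OF this] show ?thesis by (simp add: Liminf_const)
    qed
    finally have le: "(\<integral>\<^sup>+x. ennreal ((f x - u k x)\<^sup>2) \<partial>I01) \<le> ennreal (e\<^sup>2)" .
    have int: "integrable I01 (\<lambda>x. (f x - u k x)\<^sup>2)"
      by (rule integrableI_bounded) (use le in \<open>auto intro: le_less_trans\<close>)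
    then have sq: "square_integrable (\<lambda>x. f x - u k x)" by (simp add: square_integrable_def)
    have "ennreal ((norm (abs_rL2 (\<lambda>x. f x - u k x)))\<^sup>2) \<le> ennreal (e\<^sup>2)"
      using le nn_integral_eq_integral[OF int] by (simp add: norm_abs_rL2[OF sq])
    then have "(norm (abs_rL2 (\<lambda>x. f x - u k x)))\<^sup>2 \<le> e\<^sup>2" by simp
    then show ?thesis using sq e by (auto intro: power2_le_imp_le)
  qed
  have "square_integrable (\<lambda>x. (f x - u (N 1) x) + u (N 1) x)"
    using key[of 1 "N 1"] u by (intro square_integrable_add) auto
  then have sf: "square_integrable f" by simp
  have "X \<longlonglongrightarrow> abs_rL2 f"
  proof (rule LIMSEQ_I)
    fix e :: real assume e: "e > 0"
    have "norm (X n - abs_rL2 f) < e" if n: "n \<ge> N (e/3)" for n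
    proof -
      have 1: "norm (abs_rL2 f - abs_rL2 (u n)) \<le> e/3"
        using key[of "e/3" n] n e sf u by (simp add: abs_rL2_diff)
      have 2: "norm (X n - abs_rL2 (u n)) < e/3" unfolding uX using n e by (intro N) auto
      have "X n - abs_rL2 f = (X n - abs_rL2 (u n)) - (abs_rL2 f - abs_rL2 (u n))" by simp
      then have "norm (X n - abs_rL2 f) \<le> norm (X n - abs_rL2 (u n)) + norm (abs_rL2 f - abs_rL2 (u n))"
        by (metis norm_triangle_ineq4)
      then show ?thesis using 1 2 e by linarith
    qed
    then show "\<exists>no. \<forall>n\<ge>no. norm (X n - abs_rL2 f) < e" by blast
  qed
  then show "convergent X" by (rule convergentI)
qed

text \<open>Indicators of the disjoint intervals between consecutive reciprocals form an infinite
  orthogonal family of nonzero vectors.\<close>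

lemma infinite_dim_rL2: "finite S \<Longrightarrow> span S \<noteq> (UNIV :: rL2 set)"
proof
  assume S: "finite S" "span S = (UNIV :: rL2 set)"
  define J where "J n = {1 / real (n + 2)<..<1 / real (n + 1)}" for n
  define b where "b n = abs_rL2 (indicator (J n))" for n
  have sub: "J n \<subseteq> {0..1}" for n by (auto simp: J_def field_simps) (smt (verit, best) of_nat_0_le_iff mult_nonneg_nonneg)+
  have J[measurable]: "J n \<in> sets I01" for n using sub by (simp add: sets_restrict_space_iff) (simp add: J_def)
  have sq: "square_integrable (indicator (J n))" for n
    by (rule square_integrable_bounded[of _ 1]) (auto simp: indicator_def)
  have meas: "measure I01 (J n) > 0" for n
  proof -
    have "measure I01 (J n) = 1 / real (n + 1) - 1 / real (n + 2)"
      using sub by (subst measure_restrict_space) (auto simp: J_def divide_simps)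
    moreover have "1 / real (n + 2) < 1 / real (n + 1)" by (intro divide_strict_left_mono) auto
    ultimately show ?thesis by linarith
  qed
  have disj: "J m \<inter> J n = {}" if "m < n" for m n
  proof -
    have "1 / real (n + 1) \<le> 1 / real (m + 2)" using that by (intro divide_left_mono) auto
    then show ?thesis by (auto simp: J_def)
  qed
  have 0: "b m \<bullet> b n = 0" if "m \<noteq> n" for m n
  proof -
    have "J m \<inter> J n = {}" using disj[of m n] disj[of n m] that by (cases m n rule: linorder_cases) auto
    then show ?thesis by (simp add: b_def inner_abs_rL2 sq indicator_inter_arith[symmetric])
  qed
  have 1: "b n \<bullet> b n > 0" for n
    using meas[of n] sub[of n] by (simp add: b_def inner_abs_rL2 sq indicator_inter_arith[symmetric] Int_absorb2)
  have inj: "inj b" using 0 1 by (metis injI less_irrefl)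
  \<comment> \<open>The index set has \<open>card S + 1\<close> elements, one more than an
    independent subset of \<open>span S\<close> can have.\<close>
  have "independent (b ` {..card S})"
  proof (rule pairwise_orthogonal_independent)
    show "pairwise orthogonal (b ` {..card S})"
      unfolding pairwise_def orthogonal_def using 0 by (metis imageE)
    show "0 \<notin> b ` {..card S}" using 1 by (metis imageE inner_zero_left less_irrefl)
  qed
  then have "card (b ` {..card S}) \<le> card S"
    using S independent_span_bound[of S "b ` {..card S}"] by auto
  then show False using inj by (simp add: card_image inj_on_subset)
qed

interpretation I01_pair: pair_sigma_finite I01 I01 ..

lemma measurable_ident_I01 [measurable]: "(\<lambda>x. x) \<in> measurable I01 borel"
  by (intro measurable_restrict_space1 measurable_completion) simp

subsection \<open>Green operator of the form\<close>

lemma AE_I01_neq: "AE x in I01. x \<noteq> a"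
proof -
  have "AE x in lebesgue. x \<noteq> a" by (intro AE_completion AE_lborel_singleton)
  then show ?thesis by (subst AE_restrict_space_iff) auto
qed

text \<open>The kernel is the solution of \<open>- u'' = delta\<close> at \<open>y\<close> under
  \<open>u'(0) = u(0) + u(1) = - u'(1)\<close>, the boundary conditions hidden in the form. The
  value type is left open so that the same operator acts on real and on complex functions.\<close>

definition green :: "(real \<Rightarrow> 'a::{banach,second_countable_topology}) \<Rightarrow> real \<Rightarrow> 'a" where
  "green f x = (LINT y|I01. ((1 - \<bar>x - y\<bar>) / 2) *\<^sub>R f y)"

lemma integrable_bounded_scaleR:
  fixes f :: "real \<Rightarrow> 'a::{banach,second_countable_topology}"
  assumes "integrable I01 f" "k \<in> borel_measurable I01" "\<And>y. y \<in> {0..1} \<Longrightarrow> \<bar>k y\<bar> \<le> C"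
  shows "integrable I01 (\<lambda>y. k y *\<^sub>R f y)"
proof (rule Bochner_Integration.integrable_bound)
  show "integrable I01 (\<lambda>y. C * norm (f y))" using assms(1) by auto
  show "(\<lambda>y. k y *\<^sub>R f y) \<in> borel_measurable I01" using assms(1,2) by measurable
  show "AE y in I01. norm (k y *\<^sub>R f y) \<le> norm (C * norm (f y))"
    using assms(3) by (intro AE_I2) (fastforce simp: abs_mult intro!: mult_right_mono)
qed

lemma green_integrable:
  fixes f :: "real \<Rightarrow> 'a::{banach,second_countable_topology}"
  assumes "integrable I01 f"
  shows "integrable I01 (\<lambda>y. ((1 - \<bar>x - y\<bar>) / 2) *\<^sub>R f y)"
  by (rule integrable_bounded_scaleR[OF assms, of _ "2 + \<bar>x\<bar>"]) auto

text \<open>On the unit square the kernel lies between 0 and 1/2. This bound turns integral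
  estimates into uniform ones.\<close>

lemma green_norm_le:
  fixes f :: "real \<Rightarrow> 'a::{banach,second_countable_topology}"
  assumes f: "integrable I01 f" and x: "x \<in> {0..1}"
  shows "norm (green f x) \<le> (LINT y|I01. norm (f y)) / 2"
proof -
  have "norm (green f x) \<le> (LINT y|I01. norm (((1 - \<bar>x - y\<bar>) / 2) *\<^sub>R f y))"
    unfolding green_def by (rule integral_norm_bound)
  also have "\<dots> \<le> (LINT y|I01. 1/2 * norm (f y))"
  proof (rule integral_mono)
    fix y assume "y \<in> space I01"
    then have "\<bar>(1 - \<bar>x - y\<bar>) / 2\<bar> \<le> 1/2" using x by auto
    then show "norm (((1 - \<bar>x - y\<bar>) / 2) *\<^sub>R f y) \<le> 1/2 * norm (f y)"
      unfolding norm_scaleR by (rule mult_right_mono) simp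
  next
    show "integrable I01 (\<lambda>y. norm (((1 - \<bar>x - y\<bar>) / 2) *\<^sub>R f y))"
      by (intro integrable_norm green_integrable f)
  qed (use f in auto)
  finally show ?thesis by simp
qed

text \<open>The kernel is Lipschitz in \<open>x\<close> with constant 1/2. The estimate supplies the
  equicontinuity for compactness.\<close>

lemma green_lipschitz:
  fixes f :: "real \<Rightarrow> 'a::{banach,second_countable_topology}"
  assumes f: "integrable I01 f"
  shows "norm (green f x - green f z) \<le> \<bar>x - z\<bar> / 2 * (LINT y|I01. norm (f y))"
proof -
  have eq: "green f x - green f z = (LINT y|I01. ((\<bar>z - y\<bar> - \<bar>x - y\<bar>) / 2) *\<^sub>R f y)"
    unfolding green_def
    by (subst Bochner_Integration.integral_diff[symmetric, OF green_integrable[OF f] green_integrable[OF f]])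
      (simp add: scaleR_left_diff_distrib[symmetric] diff_divide_distrib[symmetric])
  have int: "integrable I01 (\<lambda>y. ((\<bar>z - y\<bar> - \<bar>x - y\<bar>) / 2) *\<^sub>R f y)"
  proof (rule integrable_bounded_scaleR[OF f, of _ "\<bar>x - z\<bar>"])
    fix y have "\<bar>\<bar>z - y\<bar> - \<bar>x - y\<bar>\<bar> \<le> \<bar>x - z\<bar>" by arith
    then have "\<bar>\<bar>z - y\<bar> - \<bar>x - y\<bar>\<bar> / 2 \<le> \<bar>x - z\<bar>" using abs_ge_zero[of "x - z"] abs_ge_zero[of "\<bar>z - y\<bar> - \<bar>x - y\<bar>"] by linarith
    then show "\<bar>(\<bar>z - y\<bar> - \<bar>x - y\<bar>) / 2\<bar> \<le> \<bar>x - z\<bar>" by simp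
  qed simp
  have "norm (green f x - green f z) \<le> (LINT y|I01. norm (((\<bar>z - y\<bar> - \<bar>x - y\<bar>) / 2) *\<^sub>R f y))"
    unfolding eq by (rule integral_norm_bound)
  also have "\<dots> \<le> (LINT y|I01. \<bar>x - z\<bar> / 2 * norm (f y))"
  proof (rule integral_mono)
    fix y
    have "\<bar>(\<bar>z - y\<bar> - \<bar>x - y\<bar>) / 2\<bar> \<le> \<bar>x - z\<bar> / 2" by auto
    then show "norm (((\<bar>z - y\<bar> - \<bar>x - y\<bar>) / 2) *\<^sub>R f y) \<le> \<bar>x - z\<bar> / 2 * norm (f y)"
      unfolding norm_scaleR by (rule mult_right_mono) simp
  next
    show "integrable I01 (\<lambda>y. norm (((\<bar>z - y\<bar> - \<bar>x - y\<bar>) / 2) *\<^sub>R f y))"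
      by (rule integrable_norm[OF int])
  qed (use f in auto)
  finally show ?thesis by simp
qed

lemma green_measurable [measurable]:
  fixes f :: "real \<Rightarrow> 'a::{banach,second_countable_topology}"
  assumes f [measurable]: "integrable I01 f"
  shows "green f \<in> borel_measurable I01"
proof -
  have [measurable]: "f \<in> borel_measurable I01" using f by simp
  show ?thesis unfolding green_def by measurable
qed

lemma green_cong_AE:
  fixes f g :: "real \<Rightarrow> 'a::{banach,second_countable_topology}"
  assumes "integrable I01 f" "integrable I01 g" "AE x in I01. f x = g x"
  shows "green f = green g"
proof
  fix x show "green f x = green g x" unfolding green_def
    by (rule integral_cong_AE) (use assms in \<open>auto elim: AE_mp\<close>)
qed

text \<open>The product \<open>g x * f y\<close> is integrable on the square, and a bounded kernel
  preserves this, so the order of integration may be exchanged.\<close>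

lemma Fubini_kernel:
  fixes f g :: "real \<Rightarrow> 'a::{real_normed_field,banach,second_countable_topology}"
  assumes f: "integrable I01 f" and g: "integrable I01 g"
    and k [measurable]: "(\<lambda>(x, y). k x y) \<in> borel_measurable (I01 \<Otimes>\<^sub>M I01)"
    and bound: "\<And>x y. x \<in> {0..1} \<Longrightarrow> y \<in> {0..1} \<Longrightarrow> \<bar>k x y\<bar> \<le> C"
  shows "(LINT x|I01. g x * (LINT y|I01. k x y *\<^sub>R f y)) = (LINT y|I01. f y * (LINT x|I01. k x y *\<^sub>R g x))"
proof -
  have [measurable]: "f \<in> borel_measurable I01" "g \<in> borel_measurable I01" using f g by auto
  have "integrable (I01 \<Otimes>\<^sub>M I01) (\<lambda>(x, y). g x * f y)"
  proof (rule I01_pair.Fubini_integrable)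
    show "integrable I01 (\<lambda>x. LINT y|I01. norm (case (x, y) of (x, y) \<Rightarrow> g x * f y))"
      using g by (simp add: norm_mult)
    show "AE x in I01. integrable I01 (\<lambda>y. case (x, y) of (x, y) \<Rightarrow> g x * f y)"
      using f by simp
  qed measurable
  then have "integrable (I01 \<Otimes>\<^sub>M I01) (\<lambda>p. C * norm (case p of (x, y) \<Rightarrow> g x * f y))" by auto
  then have int: "integrable (I01 \<Otimes>\<^sub>M I01) (\<lambda>(x, y). k x y *\<^sub>R (g x * f y))"
  proof (rule Bochner_Integration.integrable_bound)
    show "AE p in I01 \<Otimes>\<^sub>M I01. norm (case p of (x, y) \<Rightarrow> k x y *\<^sub>R (g x * f y))
        \<le> norm (C * norm (case p of (x, y) \<Rightarrow> g x * f y))"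
    proof (rule AE_I2)
      fix p assume "p \<in> space (I01 \<Otimes>\<^sub>M I01)"
      then obtain x y where p: "p = (x, y)" "x \<in> {0..1}" "y \<in> {0..1}" by (auto simp: space_pair_measure)
      have "\<bar>k x y\<bar> \<le> \<bar>C\<bar>" using bound[OF p(2,3)] by simp
      then show "norm (case p of (x, y) \<Rightarrow> k x y *\<^sub>R (g x * f y)) \<le> norm (C * norm (case p of (x, y) \<Rightarrow> g x * f y))"
        unfolding p by (simp add: abs_mult mult_right_mono)
    qed
  qed measurable
  have "(LINT x|I01. g x * (LINT y|I01. k x y *\<^sub>R f y)) = (LINT x|I01. LINT y|I01. k x y *\<^sub>R (g x * f y))"
    by (simp flip: Bochner_Integration.integral_mult_right_zero)
  also have "\<dots> = (LINT y|I01. LINT x|I01. k x y *\<^sub>R (g x * f y))"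
    using I01_pair.Fubini_integral[OF int] by simp
  also have "\<dots> = (LINT y|I01. f y * (LINT x|I01. k x y *\<^sub>R g x))"
    by (simp add: mult.commute flip: Bochner_Integration.integral_mult_right_zero)
  finally show ?thesis .
qed

lemma green_symmetric:
  fixes f g :: "real \<Rightarrow> real"
  assumes "integrable I01 f" "integrable I01 g"
  shows "(LINT x|I01. g x * green f x) = (LINT x|I01. f x * green g x)"
proof -
  have "\<bar>(1 - \<bar>x - y\<bar>) / 2\<bar> \<le> 1" if "x \<in> {0..1}" "y \<in> {0..1}" for x y :: real
    using that by auto
  from Fubini_kernel[OF assms _ this] show ?thesis
    unfolding green_def by (simp add: abs_minus_commute)
qed

section \<open>Integrals over initial intervals\<close>

text \<open>\<open>H1\<close> integrates over a measure space that depends on \<open>x\<close>. An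
  indicator moves this dependence into the integrand, so that Fubini and dominated convergence apply
  on the fixed space \<open>I01\<close>.\<close>

lemma integral_lebesgue_on_initial:
  fixes w :: "real \<Rightarrow> 'a::{banach,second_countable_topology}"
  assumes "x \<in> {0..1}"
  shows "(LINT t|lebesgue_on {0..x}. w t) = (LINT t|I01. indicat_real {..x} t *\<^sub>R w t)"
proof -
  have "indicat_real {0..x} t = indicat_real {0..1} t * indicat_real {..x} t" for t
    using assms by (auto simp: indicator_def)
  then show ?thesis by (simp add: integral_restrict_space)
qed

lemma integrable_initial:
  fixes w :: "real \<Rightarrow> 'a::{banach,second_countable_topology}"
  assumes "integrable I01 w"
  shows "integrable I01 (\<lambda>t. indicat_real {..x} t *\<^sub>R w t)"
  by (rule integrable_bounded_scaleR[OF assms, of _ 1]) (auto simp: indicator_def)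

lemma integral_initial_measurable:
  fixes w :: "real \<Rightarrow> 'a::{banach,second_countable_topology}"
  assumes "integrable I01 w"
  shows "(\<lambda>x. LINT t|I01. indicat_real {..x} t *\<^sub>R w t) \<in> borel_measurable I01"
proof -
  have [measurable]: "w \<in> borel_measurable I01" using assms by simp
  have "(\<lambda>x. LINT t|I01. (if t \<le> x then 1 else 0 :: real) *\<^sub>R w t) \<in> borel_measurable I01" by measurable
  then show ?thesis by (simp add: indicator_def)
qed

lemma integral_initial_norm_le:
  fixes w :: "real \<Rightarrow> 'a::{banach,second_countable_topology}"
  assumes "integrable I01 w"
  shows "norm (LINT t|I01. indicat_real {..x} t *\<^sub>R w t) \<le> (LINT t|I01. norm (w t))"
proof -
  have "norm (LINT t|I01. indicat_real {..x} t *\<^sub>R w t) \<le> (LINT t|I01. norm (indicat_real {..x} t *\<^sub>R w t))"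
    by (rule integral_norm_bound)
  also have "\<dots> \<le> (LINT t|I01. norm (w t))"
    using assms integrable_norm[OF integrable_initial[OF assms, of x]]
    by (intro integral_mono) (auto simp: indicator_def)
  finally show ?thesis .
qed

text \<open>Exchange of order over the triangle \<open>y \<le> t\<close>; it takes the place of
  integration by parts.\<close>

lemma Fubini_triangle:
  fixes f w :: "real \<Rightarrow> 'a::{real_normed_field,banach,second_countable_topology}"
  assumes f: "integrable I01 f" and w: "integrable I01 w"
  shows "(LINT t|I01. w t * (LINT y|I01. indicat_real {..t} y *\<^sub>R f y))
    = (LINT y|I01. f y * (LINT t|I01. indicat_real {y..} t *\<^sub>R w t))"
proof -
  have eq: "indicat_real {..t} y = (if y \<le> t then 1 else 0)" "indicat_real {y..} t = (if y \<le> t then 1 else 0)" for t y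
    by (auto simp: indicator_def)
  show ?thesis unfolding eq by (rule Fubini_kernel[OF f w, of _ 1]) auto
qed

section \<open>Complex L2 functions, H1 and the weak formulation\<close>

lemma L2_iff: "L2 f \<longleftrightarrow> square_integrable (\<lambda>x. Re (f x)) \<and> square_integrable (\<lambda>x. Im (f x))"
proof
  assume f: "L2 f"
  then have [measurable]: "f \<in> borel_measurable I01" by (simp add: L2_def)
  have int: "integrable I01 (\<lambda>x. (cmod (f x))\<^sup>2)" using f by (simp add: L2_def)
  have "integrable I01 (\<lambda>x. (Re (f x))\<^sup>2)" "integrable I01 (\<lambda>x. (Im (f x))\<^sup>2)"
    by (rule Bochner_Integration.integrable_bound[OF int]; simp add: cmod_power2)+
  then show "square_integrable (\<lambda>x. Re (f x)) \<and> square_integrable (\<lambda>x. Im (f x))"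
    by (simp add: square_integrable_def)
next
  assume f: "square_integrable (\<lambda>x. Re (f x)) \<and> square_integrable (\<lambda>x. Im (f x))"
  then have "f \<in> borel_measurable I01"
    by (subst borel_measurable_complex_iff) (auto dest: square_integrableD)
  moreover have "integrable I01 (\<lambda>x. (Re (f x))\<^sup>2 + (Im (f x))\<^sup>2)"
    using f by (intro Bochner_Integration.integrable_add integrable_square) auto
  ultimately show "L2 f" by (simp add: L2_def cmod_power2)
qed

lemma L2_measurable [measurable_dest]: "L2 f \<Longrightarrow> f \<in> borel_measurable I01"
  by (simp add: L2_def)

lemma L2_cnj_mult_integrable:
  assumes "L2 f" "L2 g" shows "integrable I01 (\<lambda>x. f x * cnj (g x))"
proof (rule Bochner_Integration.integrable_bound)
  show "integrable I01 (\<lambda>x. (cmod (f x))\<^sup>2 + (cmod (g x))\<^sup>2)"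
    using assms by (auto simp: L2_def)
  show "(\<lambda>x. f x * cnj (g x)) \<in> borel_measurable I01"
    using assms[THEN L2_measurable] by (intro borel_measurable_times borel_measurable_continuous_on[OF continuous_on_cnj[OF continuous_on_id]])
  have "cmod (f x) * cmod (g x) \<le> (cmod (f x))\<^sup>2 + (cmod (g x))\<^sup>2" for x
    using sum_squares_bound[of "cmod (f x)" "cmod (g x)"] mult_nonneg_nonneg[OF norm_ge_zero norm_ge_zero, of "f x" "g x"]
    by linarith
  then show "AE x in I01. norm (f x * cnj (g x)) \<le> norm ((cmod (f x))\<^sup>2 + (cmod (g x))\<^sup>2)"
    by (intro AE_I2) (simp add: norm_mult)
qed

lemma L2_bounded:
  assumes "f \<in> borel_measurable I01" "\<And>x. x \<in> {0..1} \<Longrightarrow> cmod (f x) \<le> B"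
  shows "L2 f"
proof -
  have "\<bar>Re (f x)\<bar> \<le> B" "\<bar>Im (f x)\<bar> \<le> B" if "x \<in> {0..1}" for x
    using assms(2)[OF that] abs_Re_le_cmod abs_Im_le_cmod order_trans by blast+
  then show ?thesis unfolding L2_iff using assms(1) by (intro conjI square_integrable_bounded[of _ B]) auto
qed

lemma L2_integrable: "L2 f \<Longrightarrow> integrable I01 f"
  using L2_cnj_mult_integrable[OF _ L2_bounded[of "\<lambda>x. 1" 1], of f] by simp

lemma H1_eq:
  "H1 v w \<longleftrightarrow> L2 w \<and> (\<forall>x\<in>{0..1}. v x = v 0 + (LINT t|I01. indicat_real {..x} t *\<^sub>R w t))"
  unfolding H1_def by (intro conj_cong ball_cong refl) (simp only: integral_lebesgue_on_initial)

lemma H1_L2_deriv: "H1 v w \<Longrightarrow> L2 w"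
  by (simp only: H1_def)

lemma H1_L2:
  assumes "H1 v w" shows "L2 v"
proof -
  have w: "integrable I01 w" using assms by (intro L2_integrable H1_L2_deriv)
  have v: "v x = v 0 + (LINT t|I01. indicat_real {..x} t *\<^sub>R w t)" if "x \<in> {0..1}" for x
    using assms that unfolding H1_eq by blast
  have "v \<in> borel_measurable I01 \<longleftrightarrow> (\<lambda>x. v 0 + (LINT t|I01. indicat_real {..x} t *\<^sub>R w t)) \<in> borel_measurable I01"
    by (intro measurable_cong v) simp
  then have "v \<in> borel_measurable I01"
    using integral_initial_measurable[OF w] by simp
  moreover have "cmod (v x) \<le> cmod (v 0) + (LINT t|I01. norm (w t))" if "x \<in> {0..1}" for x
    using v[OF that] integral_initial_norm_le[OF w, of x] norm_triangle_ineq[of "v 0"]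
    by (smt (verit))
  ultimately show ?thesis by (rule L2_bounded)
qed

text \<open>Differentiating the kernel gives 1/2 for \<open>y > x\<close> and -1/2 for
  \<open>y < x\<close>; the difference of the two half integrals is rewritten with the total
  integral.\<close>

definition green_deriv :: "(real \<Rightarrow> complex) \<Rightarrow> real \<Rightarrow> complex" where
  "green_deriv g t = (LINT y|I01. g y) / 2 - (LINT y|I01. indicat_real {..t} y *\<^sub>R g y)"

lemma L2_green_deriv:
  assumes "L2 g" shows "L2 (green_deriv g)"
proof (rule L2_bounded)
  have g: "integrable I01 g" using assms by (rule L2_integrable)
  show "green_deriv g \<in> borel_measurable I01"
    unfolding green_deriv_def[abs_def] using integral_initial_measurable[OF g] by simp
  show "cmod (green_deriv g t) \<le> cmod ((LINT y|I01. g y) / 2) + (LINT t|I01. norm (g t))" for t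
    unfolding green_deriv_def
    using norm_triangle_ineq4[of "(LINT y|I01. g y) / 2"] integral_initial_norm_le[OF g, of t]
    by (smt (verit))
qed

text \<open>The kernels at the end points, \<open>(1 - y) / 2\<close> and \<open>y / 2\<close>, add
  up to 1/2. The right-hand side is the derivative at 0, so this is the boundary condition.\<close>

lemma green_boundary:
  assumes "L2 g" shows "green g 0 + green g 1 = (LINT y|I01. g y) / 2"
proof -
  have g: "integrable I01 g" using assms by (rule L2_integrable)
  have "green g 0 + green g 1 = (LINT y|I01. ((1 - \<bar>0 - y\<bar>) / 2) *\<^sub>R g y + ((1 - \<bar>1 - y\<bar>) / 2) *\<^sub>R g y)"
    unfolding green_def by (rule Bochner_Integration.integral_add[symmetric, OF green_integrable[OF g] green_integrable[OF g]])
  also have "\<dots> = (LINT y|I01. g y / 2)"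
  proof (rule Bochner_Integration.integral_cong[OF refl])
    fix y assume "y \<in> space I01"
    then have "(1 - \<bar>0 - y\<bar>) / 2 + (1 - \<bar>1 - y\<bar>) / 2 = 1 / 2" by (auto simp: field_simps)
    then show "((1 - \<bar>0 - y\<bar>) / 2) *\<^sub>R g y + ((1 - \<bar>1 - y\<bar>) / 2) *\<^sub>R g y = g y / 2"
      unfolding scaleR_left_distrib[symmetric] by (simp only:) (simp add: scaleR_conv_of_real)
  qed
  finally show ?thesis by simp
qed

text \<open>Integrating \<open>green_deriv g\<close> over \<open>{..x}\<close> and exchanging the
  order yields the kernel \<open>x / 2 - max 0 (x - y)\<close>, and this is the increment of the
  Green kernel from 0 to \<open>x\<close>.\<close>

lemma H1_green:
  assumes "L2 g" shows "H1 (green g) (green_deriv g)"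
  unfolding H1_eq
proof (intro conjI ballI)
  show d: "L2 (green_deriv g)" using assms by (rule L2_green_deriv)
  have g: "integrable I01 g" using assms by (rule L2_integrable)
  fix x :: real assume x: "x \<in> {0..1}"
  define S where "S = (LINT y|I01. g y) / 2"
  define F where "F t = (LINT y|I01. indicat_real {..t} y *\<^sub>R g y)" for t
  have F: "integrable I01 F"
    unfolding F_def using integral_initial_measurable[OF g] integral_initial_norm_le[OF g]
    by (intro L2_integrable L2_bounded)
  have ind: "integrable I01 (indicat_real {..x})" by (rule integrable_initial[of "\<lambda>x. 1::real" x, simplified])
  have len: "(LINT t|I01. indicat_real {y..} t * indicat_real {..x} t) = max 0 (x - y)" if "y \<in> {0..1}" for y
  proof -
    have "(LINT t|I01. indicat_real {y..} t * indicat_real {..x} t) = measure I01 {y..x}"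
      using that x by (subst indicator_inter_arith[symmetric])
        (auto simp: sets_restrict_space_iff Int_atLeastAtMostR2 intro!: arg_cong[of _ _ "measure I01"])
    also have "\<dots> = max 0 (x - y)"
      using that x by (subst measure_restrict_space) (auto simp: max_def)
    finally show ?thesis .
  qed
  have tri: "(LINT t|I01. complex_of_real (indicat_real {..x} t) * F t) = (LINT y|I01. g y * complex_of_real (max 0 (x - y)))"
  proof -
    have "(LINT t|I01. complex_of_real (indicat_real {..x} t) * F t)
        = (LINT y|I01. g y * (LINT t|I01. indicat_real {y..} t *\<^sub>R complex_of_real (indicat_real {..x} t)))"
      unfolding F_def using ind by (intro Fubini_triangle[OF g]) simp
    also have "\<dots> = (LINT y|I01. g y * complex_of_real (LINT t|I01. indicat_real {y..} t * indicat_real {..x} t))"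
      by (simp add: scaleR_conv_of_real flip: integral_complex_of_real of_real_mult)
    also have "\<dots> = (LINT y|I01. g y * complex_of_real (max 0 (x - y)))"
      by (intro Bochner_Integration.integral_cong[OF refl]) (simp add: len)
    finally show ?thesis .
  qed
  have i1: "integrable I01 (\<lambda>y. max 0 (x - y) *\<^sub>R g y)"
    by (rule integrable_bounded_scaleR[OF g, of _ 1]) (use x in auto)
  have "(LINT t|I01. indicat_real {..x} t *\<^sub>R green_deriv g t)
      = (LINT t|I01. S * complex_of_real (indicat_real {..x} t) - complex_of_real (indicat_real {..x} t) * F t)"
    by (simp add: green_deriv_def S_def F_def scaleR_conv_of_real algebra_simps)
  also have "\<dots> = S * complex_of_real (LINT t|I01. indicat_real {..x} t) - (LINT t|I01. complex_of_real (indicat_real {..x} t) * F t)"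
    using ind integrable_initial[OF F, of x]
    by (subst Bochner_Integration.integral_diff) (auto simp: scaleR_conv_of_real)
  also have "(LINT t|I01. indicat_real {..x} t) = x"
  proof -
    have "(LINT t|I01. indicat_real {..x} t) = (LINT t|I01. indicat_real {0..} t * indicat_real {..x} t)"
      by (rule Bochner_Integration.integral_cong[OF refl]) simp
    then show ?thesis using len[of 0] x by simp
  qed
  finally have 1: "(LINT t|I01. indicat_real {..x} t *\<^sub>R green_deriv g t)
      = x *\<^sub>R S - (LINT y|I01. max 0 (x - y) *\<^sub>R g y)"
    unfolding tri by (simp add: scaleR_conv_of_real mult.commute)
  have "green g x - green g 0 = (LINT y|I01. (((1 - \<bar>x - y\<bar>) / 2) *\<^sub>R g y - ((1 - \<bar>0 - y\<bar>) / 2) *\<^sub>R g y))"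
    unfolding green_def by (rule Bochner_Integration.integral_diff[symmetric, OF green_integrable[OF g] green_integrable[OF g]])
  also have "\<dots> = (LINT y|I01. (x / 2) *\<^sub>R g y - max 0 (x - y) *\<^sub>R g y)"
  proof (rule Bochner_Integration.integral_cong[OF refl])
    fix y assume "y \<in> space I01"
    then have "(1 - \<bar>x - y\<bar>) / 2 - (1 - \<bar>0 - y\<bar>) / 2 = x / 2 - max 0 (x - y)" by (auto simp: max_def field_simps)
    then show "((1 - \<bar>x - y\<bar>) / 2) *\<^sub>R g y - ((1 - \<bar>0 - y\<bar>) / 2) *\<^sub>R g y = (x / 2) *\<^sub>R g y - max 0 (x - y) *\<^sub>R g y"
      unfolding scaleR_left_diff_distrib[symmetric] by simp
  qed
  also have "\<dots> = (x / 2) *\<^sub>R (LINT y|I01. g y) - (LINT y|I01. max 0 (x - y) *\<^sub>R g y)"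
    using g i1 by (subst Bochner_Integration.integral_diff) auto
  finally show "green g x = green g 0 + (LINT t|I01. indicat_real {..x} t *\<^sub>R green_deriv g t)"
    unfolding 1 S_def by (simp add: scaleR_conv_of_real field_simps)
qed

lemma form_a_eq: "form_a u u' v v' = L2_inner u' v' + (u 0 + u 1) * cnj (v 0 + v 1)"
  by (simp add: form_a_def Bmat_def trace_def algebra_simps)

text \<open>\<open>Fubini_triangle\<close> moves the derivative from \<open>v\<close> to
  \<open>green_deriv g\<close>. With \<open>S\<close> half the integral of \<open>g\<close>, this
  leaves \<open>L2_inner g v\<close> minus \<open>S * cnj (v 0 + v 1)\<close>, and by
  \<open>green_boundary\<close> the boundary part of the form cancels the latter term.\<close>

lemma form_a_green:
  assumes g: "L2 g" and v: "H1 v v'"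
  shows "form_a (green g) (green_deriv g) v v' = L2_inner g v"
proof -
  have gi: "integrable I01 g" using g by (rule L2_integrable)
  have v': "L2 v'" using v by (rule H1_L2_deriv)
  then have v'i: "integrable I01 v'" by (rule L2_integrable)
  then have cv'i: "integrable I01 (\<lambda>t. cnj (v' t))" by simp
  define S where "S = (LINT y|I01. g y) / 2"
  define F where "F t = (LINT y|I01. indicat_real {..t} y *\<^sub>R g y)" for t
  have FL: "L2 F"
    unfolding F_def using integral_initial_measurable[OF gi] integral_initial_norm_le[OF gi]
    by (intro L2_bounded)
  have vx: "v x = v 0 + (LINT t|I01. indicat_real {..x} t *\<^sub>R v' t)" if "x \<in> {0..1}" for x
    using v that unfolding H1_eq by blast
  have v1: "v 1 = v 0 + (LINT t|I01. v' t)"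
  proof -
    have "(LINT t|I01. indicat_real {..1} t *\<^sub>R v' t) = (LINT t|I01. v' t)"
      by (rule Bochner_Integration.integral_cong[OF refl]) simp
    then show ?thesis using vx[of 1] by simp
  qed
  have tail: "(LINT t|I01. indicat_real {y..} t *\<^sub>R v' t) = v 1 - v y" if y: "y \<in> {0..1}" for y
  proof -
    have "(LINT t|I01. indicat_real {y..} t *\<^sub>R v' t) = (LINT t|I01. v' t - indicat_real {..y} t *\<^sub>R v' t)"
    proof (rule integral_cong_AE)
      \<comment> \<open>The two half-lines overlap exactly in \<open>y\<close>, so their indicators
        add up to 1 only off this point.\<close>
      have "AE t in I01. t \<noteq> y" by (rule AE_I01_neq)
      then show "AE t in I01. indicat_real {y..} t *\<^sub>R v' t = v' t - indicat_real {..y} t *\<^sub>R v' t"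
        by eventually_elim (auto simp: indicator_def)
      show "(\<lambda>t. indicat_real {y..} t *\<^sub>R v' t) \<in> borel_measurable I01"
        using v'i by measurable
      show "(\<lambda>t. v' t - indicat_real {..y} t *\<^sub>R v' t) \<in> borel_measurable I01"
        using v'i by measurable
    qed
    also have "\<dots> = (LINT t|I01. v' t) - (LINT t|I01. indicat_real {..y} t *\<^sub>R v' t)"
      by (rule Bochner_Integration.integral_diff[OF v'i integrable_initial[OF v'i]])
    finally show ?thesis using v1 vx[OF y] by simp
  qed
  have ctail: "(LINT t|I01. indicat_real {y..} t *\<^sub>R cnj (v' t)) = cnj (v 1) - cnj (v y)" if y: "y \<in> {0..1}" for y
  proof -
    have "(LINT t|I01. indicat_real {y..} t *\<^sub>R cnj (v' t)) = (LINT t|I01. cnj (indicat_real {y..} t *\<^sub>R v' t))"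
      by simp
    also have "\<dots> = cnj (LINT t|I01. indicat_real {y..} t *\<^sub>R v' t)"
      by (rule Bochner_Integration.integral_cnj)
    finally show ?thesis using tail[OF y] by simp
  qed
  have "L2_inner (green_deriv g) v' = (LINT t|I01. S * cnj (v' t) - cnj (v' t) * F t)"
    by (simp add: L2_inner_def green_deriv_def S_def F_def algebra_simps)
  also have "\<dots> = S * (LINT t|I01. cnj (v' t)) - (LINT t|I01. cnj (v' t) * F t)"
    using cv'i L2_cnj_mult_integrable[OF FL v']
    by (subst Bochner_Integration.integral_diff) (auto simp: mult.commute)
  also have "(LINT t|I01. cnj (v' t)) = cnj (v 1) - cnj (v 0)"
    using v1 by simp
  also have "(LINT t|I01. cnj (v' t) * F t) = (LINT y|I01. g y * (LINT t|I01. indicat_real {y..} t *\<^sub>R cnj (v' t)))"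
    unfolding F_def by (rule Fubini_triangle[OF gi cv'i])
  also have "\<dots> = (LINT y|I01. cnj (v 1) * g y - g y * cnj (v y))"
    by (intro Bochner_Integration.integral_cong[OF refl]) (simp add: ctail algebra_simps)
  also have "\<dots> = 2 * S * cnj (v 1) - L2_inner g v"
    using gi L2_cnj_mult_integrable[OF g H1_L2[OF v]]
    by (subst Bochner_Integration.integral_diff) (auto simp: L2_inner_def S_def)
  finally show ?thesis
    unfolding form_a_eq green_boundary[OF g] S_def[symmetric] by (simp add: algebra_simps)
qed

lemma L2_diff: "L2 f \<Longrightarrow> L2 g \<Longrightarrow> L2 (\<lambda>x. f x - g x)"
  by (simp add: L2_iff)

lemma H1_diff:
  assumes "H1 u u'" "H1 v v'" shows "H1 (\<lambda>x. u x - v x) (\<lambda>x. u' x - v' x)"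
proof -
  have i: "integrable I01 u'" "integrable I01 v'" using assms by (auto intro: L2_integrable H1_L2_deriv)
  show ?thesis unfolding H1_eq
  proof (intro conjI ballI)
    show "L2 (\<lambda>x. u' x - v' x)" using assms by (intro L2_diff H1_L2_deriv)
    fix x :: real assume x: "x \<in> {0..1}"
    have "(LINT t|I01. indicat_real {..x} t *\<^sub>R (u' t - v' t))
        = (LINT t|I01. indicat_real {..x} t *\<^sub>R u' t) - (LINT t|I01. indicat_real {..x} t *\<^sub>R v' t)"
      unfolding scaleR_right_diff_distrib
      by (rule Bochner_Integration.integral_diff[OF integrable_initial[OF i(1)] integrable_initial[OF i(2)]])
    moreover have "u x = u 0 + (LINT t|I01. indicat_real {..x} t *\<^sub>R u' t)"
      "v x = v 0 + (LINT t|I01. indicat_real {..x} t *\<^sub>R v' t)"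
      using assms x unfolding H1_eq by blast+
    ultimately show "u x - v x = u 0 - v 0 + (LINT t|I01. indicat_real {..x} t *\<^sub>R (u' t - v' t))"
      by (simp only: algebra_simps)
  qed
qed

lemma L2_inner_self: "L2_inner f f = complex_of_real (LINT x|I01. (cmod (f x))\<^sup>2)"
  unfolding L2_inner_def by (simp add: complex_norm_square[symmetric] flip: integral_complex_of_real)

text \<open>The form at \<open>u\<close> is the integral of \<open>|u'|\<^sup>2\<close> plus
  \<open>|u 0 + u 1|\<^sup>2\<close>. If it vanishes, \<open>u\<close> is constant and twice the
  constant is 0.\<close>

lemma form_a_self_zero:
  assumes u: "H1 u u'" and zero: "form_a u u' u u' = 0"
  shows "AE x in I01. u' x = 0" "x \<in> {0..1} \<Longrightarrow> u x = 0"
proof -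
  have u': "L2 u'" using u by (rule H1_L2_deriv)
  have "form_a u u' u u' = complex_of_real ((LINT x|I01. (cmod (u' x))\<^sup>2) + (cmod (u 0 + u 1))\<^sup>2)"
    unfolding form_a_eq L2_inner_self by (simp only: of_real_add complex_norm_square)
  then have "(LINT x|I01. (cmod (u' x))\<^sup>2) + (cmod (u 0 + u 1))\<^sup>2 = 0"
    using zero by (metis of_real_eq_0_iff)
  moreover have "0 \<le> (LINT x|I01. (cmod (u' x))\<^sup>2)" by simp
  ultimately have 0: "(LINT x|I01. (cmod (u' x))\<^sup>2) = 0" "(cmod (u 0 + u 1))\<^sup>2 = 0"
    using zero_le_power2[of "cmod (u 0 + u 1)"] by linarith+
  then show ae: "AE x in I01. u' x = 0"
    using u' by (subst (asm) integral_nonneg_eq_0_iff_AE) (auto simp: L2_def)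
  have const: "u x = u 0" if "x \<in> {0..1}" for x
  proof -
    have "(LINT t|I01. indicat_real {..x} t *\<^sub>R u' t) = 0"
      by (rule integral_eq_zero_AE) (use ae in eventually_elim, simp)
    moreover have "u x = u 0 + (LINT t|I01. indicat_real {..x} t *\<^sub>R u' t)"
      using u that unfolding H1_eq by blast
    ultimately show ?thesis by simp
  qed
  have "u 0 = 0" using const[of 1] 0(2) by simp
  then show "x \<in> {0..1} \<Longrightarrow> u x = 0" using const[of x] by simp
qed

text \<open>\<open>green g\<close> is a weak solution for the datum \<open>g\<close>. The difference
  from any other weak solution is itself a test function, so the form vanishes at it and
  \<open>form_a_self_zero\<close> gives uniqueness.\<close>

theorem opA_iff_green: "opA f g \<longleftrightarrow> L2 f \<and> L2 g \<and> ae_eq f (green g)"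
proof
  assume "L2 f \<and> L2 g \<and> ae_eq f (green g)"
  then show "opA f g" unfolding opA_def
    by (intro conjI exI[of _ "green g"] exI[of _ "green_deriv g"] allI impI) (auto intro: H1_green form_a_green)
next
  assume "opA f g"
  then obtain u u' where fg: "L2 f" "L2 g" "ae_eq f u" and u: "H1 u u'"
    and form: "\<And>v v'. H1 v v' \<Longrightarrow> form_a u u' v v' = L2_inner g v" unfolding opA_def by blast
  let ?d = "\<lambda>x. u x - green g x" and ?d' = "\<lambda>x. u' x - green_deriv g x"
  have d: "H1 ?d ?d'" by (rule H1_diff[OF u H1_green[OF fg(2)]])
  note L = H1_L2_deriv[OF u] H1_L2_deriv[OF d]
  have "form_a ?d ?d' ?d ?d' = form_a u u' ?d ?d' - form_a (green g) (green_deriv g) ?d ?d'"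
    unfolding form_a_eq L2_inner_def
    using L2_cnj_mult_integrable[OF L] L2_cnj_mult_integrable[OF L2_green_deriv[OF fg(2)] L(2)]
    by (simp only: left_diff_distrib Bochner_Integration.integral_diff) (simp add: algebra_simps)
  then have "form_a ?d ?d' ?d ?d' = 0" using form[OF d] form_a_green[OF fg(2) d] by simp
  then have "?d x = 0" if "x \<in> {0..1}" for x by (rule form_a_self_zero(2)[OF d _ that])
  then have "AE x in I01. u x = green g x" by (intro AE_I2) auto
  with fg(3) have "ae_eq f (green g)" unfolding ae_eq_def by eventually_elim simp
  then show "L2 f \<and> L2 g \<and> ae_eq f (green g)" using fg by simp
qed

section \<open>Functions with vanishing initial integrals\<close>

lemma AE_I01_exists:
  assumes "AE x in I01. P x" "0 \<le> a" "a < b" "b \<le> 1"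
  obtains x where "a < x" "x < b" "P x"
proof (rule ccontr)
  assume "\<not> thesis"
  with that have "\<not> P x" if "a < x" "x < b" for x using \<open>a < x\<close> \<open>x < b\<close> by blast
  with assms(1) have "AE x in I01. x \<notin> {a<..<b}" by (elim AE_mp) (auto intro!: AE_I2)
  then have "emeasure I01 {x\<in>space I01. x \<in> {a<..<b}} = 0"
    by (rule emeasure_eq_0_AE)
  moreover have "{x\<in>space I01. x \<in> {a<..<b}} = {a<..<b}" using assms by auto
  moreover have "emeasure I01 {a<..<b} = emeasure lebesgue {a<..<b}"
    using assms by (intro emeasure_restrict_space) auto
  ultimately show False using assms by simp
qed

text \<open>The points where the integral vanishes are dense, so some of them decrease to
  \<open>a\<close>; approaching from the right makes the indicators of \<open>{..t n}\<close>
  converge everywhere to that of \<open>{..a}\<close>, and dominated convergence applies.\<close>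

lemma integral_initial_right_limit:
  fixes f :: "real \<Rightarrow> real"
  assumes f: "integrable I01 f" and ae: "AE t in I01. (LINT y|I01. indicat_real {..t} y * f y) = 0"
    and a: "0 \<le> a" "a < 1"
  shows "(LINT y|I01. indicat_real {..a} y * f y) = 0"
proof -
  have [measurable]: "f \<in> borel_measurable I01" using f by simp
  have "\<exists>t. a < t \<and> t < a + (1 - a) / real (Suc n) \<and> (LINT y|I01. indicat_real {..t} y * f y) = 0" for n
  proof -
    have "a < a + (1 - a) / real (Suc n)" using a by simp
    moreover have "(1 - a) / real (Suc n) \<le> (1 - a) / 1" using a by (intro divide_left_mono) auto
    then have "a + (1 - a) / real (Suc n) \<le> 1" by simp
    ultimately show ?thesis using AE_I01_exists[OF ae a(1)] by metis
  qed
  then obtain t where t: "\<And>n. a < t n" "\<And>n. t n < a + (1 - a) / real (Suc n)"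
    "\<And>n. (LINT y|I01. indicat_real {..t n} y * f y) = 0" by metis
  have "(\<lambda>n. (1 - a) / real (Suc n)) \<longlonglongrightarrow> 0"
    using LIMSEQ_Suc[OF lim_const_over_n[of "1 - a"]] by simp
  then have "(\<lambda>n. a + (1 - a) / real (Suc n)) \<longlonglongrightarrow> a + 0" by (intro tendsto_intros)
  then have up: "(\<lambda>n. a + (1 - a) / real (Suc n)) \<longlonglongrightarrow> a" by simp
  have ta: "t \<longlonglongrightarrow> a"
  proof (rule tendsto_sandwich[OF _ _ tendsto_const up])
    show "\<forall>\<^sub>F n in sequentially. a \<le> t n" using t(1) less_imp_le by (intro always_eventually allI) blast
    show "\<forall>\<^sub>F n in sequentially. t n \<le> a + (1 - a) / real (Suc n)"
      using t(2) less_imp_le by (intro always_eventually allI) blast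
  qed
  have "(\<lambda>n. LINT y|I01. indicat_real {..t n} y * f y) \<longlonglongrightarrow> (LINT y|I01. indicat_real {..a} y * f y)"
  proof (rule integral_dominated_convergence)
    show "integrable I01 (\<lambda>y. \<bar>f y\<bar>)" using f by simp
    show "AE y in I01. (\<lambda>n. indicat_real {..t n} y * f y) \<longlonglongrightarrow> indicat_real {..a} y * f y"
    proof (rule AE_I2)
      fix y
      have "(\<lambda>n. indicat_real {..t n} y) \<longlonglongrightarrow> indicat_real {..a} y"
      proof (cases "y \<le> a")
        case True
        then have "y \<le> t n" for n using t(1)[of n] by simp
        then show ?thesis using True by simp
      next
        case False
        then have "eventually (\<lambda>n. t n < y) sequentially" using ta by (intro order_tendstoD) auto
        then have "eventually (\<lambda>n. indicat_real {..t n} y = indicat_real {..a} y) sequentially"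
          by eventually_elim (use False in auto)
        then show ?thesis by (rule tendsto_eventually)
      qed
      then show "(\<lambda>n. indicat_real {..t n} y * f y) \<longlonglongrightarrow> indicat_real {..a} y * f y"
        by (intro tendsto_intros)
    qed
  qed (auto simp: indicator_def)
  then show ?thesis using t(3) by (simp add: LIMSEQ_const_iff)
qed

text \<open>Half-lines form an intersection-stable generator of the Borel sets, so the integral of
  \<open>f\<close> vanishes over every Borel set; complements use the vanishing total integral.
  After extension to Lebesgue sets, testing on the sets where \<open>f\<close> or \<open>- f\<close>
  is positive gives the claim.\<close>

lemma AE_zero_of_initial_integrals:
  fixes f :: "real \<Rightarrow> real"
  assumes f: "integrable I01 f" and total: "(LINT y|I01. f y) = 0"
    and ae: "AE t in I01. (LINT y|I01. indicat_real {..t} y * f y) = 0"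
  shows "AE y in I01. f y = 0"
proof -
  have [measurable]: "f \<in> borel_measurable I01" using f by simp
  have intA: "integrable I01 (\<lambda>y. indicat_real A y * f y)" if [measurable]: "A \<in> sets borel" for A
    by (rule Bochner_Integration.integrable_bound[OF f]) (auto simp: indicator_def)
  have initial: "(LINT y|I01. indicat_real {..a} y * f y) = 0" for a
  proof -
    consider "a < 0" | "0 \<le> a \<and> a < 1" | "1 \<le> a" by linarith
    then show ?thesis
    proof cases
      case 1
      then have "(LINT y|I01. indicat_real {..a} y * f y) = (LINT y|I01. 0)"
        by (intro Bochner_Integration.integral_cong[OF refl]) (auto simp: indicator_def)
      then show ?thesis by simp
    next
      case 2
      then show ?thesis using integral_initial_right_limit[OF f ae] by blast
    next
      case 3
      then have "(LINT y|I01. indicat_real {..a} y * f y) = (LINT y|I01. f y)"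
        by (intro Bochner_Integration.integral_cong[OF refl]) (auto simp: indicator_def)
      then show ?thesis using total by simp
    qed
  qed
  have borel0: "(LINT y|I01. indicat_real A y * f y) = 0" if "A \<in> sets borel" for A
  proof -
    have B: "sets borel = sigma_sets UNIV (range (\<lambda>a::real. {..a}))"
      unfolding borel_eq_atMost by (rule sets_measure_of) simp
    have S: "Int_stable (range (\<lambda>a::real. {..a}))" by (auto simp: Int_stable_def)
    have "A \<in> sigma_sets UNIV (range (\<lambda>a::real. {..a}))" using that B by simp
    then show ?thesis
    proof (induction rule: sigma_sets_induct_disjoint[OF S Pow_UNIV[THEN equalityD2, THEN subset_trans[OF subset_UNIV]], consumes 1, case_names basic empty compl union])
      case (basic A) then show ?case using initial by auto
    next
      case empty then show ?case by simp
    next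
      case (compl A)
      then have "A \<in> sets borel" using B by simp
      from intA[OF this] have "(LINT y|I01. f y - indicat_real A y * f y) = 0"
        using compl f total by (subst Bochner_Integration.integral_diff) auto
      moreover have "f y - indicat_real A y * f y = indicat_real (UNIV - A) y * f y" for y
        by (auto simp: indicator_def)
      ultimately show ?case by simp
    next
      case (union A)
      then have A [measurable]: "A i \<in> sets borel" for i using B by auto
      define A' where "A' i = A i \<inter> {0..1}" for i
      have A': "A' i \<in> sets I01" for i
        using A[of i] by (auto simp: A'_def sets_restrict_space intro!: image_eqI[of _ _ "A i"])
      have restr: "(LINT y|I01. indicat_real B y * f y) = (LINT y:(B \<inter> {0..1})|I01. f y)" for B
        unfolding set_lebesgue_integral_def
        by (intro Bochner_Integration.integral_cong[OF refl]) (auto simp: indicator_def)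
      have "(LINT y|I01. indicat_real (\<Union>i. A i) y * f y) = (LINT y:(\<Union>i. A' i)|I01. f y)"
        by (simp add: restr A'_def Int_UN_distrib2)
      also have "\<dots> = (\<Sum>i. LINT y:(A' i)|I01. f y)"
      proof (rule lebesgue_integral_countable_add[OF A'])
        show "A' i \<inter> A' j = {}" if "i \<noteq> j" for i j
          using union(1) that by (auto simp: A'_def disjoint_family_on_def)
        have [measurable]: "(\<Union>i. A' i) \<in> sets I01" using A' by blast
        have "(\<lambda>y. indicat_real (\<Union>i. A' i) y *\<^sub>R f y) \<in> borel_measurable I01" by measurable
        then show "set_integrable I01 (\<Union>i. A' i) f"
          unfolding set_integrable_def
          by (rule Bochner_Integration.integrable_bound[OF f]) (auto intro!: AE_I2 simp: indicator_def)
      qed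
      also have "\<dots> = 0" using union(3) by (simp add: restr[symmetric] A'_def)
      finally show ?case .
    qed
  qed
  \<comment> \<open>A Lebesgue set differs from a Borel set by a subset of a null set.\<close>
  have sets0: "(LINT y|I01. indicat_real A y * f y) = 0" if A: "A \<in> sets I01" for A
  proof -
    have AL: "A \<in> sets lebesgue" "A \<subseteq> {0..1}" using A by (auto simp: sets_restrict_space_iff)
    then obtain S N N' where S: "A = S \<union> N" "N \<subseteq> N'" "N' \<in> null_sets lborel" "S \<in> sets lborel"
      by (metis sets_completionE)
    have "N' \<in> null_sets lebesgue" using S(3) by (rule null_sets_completionI)
    then have "AE x in lebesgue. x \<notin> N'" by (rule AE_not_in)
    then have "AE x in I01. x \<notin> N'" by (subst AE_restrict_space_iff) auto
    then have "AE x in I01. indicat_real A x * f x = indicat_real S x * f x"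
      by eventually_elim (use S in \<open>auto simp: indicator_def\<close>)
    then have "(LINT y|I01. indicat_real A y * f y) = (LINT y|I01. indicat_real S y * f y)"
      using A S(4) by (intro integral_cong_AE) auto
    then show ?thesis using borel0 S(4) by simp
  qed
  have nonneg_zero: "AE y in I01. g y \<le> 0"
    if g: "integrable I01 g" "\<And>A. A \<in> sets I01 \<Longrightarrow> (LINT y|I01. indicat_real A y * g y) = 0" for g :: "real \<Rightarrow> real"
  proof -
    have [measurable]: "g \<in> borel_measurable I01" using g by simp
    define A where "A = {y\<in>space I01. g y > 0}"
    have A: "A \<in> sets I01" unfolding A_def by measurable
    have "integrable I01 (\<lambda>y. indicat_real A y * g y)"
      by (rule Bochner_Integration.integrable_bound[OF g(1)]) (use A in \<open>auto simp: indicator_def\<close>)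
    then have "AE y in I01. indicat_real A y * g y = 0"
      using g(2)[OF A] by (subst (asm) integral_nonneg_eq_0_iff_AE) (auto simp: A_def indicator_def)
    then show ?thesis
      by (rule AE_mp) (auto intro!: AE_I2 simp: A_def indicator_def)
  qed
  have "AE y in I01. f y \<le> 0" by (rule nonneg_zero[OF f sets0])
  moreover have "AE y in I01. - f y \<le> 0"
    by (rule nonneg_zero) (use f sets0 in auto)
  ultimately show ?thesis by eventually_elim simp
qed

lemma green_of_real:
  assumes "integrable I01 f"
  shows "green (\<lambda>x. complex_of_real (f x)) x = complex_of_real (green f x)"
proof -
  have "green (\<lambda>x. complex_of_real (f x)) x = (LINT y|I01. complex_of_real (((1 - \<bar>x - y\<bar>) / 2) *\<^sub>R f y))"
    unfolding green_def by (simp only: scaleR_conv_of_real of_real_mult of_real_eq_id id_apply)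
  also have "\<dots> = complex_of_real (green f x)"
    unfolding green_def by (rule integral_complex_of_real)
  finally show ?thesis .
qed

lemma L2_of_real: "square_integrable f \<Longrightarrow> L2 (\<lambda>x. complex_of_real (f x))"
  by (simp add: L2_iff)

lemma square_integrable_green [simp]:
  assumes "square_integrable f" shows "square_integrable (green f)"
proof (rule square_integrable_bounded)
  have f: "integrable I01 f" using assms by (rule square_integrable_integrable)
  then show "green f \<in> borel_measurable I01" by measurable
  show "\<And>x. x \<in> {0..1} \<Longrightarrow> \<bar>green f x\<bar> \<le> (LINT y|I01. norm (f y)) / 2"
    using green_norm_le[OF f] by simp
qed

text \<open>By \<open>form_a_green\<close>, \<open>\<integral> (green f) f\<close> is the value of the form at \<open>green f\<close>.\<close>
lemma green_energy:
  assumes f: "square_integrable f"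
  shows "0 \<le> (LINT x|I01. green f x * f x)"
    and "(LINT x|I01. green f x * f x) = 0 \<Longrightarrow> AE x in I01. f x = 0"
proof -
  define g where "g x = complex_of_real (f x)" for x
  have fi: "integrable I01 f" using f by (rule square_integrable_integrable)
  have g: "L2 g" unfolding g_def by (rule L2_of_real[OF f])
  have gg: "green g x = complex_of_real (green f x)" for x
    unfolding g_def by (rule green_of_real[OF fi])
  note H = H1_green[OF g]
  have "form_a (green g) (green_deriv g) (green g) (green_deriv g) = L2_inner g (green g)"
    by (rule form_a_green[OF g H])
  also have "\<dots> = complex_of_real (LINT x|I01. green f x * f x)"
    unfolding L2_inner_def gg by (simp add: g_def mult.commute flip: of_real_mult)
  finally have E: "form_a (green g) (green_deriv g) (green g) (green_deriv g) = complex_of_real (LINT x|I01. green f x * f x)" .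
  have "form_a (green g) (green_deriv g) (green g) (green_deriv g)
      = complex_of_real ((LINT x|I01. (cmod (green_deriv g x))\<^sup>2) + (cmod (green g 0 + green g 1))\<^sup>2)"
    unfolding form_a_eq L2_inner_self by (simp only: of_real_add complex_norm_square)
  with E have "(LINT x|I01. green f x * f x)
      = (LINT x|I01. (cmod (green_deriv g x))\<^sup>2) + (cmod (green g 0 + green g 1))\<^sup>2"
    by (simp only: of_real_eq_iff)
  then show "0 \<le> (LINT x|I01. green f x * f x)" by simp
  assume "(LINT x|I01. green f x * f x) = 0"
  then have form0: "form_a (green g) (green_deriv g) (green g) (green_deriv g) = 0" using E by simp
  \<comment> \<open>Zero boundary values of \<open>green g\<close> give the total integral of
    \<open>f\<close>; the vanishing derivative then gives its initial integrals.\<close>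
  have "(LINT y|I01. g y) / 2 = 0"
    using green_boundary[OF g] form_a_self_zero(2)[OF H form0, of 0] form_a_self_zero(2)[OF H form0, of 1] by simp
  then have S: "(LINT y|I01. g y) = 0" by simp
  then have tot: "(LINT y|I01. f y) = 0" by (simp add: g_def)
  have "AE t in I01. (LINT y|I01. indicat_real {..t} y * f y) = 0"
    using form_a_self_zero(1)[OF H form0]
  proof eventually_elim
    case (elim t)
    then have "(LINT y|I01. indicat_real {..t} y *\<^sub>R g y) = 0" using S by (simp add: green_deriv_def)
    then have "complex_of_real (LINT y|I01. indicat_real {..t} y * f y) = 0"
      by (simp add: g_def scaleR_conv_of_real flip: of_real_mult)
    then show ?case by simp
  qed
  then show "AE x in I01. f x = 0" by (rule AE_zero_of_initial_integrals[OF fi tot])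
qed

subsection \<open>Spectrum of the Green operator\<close>

lift_definition green_op :: "rL2 \<Rightarrow> rL2" is green
proof (elim conjE, intro conjI)
  fix f g :: "real \<Rightarrow> real"
  assume fg: "square_integrable f" "square_integrable g" "AE x in I01. f x = g x"
  then have "green f = green g" by (intro green_cong_AE square_integrable_integrable)
  then show "AE x in I01. green f x = green g x" by simp
qed simp_all

lemma green_op_abs: "square_integrable f \<Longrightarrow> green_op (abs_rL2 f) = abs_rL2 (green f)"
  by (simp add: green_op.abs_eq)

lemma green_add:
  assumes "integrable I01 f" "integrable I01 g"
  shows "green (\<lambda>x. f x + g x) x = green f x + green g x"
  using green_integrable[OF assms(1), of x] green_integrable[OF assms(2), of x]
  by (simp only: green_def scaleR_right_distrib Bochner_Integration.integral_add)

lemma green_scale: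
  fixes f :: "real \<Rightarrow> real"
  assumes "integrable I01 f"
  shows "green (\<lambda>x. c * f x) x = c * green f x"
proof -
  have "green (\<lambda>x. c * f x) x = (LINT y|I01. c * (((1 - \<bar>x - y\<bar>) / 2) *\<^sub>R f y))"
    by (simp add: green_def algebra_simps)
  then show ?thesis by (simp only: green_def Bochner_Integration.integral_mult_right_zero)
qed

lemma green_op_linear: "linear green_op"
proof (rule linearI)
  fix x y :: rL2 and c :: real
  obtain f where f: "square_integrable f" "x = abs_rL2 f" by (rule rL2_cases)
  obtain g where g: "square_integrable g" "y = abs_rL2 g" by (rule rL2_cases)
  note i = square_integrable_integrable
  have "green (\<lambda>x. f x + g x) = (\<lambda>x. green f x + green g x)"
    using green_add[OF i i] f g by blast
  then show "green_op (x + y) = green_op x + green_op y"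
    using f g by (simp add: green_op_abs abs_rL2_add[symmetric])
  have "green (\<lambda>x. c * f x) = (\<lambda>x. c * green f x)"
    using green_scale[OF i] f by blast
  then show "green_op (c *\<^sub>R x) = c *\<^sub>R green_op x"
    using f by (simp add: green_op_abs abs_rL2_scale[symmetric])
qed

text \<open>The unit ball of L2 is bounded in L1, so its images are uniformly bounded and
  equi-Lipschitz. Arzela--Ascoli gives a uniform limit, which is also a limit in norm.\<close>

lemma green_op_compact:
  assumes X: "\<And>n. norm (X n) \<le> 1"
  shows "\<exists>r l. strict_mono (r::nat \<Rightarrow> nat) \<and> (\<lambda>n. green_op (X (r n))) \<longlonglongrightarrow> l"
proof -
  have "\<exists>f. square_integrable f \<and> X n = abs_rL2 f" for n using rL2_cases by blast
  then obtain F where F: "\<And>n. square_integrable (F n)" "\<And>n. X n = abs_rL2 (F n)" by metis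
  have Fi: "integrable I01 (F n)" for n by (intro square_integrable_integrable F)
  have F1: "(LINT y|I01. norm (F n y)) \<le> 1" for n
    using integral_abs_le_norm[OF F(1)] X[of n] F(2)[of n] by (smt (verit, best) real_norm_def Bochner_Integration.integral_cong)
  obtain g r where g: "continuous_on {0..1} g" and r: "strict_mono (r::nat \<Rightarrow> nat)"
    and lim: "\<And>e. 0 < e \<Longrightarrow> \<exists>N. \<forall>n x. n \<ge> N \<and> x \<in> {0..1} \<longrightarrow> norm (green (F (r n)) x - g x) < e"
  proof (rule Arzela_Ascoli[of "{0..1::real}" "\<lambda>n. green (F n)" "1/2"])
    show "norm (green (F n) x) \<le> 1/2" if "x \<in> {0..1}" for n x
      using green_norm_le[OF Fi that, of n] F1[of n] by simp
    show "\<exists>d>0. \<forall>n y. y \<in> {0..1} \<and> norm (x - y) < d \<longrightarrow> norm (green (F n) x - green (F n) y) < e"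
      if "0 < e" for x e :: real
    proof (intro exI[of _ e] conjI allI impI that)
      fix n y assume y: "y \<in> {0..1} \<and> norm (x - y) < e"
      have "norm (green (F n) x - green (F n) y) \<le> \<bar>x - y\<bar> / 2 * (LINT y|I01. norm (F n y))"
        by (rule green_lipschitz[OF Fi])
      also have "\<dots> \<le> \<bar>x - y\<bar> / 2 * 1" by (intro mult_left_mono F1) auto
      also have "\<dots> < e" using y that by (auto simp: abs_if split: if_splits)
      finally show "norm (green (F n) x - green (F n) y) < e" .
    qed
  qed auto
  have gm: "g \<in> borel_measurable I01"
    using g by (intro continuous_imp_measurable_on_sets_lebesgue) auto
  obtain B where "\<And>x. x \<in> {0..1} \<Longrightarrow> norm (g x) \<le> B"
    using compact_continuous_image[OF g] compact_imp_bounded bounded_iff by (metis compact_Icc imageI)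
  then have gs: "square_integrable g" using gm by (intro square_integrable_bounded[of g B]) auto
  have "(\<lambda>n. green_op (X (r n))) \<longlonglongrightarrow> abs_rL2 g"
  proof (rule LIMSEQ_I)
    fix e :: real assume "e > 0"
    then obtain N where N: "\<And>n x. n \<ge> N \<Longrightarrow> x \<in> {0..1} \<Longrightarrow> norm (green (F (r n)) x - g x) < e/2"
      using lim[of "e/2"] by (metis half_gt_zero)
    have "norm (green_op (X (r n)) - abs_rL2 g) < e" if "n \<ge> N" for n
    proof -
      have "green_op (X (r n)) - abs_rL2 g = abs_rL2 (\<lambda>x. green (F (r n)) x - g x)"
        using F gs by (simp add: green_op_abs abs_rL2_diff)
      also have "norm \<dots> \<le> e/2"
        using N[OF that] F gs by (intro norm_rL2_bounded) (auto intro: less_imp_le)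
      finally show ?thesis using \<open>e > 0\<close> by simp
    qed
    then show "\<exists>no. \<forall>n\<ge>no. norm (green_op (X (r n)) - abs_rL2 g) < e" by blast
  qed
  then show ?thesis using r by blast
qed

lemma inner_green_op:
  assumes "square_integrable f" "square_integrable g"
  shows "green_op (abs_rL2 f) \<bullet> abs_rL2 g = (LINT x|I01. green f x * g x)"
  using assms by (simp add: green_op_abs inner_abs_rL2)

interpretation green_op: compact_positive_operator green_op
proof (rule compact_positive_operator.intro)
  fix x y :: rL2
  obtain f where f: "square_integrable f" "x = abs_rL2 f" by (rule rL2_cases)
  obtain g where g: "square_integrable g" "y = abs_rL2 g" by (rule rL2_cases)
  show "green_op x \<bullet> y = x \<bullet> green_op y"
    using green_symmetric[of f g] f g
    by (simp add: green_op_abs inner_abs_rL2 square_integrable_integrable mult.commute)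
  show "0 \<le> green_op x \<bullet> x" using f green_energy(1) by (simp add: inner_green_op)
  show "x = 0" if "green_op x = 0"
  proof -
    have "(LINT x|I01. green f x * f x) = 0" using that f inner_green_op[of f f] by simp
    then show ?thesis using f green_energy(2)[of f] by (simp add: abs_rL2_eq_0_iff)
  qed
next
  show "linear green_op" by (rule green_op_linear)
qed (use green_op_compact infinite_dim_rL2 in auto)

section \<open>Perron--Frobenius theory of the Green operator\<close>

text \<open>Since \<open>\<bar>x - y\<bar> \<le> max y (1 - y)\<close>, the kernel dominates
  \<open>min y (1 - y) / 2\<close> for all \<open>x\<close> at once, a weight that is positive off
  the end points.\<close>

lemma green_strongly_positive:
  fixes f :: "real \<Rightarrow> real"
  assumes f: "integrable I01 f" and nonneg: "AE y in I01. 0 \<le> f y" and nz: "\<not> (AE y in I01. f y = 0)"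
  shows "\<exists>c>0. \<forall>x\<in>{0..1}. c \<le> green f x"
proof -
  define c where "c = (LINT y|I01. (min y (1 - y) / 2) *\<^sub>R f y)"
  have ci: "integrable I01 (\<lambda>y. (min y (1 - y) / 2) *\<^sub>R f y)"
    by (rule integrable_bounded_scaleR[OF f, of _ 1]) (auto simp: min_def)
  have cnn: "AE y in I01. 0 \<le> (min y (1 - y) / 2) *\<^sub>R f y"
    using nonneg AE_space by eventually_elim auto
  have "c \<ge> 0" unfolding c_def by (rule integral_nonneg_AE[OF cnn])
  moreover have "c \<noteq> 0"
  proof
    assume "c = 0"
    then have "AE y in I01. (min y (1 - y) / 2) *\<^sub>R f y = 0"
      unfolding c_def using ci cnn by (subst (asm) integral_nonneg_eq_0_iff_AE) auto
    then have "AE y in I01. f y = 0"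
      using AE_I01_neq[of 0] AE_I01_neq[of 1] by eventually_elim (auto simp: min_def split: if_splits)
    then show False using nz by simp
  qed
  moreover have "c \<le> green f x" if x: "x \<in> {0..1}" for x
    unfolding c_def green_def
  proof (rule integral_mono_AE[OF ci green_integrable[OF f]])
    show "AE y in I01. (min y (1 - y) / 2) *\<^sub>R f y \<le> ((1 - \<bar>x - y\<bar>) / 2) *\<^sub>R f y"
      using nonneg AE_space
    proof eventually_elim
      case (elim y)
      then have "min y (1 - y) / 2 \<le> (1 - \<bar>x - y\<bar>) / 2" using x by (auto simp: min_def)
      then show ?case using elim by (intro scaleR_right_mono) auto
    qed
  qed
  ultimately show ?thesis by (intro exI[of _ c]) auto
qed

lemma green_mono_AE:
  fixes f g :: "real \<Rightarrow> real"
  assumes "integrable I01 f" "integrable I01 g" "AE y in I01. f y \<le> g y" "x \<in> {0..1}"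
  shows "green f x \<le> green g x"
  unfolding green_def
proof (rule integral_mono_AE[OF green_integrable[OF assms(1)] green_integrable[OF assms(2)]])
  show "AE y in I01. ((1 - \<bar>x - y\<bar>) / 2) *\<^sub>R f y \<le> ((1 - \<bar>x - y\<bar>) / 2) *\<^sub>R g y"
    using assms(3) AE_space
  proof eventually_elim
    case (elim y)
    have "0 \<le> (1 - \<bar>x - y\<bar>) / 2" using elim assms(4) by auto
    then show ?case using elim by (intro scaleR_left_mono) auto
  qed
qed

text \<open>The kernel is nonnegative, so \<open>\<bar>f\<bar>\<close> has the norm of
  \<open>f\<close> and at least its energy; hence it also attains the maximum and
  \<open>maximizer_eigenvector\<close> applies.\<close>

lemma top_eigenvector_abs:
  assumes f: "square_integrable f"
    and eig: "green_op (abs_rL2 f) = \<mu> *\<^sub>R abs_rL2 f" and max: "\<And>y. green_op y \<bullet> y \<le> \<mu> * (norm y)\<^sup>2"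
  shows "green_op (abs_rL2 (\<lambda>x. \<bar>f x\<bar>)) = \<mu> *\<^sub>R abs_rL2 (\<lambda>x. \<bar>f x\<bar>)"
proof (rule green_op.maximizer_eigenvector[OF max])
  have a: "square_integrable (\<lambda>x. \<bar>f x\<bar>)" using f by simp
  have fi: "integrable I01 f" "integrable I01 (\<lambda>x. \<bar>f x\<bar>)" using f a by (auto intro: square_integrable_integrable)
  have n: "(norm (abs_rL2 (\<lambda>x. \<bar>f x\<bar>)))\<^sup>2 = (norm (abs_rL2 f))\<^sup>2"
    using f a by (simp add: norm_abs_rL2)
  have "\<mu> * (norm (abs_rL2 f))\<^sup>2 = green_op (abs_rL2 f) \<bullet> abs_rL2 f"
    by (simp add: eig power2_norm_eq_inner)
  also have "\<dots> = (LINT x|I01. green f x * f x)" using f by (simp add: inner_green_op)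
  also have "\<dots> \<le> (LINT x|I01. green (\<lambda>x. \<bar>f x\<bar>) x * \<bar>f x\<bar>)"
  proof (rule integral_mono)
    fix x assume x: "x \<in> space I01"
    have "green f x \<le> green (\<lambda>x. \<bar>f x\<bar>) x" by (rule green_mono_AE) (use fi x in auto)
    moreover have "- green f x = green (\<lambda>x. - f x) x" using green_scale[OF fi(1), of "-1" x] by simp
    moreover have "green (\<lambda>x. - f x) x \<le> green (\<lambda>x. \<bar>f x\<bar>) x" by (rule green_mono_AE) (use fi x in auto)
    ultimately have "\<bar>green f x\<bar> \<le> green (\<lambda>x. \<bar>f x\<bar>) x" by linarith
    then have "\<bar>green f x\<bar> * \<bar>f x\<bar> \<le> green (\<lambda>x. \<bar>f x\<bar>) x * \<bar>f x\<bar>" by (rule mult_right_mono) simp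
    then show "green f x * f x \<le> green (\<lambda>x. \<bar>f x\<bar>) x * \<bar>f x\<bar>"
      using abs_ge_self[of "green f x * f x"] by (simp add: abs_mult)
  qed (use f a in \<open>auto intro!: integrable_mult_square\<close>)
  also have "\<dots> = green_op (abs_rL2 (\<lambda>x. \<bar>f x\<bar>)) \<bullet> abs_rL2 (\<lambda>x. \<bar>f x\<bar>)" using a by (simp add: inner_green_op)
  finally show "green_op (abs_rL2 (\<lambda>x. \<bar>f x\<bar>)) \<bullet> abs_rL2 (\<lambda>x. \<bar>f x\<bar>) = \<mu> * (norm (abs_rL2 (\<lambda>x. \<bar>f x\<bar>)))\<^sup>2"
    using max[of "abs_rL2 (\<lambda>x. \<bar>f x\<bar>)"] n by simp
qed

text \<open>The eigenvector equals \<open>green f / \<mu>\<close> almost everywhere, and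
  \<open>green f\<close> has a positive lower bound.\<close>

lemma nonneg_eigenvector_positive:
  assumes f: "square_integrable f" "AE x in I01. 0 \<le> f x" "abs_rL2 f \<noteq> 0"
    and eig: "green_op (abs_rL2 f) = \<mu> *\<^sub>R abs_rL2 f" and \<mu>: "0 < \<mu>"
  shows "\<exists>c>0. AE x in I01. c \<le> f x"
proof -
  obtain c where c: "c > 0" "\<And>x. x \<in> {0..1} \<Longrightarrow> c \<le> green f x"
    using green_strongly_positive[OF square_integrable_integrable[OF f(1)] f(2)] f by (auto simp: abs_rL2_eq_0_iff)
  have "abs_rL2 (green f) = abs_rL2 (\<lambda>x. \<mu> * f x)"
    using eig f by (simp add: green_op_abs abs_rL2_scale)
  then have "AE x in I01. green f x = \<mu> * f x" using f by (simp add: abs_rL2_eq_iff)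
  then have "AE x in I01. c / \<mu> \<le> f x"
    using AE_space
  proof eventually_elim
    case (elim x)
    then show ?case using c(2)[of x] \<mu> by (simp add: field_simps)
  qed
  then show ?thesis using c(1) \<mu> by (intro exI[of _ "c / \<mu>"]) auto
qed

text \<open>The interface between the operator theory above and everything below. The
  \<open>\<kappa> n\<close> are reciprocals of the eigenvalues of \<open>A\<close>;
  \<open>\<kappa>_gap\<close> says that the lowest one of \<open>A\<close> is simple.\<close>

locale green_spectrum =
  fixes \<phi> :: "nat \<Rightarrow> rL2" and \<kappa> :: "nat \<Rightarrow> real"
  assumes orthonormal: "\<And>m n. \<phi> m \<bullet> \<phi> n = (if m = n then 1 else 0)"
    and \<kappa>_pos: "\<And>n. 0 < \<kappa> n"
    and eigen: "\<And>n. green_op (\<phi> n) = \<kappa> n *\<^sub>R \<phi> n"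
    and \<kappa>_tendsto: "\<kappa> \<longlonglongrightarrow> 0"
    and \<kappa>_gap: "\<kappa> 1 < \<kappa> 0" "\<And>n. 1 \<le> n \<Longrightarrow> \<kappa> n \<le> \<kappa> 1"
    and expansion: "\<And>x. (\<lambda>n. (x \<bullet> \<phi> n) *\<^sub>R \<phi> n) sums x"
    and ground: "\<exists>e c. square_integrable e \<and> \<phi> 0 = abs_rL2 e \<and> 0 < c \<and> (AE x in I01. c \<le> e x)"

text \<open>The ground state is the absolute value of any top eigenvector. If the top eigenvalue
  were repeated, a second eigenvector \<open>h\<close> orthogonal to \<open>e\<close> would have
  constant sign, which is incompatible with orthogonality to a function bounded below by
  \<open>c > 0\<close>.\<close>

theorem green_spectrum_exists: "\<exists>\<phi> \<kappa>. green_spectrum \<phi> \<kappa>"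
proof -
  obtain x \<mu> where x: "norm x = 1" "0 < \<mu>" "green_op x = \<mu> *\<^sub>R x"
    and max: "\<And>y. green_op y \<bullet> y \<le> \<mu> * (norm y)\<^sup>2"
    using green_op.next_eigenvector[of "{}"] by auto
  obtain f where f: "square_integrable f" "x = abs_rL2 f" by (rule rL2_cases)
  define e where "e x = \<bar>f x\<bar>" for x
  have e: "square_integrable e" using f unfolding e_def[abs_def] by simp
  have Ke: "green_op (abs_rL2 e) = \<mu> *\<^sub>R abs_rL2 e"
    unfolding e_def using top_eigenvector_abs[OF f(1) _ max] x f by simp
  have "(norm (abs_rL2 e))\<^sup>2 = (norm x)\<^sup>2" using f e by (simp add: norm_abs_rL2 e_def)
  then have ne: "norm (abs_rL2 e) = 1" using x(1) power2_eq_imp_eq[of "norm (abs_rL2 e)" "norm x"] by simp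
  then have "abs_rL2 e \<noteq> 0" by auto
  then obtain c where c: "c > 0" "AE x in I01. c \<le> e x"
    using nonneg_eigenvector_positive[OF e _ _ Ke x(2)] by (auto simp: e_def)
  obtain \<phi> :: "nat \<Rightarrow> rL2" and \<kappa> :: "nat \<Rightarrow> real" where 0: "\<phi> 0 = abs_rL2 e" "\<kappa> 0 = \<mu>"
    and ort: "\<And>m n. \<phi> m \<bullet> \<phi> n = (if m = n then 1 else 0)"
    and pos: "\<And>n. 0 < \<kappa> n" and eig: "\<And>n. green_op (\<phi> n) = \<kappa> n *\<^sub>R \<phi> n"
    and mx: "\<And>n y. (\<And>i. i < n \<Longrightarrow> y \<bullet> \<phi> i = 0) \<Longrightarrow> green_op y \<bullet> y \<le> \<kappa> n * (norm y)\<^sup>2"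
  proof (rule green_op.eigensequence[OF ne Ke x(2) max])
    fix \<phi> :: "nat \<Rightarrow> rL2" and \<kappa> :: "nat \<Rightarrow> real"
    assume "\<phi> 0 = abs_rL2 e" "\<kappa> 0 = \<mu>"
      and "\<And>m n. \<phi> m \<bullet> \<phi> n = (if m = n then 1 else 0)"
      and "\<And>n. 0 < \<kappa> n" "\<And>n. green_op (\<phi> n) = \<kappa> n *\<^sub>R \<phi> n"
      and "\<And>n y. (\<And>i. i < n \<Longrightarrow> y \<bullet> \<phi> i = 0) \<Longrightarrow> green_op y \<bullet> y \<le> \<kappa> n * (norm y)\<^sup>2"
    then show thesis by (rule that[of \<phi> \<kappa>])
  qed
  note props = ort pos eig mx
  have decr: "\<kappa> n \<le> \<kappa> m" if "m \<le> n" for m n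
    by (rule green_op.eigenvalues_decreasing[OF props that])
  have "\<kappa> 1 \<noteq> \<mu>"
  proof
    assume eq: "\<kappa> 1 = \<mu>"
    obtain h where h: "square_integrable h" "\<phi> 1 = abs_rL2 h" by (rule rL2_cases)
    have Kh: "green_op (abs_rL2 h) = \<mu> *\<^sub>R abs_rL2 h" using eig[of 1] eq h by simp
    have Ka: "green_op (abs_rL2 (\<lambda>x. \<bar>h x\<bar>)) = \<mu> *\<^sub>R abs_rL2 (\<lambda>x. \<bar>h x\<bar>)"
      by (rule top_eigenvector_abs[OF h(1) Kh max])
    \<comment> \<open>Twice the positive part of \<open>h\<close>, again a top eigenvector. It is
      either zero, whence \<open>h \<le> 0\<close>, or bounded away from 0, whence
      \<open>h > 0\<close>.\<close>
    define p where "p x = \<bar>h x\<bar> + h x" for x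
    have p: "square_integrable p" "abs_rL2 p = abs_rL2 (\<lambda>x. \<bar>h x\<bar>) + abs_rL2 h"
      using h unfolding p_def[abs_def] by (simp_all add: abs_rL2_add)
    have Kp: "green_op (abs_rL2 p) = \<mu> *\<^sub>R abs_rL2 p"
      unfolding p(2) by (simp add: linear_add[OF green_op_linear] Ka Kh scaleR_right_distrib)
    have orth: "(LINT x|I01. h x * e x) = 0"
      using ort[of 1 0] h e 0 by (simp add: inner_abs_rL2)
    have he: "integrable I01 (\<lambda>x. h x * e x)" using h e by (intro integrable_mult_square)
    have sign: "(AE x in I01. 0 \<le> h x) \<or> (AE x in I01. h x \<le> 0)"
    proof (cases "abs_rL2 p = 0")
      case True
      then have "AE x in I01. p x = 0" using p by (simp add: abs_rL2_eq_0_iff)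
      then have "AE x in I01. h x \<le> 0" by eventually_elim (auto simp: p_def)
      then show ?thesis by blast
    next
      case False
      have "AE x in I01. 0 \<le> p x" by (simp add: p_def)
      then obtain d where "d > 0" "AE x in I01. d \<le> p x"
        using nonneg_eigenvector_positive[OF p(1) _ False Kp x(2)] by blast
      then have "AE x in I01. 0 \<le> h x" by (elim AE_mp) (auto intro!: AE_I2 simp: p_def)
      then show ?thesis by blast
    qed
    have "AE x in I01. h x * e x = 0"
      using sign
    proof
      assume "AE x in I01. 0 \<le> h x"
      then have "AE x in I01. 0 \<le> h x * e x" by eventually_elim (simp add: e_def)
      then show ?thesis using orth he by (simp add: integral_nonneg_eq_0_iff_AE)
    next
      assume "AE x in I01. h x \<le> 0"
      then have "AE x in I01. 0 \<le> - (h x * e x)" by eventually_elim (simp add: e_def mult_nonpos_nonneg)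
      moreover have "integrable I01 (\<lambda>x. - (h x * e x))" using he by simp
      ultimately have "AE x in I01. - (h x * e x) = 0" using orth
        by (subst integral_nonneg_eq_0_iff_AE[symmetric]) auto
      then show ?thesis by simp
    qed
    then have "AE x in I01. h x = 0" using c(2) by eventually_elim (use c(1) in auto)
    then have "\<phi> 1 = 0" using h by (simp add: abs_rL2_eq_0_iff)
    then show False using ort[of 1 1] by simp
  qed
  then have gap: "\<kappa> 1 < \<kappa> 0" using decr[of 0 1] 0(2) by simp
  have "green_spectrum \<phi> \<kappa>"
  proof
    show "\<kappa> \<longlonglongrightarrow> 0" by (rule green_op.eigenvalues_tendsto_0[OF props])
    show "\<And>x. (\<lambda>n. (x \<bullet> \<phi> n) *\<^sub>R \<phi> n) sums x" by (rule green_op.expansion[OF props])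
    show "\<exists>e c. square_integrable e \<and> \<phi> 0 = abs_rL2 e \<and> 0 < c \<and> (AE x in I01. c \<le> e x)"
      using e 0(1) c by blast
  qed (use ort pos eig gap decr in auto)
  then show ?thesis by blast
qed

subsection \<open>Resolvent and semigroup in coordinates\<close>

lemma L2_lincomb [intro]: "L2 f \<Longrightarrow> L2 g \<Longrightarrow> L2 (\<lambda>x. a * f x + b * g x)"
  by (simp add: L2_iff)

lemma L2_scale [intro]: "L2 f \<Longrightarrow> L2 (\<lambda>x. a * f x)"
  by (simp add: L2_iff)

lemma L2_uminus [intro]: "L2 f \<Longrightarrow> L2 (\<lambda>x. - f x)"
  by (simp add: L2_iff)

lemma L2_zero [simp]: "L2 (\<lambda>x. 0)"
  by (simp add: L2_iff)

lemma L2_green [intro]: "L2 g \<Longrightarrow> L2 (green g)"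
  by (rule H1_L2[OF H1_green])

lemma Re_Im_green:
  assumes "L2 g"
  shows "Re (green g x) = green (\<lambda>x. Re (g x)) x" "Im (green g x) = green (\<lambda>x. Im (g x)) x"
proof -
  have i: "integrable I01 (\<lambda>y. ((1 - \<bar>x - y\<bar>) / 2) *\<^sub>R g y)"
    by (intro green_integrable L2_integrable assms)
  show "Re (green g x) = green (\<lambda>x. Re (g x)) x"
    unfolding green_def Bochner_Integration.integral_Re[OF i, symmetric] by simp
  show "Im (green g x) = green (\<lambda>x. Im (g x)) x"
    unfolding green_def Bochner_Integration.integral_Im[OF i, symmetric] by simp
qed

lemma L2_norm_power2: "(L2_norm f)\<^sup>2 = (LINT x|I01. (cmod (f x))\<^sup>2)"
  by (simp add: L2_norm_def)

lemma L2_norm_nonneg [simp]: "0 \<le> L2_norm f"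
  by (simp add: L2_norm_def)

lemma dominated_sum_tendsto_0:
  fixes a :: "nat \<Rightarrow> 'b \<Rightarrow> real"
  assumes "\<And>n. ((a n) \<longlongrightarrow> 0) F" "eventually (\<lambda>t. \<forall>n. \<bar>a n t\<bar> \<le> M n) F" "summable M" "F \<noteq> bot"
  shows "((\<lambda>t. \<Sum>n. a n t) \<longlongrightarrow> 0) F"
proof -
  have "eventually (\<lambda>(n, t). norm (a n t) \<le> M n) (at_top \<times>\<^sub>F F)"
    unfolding eventually_prod_filter
    by (intro exI[of _ "\<lambda>_. True"] exI[of _ "\<lambda>t. \<forall>n. \<bar>a n t\<bar> \<le> M n"]) (use assms(2) in auto)
  from tannerys_theorem[OF assms(1) this assms(3,4)] show ?thesis by simp
qed

context green_spectrum
begin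

text \<open>The Hilbert space is real, so the complex coordinate is assembled from those of the real
  and imaginary parts.\<close>

definition coef :: "nat \<Rightarrow> (real \<Rightarrow> complex) \<Rightarrow> complex" where
  "coef n f = Complex (abs_rL2 (\<lambda>x. Re (f x)) \<bullet> \<phi> n) (abs_rL2 (\<lambda>x. Im (f x)) \<bullet> \<phi> n)"

definition lam :: "nat \<Rightarrow> real" where "lam n = inverse (\<kappa> n)"

lemma lam_pos: "0 < lam n"
  using \<kappa>_pos by (simp add: lam_def)

lemma lam_gap: "lam 0 < lam 1" "1 \<le> n \<Longrightarrow> lam 1 \<le> lam n"
  using \<kappa>_gap \<kappa>_pos by (auto simp: lam_def)

lemma lam_ge: "lam 0 \<le> lam n"
  using lam_gap(1) lam_gap(2)[of n] by (cases n) auto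

lemma eigen_coord: "green_op x \<bullet> \<phi> n = \<kappa> n * (x \<bullet> \<phi> n)"
  by (simp add: green_op.symmetric eigen)

lemma rL2_eqI: "(\<And>n. x \<bullet> \<phi> n = y \<bullet> \<phi> n) \<Longrightarrow> x = y"
  using expansion[of x] expansion[of y] by (simp add: sums_iff)

lemma Parseval_real: "(\<lambda>n. (x \<bullet> \<phi> n)\<^sup>2) sums (norm x)\<^sup>2"
  using bounded_linear.sums[OF bounded_linear_inner_left expansion[of x], of x]
  by (simp add: inner_commute power2_eq_square flip: power2_norm_eq_inner)

lemma coef_lincomb:
  assumes "L2 f" "L2 g"
  shows "coef n (\<lambda>x. a * f x + b * g x) = a * coef n f + b * coef n g"
proof -
  have s: "square_integrable (\<lambda>x. Re (f x))" "square_integrable (\<lambda>x. Im (f x))"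
    "square_integrable (\<lambda>x. Re (g x))" "square_integrable (\<lambda>x. Im (g x))"
    using assms by (auto simp: L2_iff)
  then show ?thesis
    by (simp add: coef_def complex_eq_iff abs_rL2_add abs_rL2_diff abs_rL2_scale inner_add_left inner_diff_left)
qed

lemma coef_scale: "L2 f \<Longrightarrow> coef n (\<lambda>x. a * f x) = a * coef n f"
  using coef_lincomb[of f f n a 0] by simp

lemma coef_diff: "L2 f \<Longrightarrow> L2 g \<Longrightarrow> coef n (\<lambda>x. f x - g x) = coef n f - coef n g"
  using coef_lincomb[of f g n 1 "-1"] by simp

lemma coef_uminus: "L2 f \<Longrightarrow> coef n (\<lambda>x. - f x) = - coef n f"
  using coef_scale[of f n "-1"] by simp

lemma coef_zero [simp]: "coef n (\<lambda>x. 0) = 0"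
  using coef_scale[of "\<lambda>x. 0" n 0] by simp

text \<open>By completeness coordinates determine the class; from here on almost everywhere
  identities are checked number by number.\<close>

lemma ae_eq_iff_coef:
  assumes "L2 f" "L2 g"
  shows "ae_eq f g \<longleftrightarrow> (\<forall>n. coef n f = coef n g)"
proof -
  have s: "square_integrable (\<lambda>x. Re (f x))" "square_integrable (\<lambda>x. Im (f x))"
    "square_integrable (\<lambda>x. Re (g x))" "square_integrable (\<lambda>x. Im (g x))"
    using assms by (auto simp: L2_iff)
  have "ae_eq f g \<longleftrightarrow> abs_rL2 (\<lambda>x. Re (f x)) = abs_rL2 (\<lambda>x. Re (g x)) \<and> abs_rL2 (\<lambda>x. Im (f x)) = abs_rL2 (\<lambda>x. Im (g x))"
    using s by (simp add: abs_rL2_eq_iff ae_eq_def complex_eq_iff)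
  also have "\<dots> \<longleftrightarrow> (\<forall>n. coef n f = coef n g)"
    unfolding coef_def complex.inject using rL2_eqI by metis
  finally show ?thesis .
qed

lemma L2_norm_Re_Im:
  assumes "L2 f"
  shows "(L2_norm f)\<^sup>2 = (norm (abs_rL2 (\<lambda>x. Re (f x))))\<^sup>2 + (norm (abs_rL2 (\<lambda>x. Im (f x))))\<^sup>2"
  using assms by (simp add: L2_iff norm_abs_rL2 L2_norm_power2 cmod_power2 integrable_square)

lemma Parseval: "L2 f \<Longrightarrow> (\<lambda>n. (cmod (coef n f))\<^sup>2) sums (L2_norm f)\<^sup>2"
  unfolding L2_norm_Re_Im coef_def cmod_power2 complex.sel
  by (intro sums_add Parseval_real)

lemma coef_exists:
  assumes "summable (\<lambda>n. (cmod (a n))\<^sup>2)"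
  shows "\<exists>f. L2 f \<and> (\<forall>n. coef n f = a n)"
proof -
  have 1: "summable (\<lambda>n. (Re (a n))\<^sup>2)" "summable (\<lambda>n. (Im (a n))\<^sup>2)"
    by (rule summable_comparison_test'[OF assms]; simp add: cmod_power2)+
  obtain x where x: "\<And>n. x \<bullet> \<phi> n = Re (a n)" using Riesz_Fischer[OF orthonormal 1(1)] by blast
  obtain y where y: "\<And>n. y \<bullet> \<phi> n = Im (a n)" using Riesz_Fischer[OF orthonormal 1(2)] by blast
  obtain f where f: "square_integrable f" "x = abs_rL2 f" by (rule rL2_cases)
  obtain g where g: "square_integrable g" "y = abs_rL2 g" by (rule rL2_cases)
  show ?thesis
    using f g x y by (intro exI[of _ "\<lambda>x. Complex (f x) (g x)"]) (simp add: L2_iff coef_def complex_eq_iff)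
qed

lemma coef_exists_dominated:
  assumes "L2 g" "\<And>n. cmod (a n) \<le> C * cmod (coef n g)"
  shows "\<exists>f. L2 f \<and> (\<forall>n. coef n f = a n)"
proof (rule coef_exists)
  have "summable (\<lambda>n. C\<^sup>2 * (cmod (coef n g))\<^sup>2)"
    using Parseval[OF assms(1)] by (intro summable_mult) (simp add: sums_iff)
  then show "summable (\<lambda>n. (cmod (a n))\<^sup>2)"
  proof (rule summable_comparison_test')
    fix n
    have "(cmod (a n))\<^sup>2 \<le> (C * cmod (coef n g))\<^sup>2" by (intro power_mono assms(2)) simp
    then show "norm ((cmod (a n))\<^sup>2) \<le> C\<^sup>2 * (cmod (coef n g))\<^sup>2" by (simp add: power_mult_distrib)
  qed
qed

lemma L2_norm_le_of_coef:
  assumes "L2 f" "L2 g" "\<And>n. cmod (coef n f) \<le> C * cmod (coef n g)" "0 \<le> C"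
  shows "L2_norm f \<le> C * L2_norm g"
proof (rule power2_le_imp_le)
  have "(cmod (coef n f))\<^sup>2 \<le> C\<^sup>2 * (cmod (coef n g))\<^sup>2" for n
    using power_mono[OF assms(3)[of n], of 2] by (simp add: power_mult_distrib)
  from sums_le[OF this Parseval[OF assms(1)] sums_mult[OF Parseval[OF assms(2)]]]
  show "(L2_norm f)\<^sup>2 \<le> (C * L2_norm g)\<^sup>2" by (simp add: power_mult_distrib)
qed (use assms(4) in simp)

lemma cmod_coef_le:
  assumes "L2 f" shows "cmod (coef n f) \<le> L2_norm f"
proof (rule power2_le_imp_le)
  have "(\<Sum>k\<in>{n}. (cmod (coef k f))\<^sup>2) \<le> (L2_norm f)\<^sup>2"
    using Parseval[OF assms] by (metis (lifting) finite.emptyI finite.insertI sum_le_suminf sums_iff zero_le_power2)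
  then show "(cmod (coef n f))\<^sup>2 \<le> (L2_norm f)\<^sup>2" by simp
qed simp

lemma coef_green: "L2 g \<Longrightarrow> coef n (green g) = \<kappa> n * coef n g"
  by (simp add: coef_def Re_Im_green complex_eq_iff L2_iff flip: green_op_abs eigen_coord)

text \<open>The Green operator multiplies coordinates by \<open>\<kappa> n\<close>, and
  \<open>lam n\<close> is the reciprocal. The domain of \<open>A\<close> is encoded by the existence
  of an L2 function \<open>g\<close> with the scaled coordinates.\<close>

lemma opA_iff_coef: "opA f g \<longleftrightarrow> L2 f \<and> L2 g \<and> (\<forall>n. coef n g = lam n * coef n f)"
proof -
  have "coef n f = \<kappa> n * coef n g \<longleftrightarrow> coef n g = lam n * coef n f" for n
    using \<kappa>_pos[of n] by (auto simp: lam_def field_simps)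
  moreover have "ae_eq f (green g) \<longleftrightarrow> (\<forall>n. coef n f = \<kappa> n * coef n g)" if "L2 f" "L2 g"
    unfolding ae_eq_iff_coef[OF that(1) L2_green[OF that(2)]] coef_green[OF that(2)] ..
  ultimately show ?thesis unfolding opA_iff_green by metis
qed

text \<open>The hypothesis bounds \<open>1 / (z + lam n)\<close> by \<open>1 / (c * lam 0)\<close>
  and \<open>lam n / (z + lam n)\<close> by \<open>1 / c\<close>. The first bound gives the solution
  \<open>f\<close> and the resolvent estimate, the second gives \<open>A f\<close> in L2.\<close>

lemma resolvent_setI:
  fixes z :: complex
  assumes c: "c > 0" "\<And>n. c * lam n \<le> cmod (z + lam n)"
  shows "z \<in> resolvent_set_negA"
proof -
  have nz: "z + lam n \<noteq> 0" for n
    using c(2)[of n] mult_pos_pos[OF c(1) lam_pos[of n]] by auto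
  have c0: "c * lam 0 \<le> cmod (z + lam n)" for n
    using c(2)[of n] mult_left_mono[OF lam_ge[of n], of c] c(1) by linarith
  have c0_pos: "c * lam 0 > 0" using c(1) lam_pos by simp
  define C where "C = 1 / (c * lam 0)"
  have C: "C \<ge> 0" using c0_pos by (simp add: C_def)
  have coefs: "coef n (\<lambda>x. z * f x + h x) = (z + lam n) * coef n f" if "opA f h" for f h n
    using that coef_lincomb[of f h n z 1] by (simp add: opA_iff_coef distrib_right)
  have L: "L2 (\<lambda>x. z * f x + h x)" if "opA f h" for f h
    using that L2_lincomb[of f h z 1] by (simp add: opA_iff_coef)
  have div: "cmod a \<le> C * cmod ((z + lam n) * a)" for a n
  proof -
    have "c * lam 0 * cmod a \<le> cmod (z + lam n) * cmod a" by (intro mult_right_mono c0) simp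
    then show ?thesis unfolding C_def norm_mult using c0_pos by (simp add: field_simps)
  qed
  have bound: "L2_norm f \<le> C * L2_norm (\<lambda>x. z * f x + h x)" if "opA f h" for f h
    by (rule L2_norm_le_of_coef) (use that L coefs div C in \<open>auto simp: opA_iff_coef\<close>)
  have surj: "\<exists>f h. opA f h \<and> ae_eq (\<lambda>x. z * f x + h x) g" if g: "L2 g" for g
  proof -
    have "cmod (coef n g / (z + lam n)) \<le> C * cmod (coef n g)" for n
      using div[of "coef n g / (z + lam n)" n] nz[of n] by simp
    from coef_exists_dominated[OF g this]
    have "\<exists>f. L2 f \<and> (\<forall>n. coef n f = coef n g / (z + lam n))" .
    then obtain f where f: "L2 f" "\<And>n. coef n f = coef n g / (z + lam n)" by blast
    have "cmod (lam n * coef n f) \<le> (1 / c) * cmod (coef n g)" for n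
    proof -
      have "c * lam n * cmod (coef n f) \<le> cmod (z + lam n) * cmod (coef n f)"
        by (intro mult_right_mono c) simp
      also have "\<dots> = cmod (coef n g)" using nz by (simp add: f(2) flip: norm_mult)
      finally show ?thesis using c(1) lam_pos[of n] by (simp add: norm_mult field_simps)
    qed
    from coef_exists_dominated[OF g this] obtain h where h: "L2 h" "\<And>n. coef n h = lam n * coef n f" by blast
    have op: "opA f h" using f h by (simp add: opA_iff_coef)
    have "ae_eq (\<lambda>x. z * f x + h x) g"
      using ae_eq_iff_coef[OF L[OF op] g] coefs[OF op] f(2) nz by simp
    then show ?thesis using op by blast
  qed
  have inj: "ae_eq f (\<lambda>x. 0)" if "opA f h" "ae_eq (\<lambda>x. z * f x + h x) (\<lambda>x. 0)" for f h
  proof -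
    have "(z + lam n) * coef n f = 0" for n
      using that ae_eq_iff_coef[OF L[OF that(1)] L2_zero] coefs[OF that(1)] by simp
    then show ?thesis using that(1) nz by (subst ae_eq_iff_coef) (auto simp: opA_iff_coef)
  qed
  show ?thesis unfolding resolvent_set_negA_def using bound surj inj by blast
qed

lemma spectrum_negative: "spectrum_negA \<subseteq> complex_of_real ` {..<0}"
proof -
  have "z \<in> resolvent_set_negA" if z: "z \<notin> complex_of_real ` {..<0}" for z
  proof (cases "0 \<le> Re z")
    case True
    show ?thesis
    proof (rule resolvent_setI[of 1])
      fix n
      have "lam n \<le> Re (z + lam n)" using True by simp
      also have "\<dots> \<le> cmod (z + lam n)" by (rule complex_Re_le_cmod)
      finally show "1 * lam n \<le> cmod (z + lam n)" by simp
    qed simp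
  next
    case False
    have Im: "Im z \<noteq> 0"
    proof
      assume "Im z = 0"
      then have "z = complex_of_real (Re z)" by (simp add: complex_eq_iff)
      then show False using z False by (metis imageI lessThan_iff not_le)
    qed
    then have zpos: "cmod z > 0" by auto
    \<comment> \<open>The term 1/2 serves indices with \<open>lam n \<ge> 2 * cmod z\<close>, where
      \<open>cmod (z + lam n)\<close> is at least \<open>lam n / 2\<close>. For the others
      \<open>cmod (z + lam n)\<close> is at least \<open>\<bar>Im z\<bar>\<close> and
      \<open>lam n\<close> is below \<open>2 * cmod z\<close>.\<close>
    define c where "c = min (1/2) (\<bar>Im z\<bar> / (2 * cmod z))"
    have c: "c > 0" using Im zpos by (simp add: c_def)
    show ?thesis
    proof (rule resolvent_setI[OF c])
      fix n
      show "c * lam n \<le> cmod (z + lam n)"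
      proof (cases "2 * cmod z \<le> lam n")
        case True
        have "c * lam n \<le> 1/2 * lam n" using lam_pos[of n] by (intro mult_right_mono) (auto simp: c_def)
        also have "\<dots> \<le> cmod (complex_of_real (lam n)) - cmod z" using True lam_pos[of n] by simp
        also have "\<dots> \<le> cmod (z + lam n)" by (metis add.commute norm_diff_ineq)
        finally show ?thesis .
      next
        case False
        have "c * lam n \<le> \<bar>Im z\<bar> / (2 * cmod z) * (2 * cmod z)"
          using False lam_pos[of n] c by (intro mult_mono) (auto simp: c_def)
        also have "\<dots> = \<bar>Im (z + lam n)\<bar>" using zpos by simp
        also have "\<dots> \<le> cmod (z + lam n)" by (rule abs_Im_le_cmod)
        finally show ?thesis .
      qed
    qed
  qed
  then show ?thesis by (auto simp: spectrum_negA_def)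
qed

section \<open>The semigroup built from coordinates\<close>

text \<open>\<open>SOME\<close> picks a representative; its class is determined by the
  coordinates.\<close>

definition semigroup :: "real \<Rightarrow> (real \<Rightarrow> complex) \<Rightarrow> real \<Rightarrow> complex" where
  "semigroup t f = (SOME g. L2 g \<and> (\<forall>n. coef n g = exp (- lam n * t) * coef n f))"

lemma semigroup:
  assumes "L2 f" "0 \<le> t"
  shows "L2 (semigroup t f)" "coef n (semigroup t f) = exp (- lam n * t) * coef n f"
proof -
  have "cmod (complex_of_real (exp (- lam n * t)) * coef n f) \<le> 1 * cmod (coef n f)" for n
    unfolding norm_mult using lam_pos[of n] assms(2) by (intro mult_right_mono) auto
  from someI_ex[OF coef_exists_dominated[OF assms(1) this]]
  show "L2 (semigroup t f)" "coef n (semigroup t f) = exp (- lam n * t) * coef n f"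
    unfolding semigroup_def by auto
qed

text \<open>Parseval turns the norm into a series, and dominated convergence for series handles the
  limit.\<close>

lemma L2_norm_tendsto_0:
  assumes L: "eventually (\<lambda>t. L2 (g t)) F"
    and lim: "\<And>n. ((\<lambda>t. coef n (g t)) \<longlongrightarrow> 0) F"
    and bound: "eventually (\<lambda>t. \<forall>n. (cmod (coef n (g t)))\<^sup>2 \<le> M n) F" and "summable M" "F \<noteq> bot"
  shows "((\<lambda>t. L2_norm (g t)) \<longlongrightarrow> 0) F"
proof -
  have "((\<lambda>t. \<Sum>n. (cmod (coef n (g t)))\<^sup>2) \<longlongrightarrow> 0) F"
  proof (rule dominated_sum_tendsto_0[OF _ _ assms(4,5)])
    show "((\<lambda>t. (cmod (coef n (g t)))\<^sup>2) \<longlongrightarrow> 0) F" for n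
      using tendsto_power[OF tendsto_norm[OF lim[of n]], of 2] by simp
  qed (use bound in simp)
  then have "((\<lambda>t. sqrt (\<Sum>n. (cmod (coef n (g t)))\<^sup>2)) \<longlongrightarrow> sqrt 0) F"
    by (rule tendsto_real_sqrt)
  moreover have "eventually (\<lambda>t. sqrt (\<Sum>n. (cmod (coef n (g t)))\<^sup>2) = L2_norm (g t)) F"
    using L by eventually_elim (simp add: sums_unique[OF Parseval, symmetric])
  ultimately show ?thesis by (simp add: tendsto_cong)
qed

lemma exp_quotient_tendsto: "((\<lambda>t. (exp (- l * t) - 1) / t) \<longlongrightarrow> - l) (at_right (0::real))"
proof -
  have "((\<lambda>t. exp (- l * t)) has_real_derivative (exp (- l * 0) * (- l))) (at 0)"
    by (auto intro!: derivative_eq_intros)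
  then have "((\<lambda>t. (exp (- l * t) - 1) / t) \<longlongrightarrow> - l) (at 0)"
    by (simp add: has_field_derivative_iff)
  then show ?thesis by (rule filterlim_mono) (auto simp: at_le)
qed

lemma generator_quotient_coef:
  assumes "L2 f" "L2 g" "L2 h"
  shows "L2 (\<lambda>x. (g x - f x) / of_real t - h x)"
    "coef n (\<lambda>x. (g x - f x) / of_real t - h x) = (coef n g - coef n f) / of_real t - coef n h"
proof -
  have L: "L2 (\<lambda>x. g x - f x)" using assms by (intro L2_diff)
  have eq: "(\<lambda>x. (g x - f x) / of_real t - h x) = (\<lambda>x. (1 / of_real t) * (g x - f x) - h x)" by simp
  show "L2 (\<lambda>x. (g x - f x) / of_real t - h x)" unfolding eq using L assms by (intro L2_diff L2_scale)
  show "coef n (\<lambda>x. (g x - f x) / of_real t - h x) = (coef n g - coef n f) / of_real t - coef n h"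
    unfolding eq coef_diff[OF L2_scale[OF L] assms(3)] coef_scale[OF L] coef_diff[OF assms(2,1)] by simp
qed

text \<open>Both sides say that \<open>coef n h\<close> is \<open>- lam n * coef n f\<close> for all
  \<open>n\<close>. Norm convergence implies this since a coordinate is bounded by the norm;
  conversely the coordinates of the quotient error are dominated by those of
  \<open>h\<close>.\<close>

lemma semigroup_generator:
  assumes f: "L2 f" and h: "L2 h"
  shows "((\<lambda>t. L2_norm (\<lambda>x. (semigroup t f x - f x) / of_real t - h x)) \<longlongrightarrow> 0) (at_right 0)
    \<longleftrightarrow> opA f (\<lambda>x. - h x)" (is "?lim \<longleftrightarrow> _")
proof -
  define q where "q t x = (semigroup t f x - f x) / of_real t - h x" for t x
  have pos: "eventually (\<lambda>t::real. 0 < t) (at_right 0)" by (simp add: eventually_at_right_less)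
  have q: "L2 (q t)" "coef n (q t) = of_real ((exp (- lam n * t) - 1) / t) * coef n f - coef n h" if "0 < t" for t n
    unfolding q_def
    using generator_quotient_coef(1)[OF f semigroup(1)[OF f] h, of t t]
      generator_quotient_coef(2)[OF f semigroup(1)[OF f] h, of t n t] semigroup(2)[OF f, of t n] that
    by (auto simp: algebra_simps diff_divide_distrib)
  have lim: "((\<lambda>t. coef n (q t)) \<longlongrightarrow> of_real (- lam n) * coef n f - coef n h) (at_right 0)" for n
  proof -
    have "((\<lambda>t. of_real ((exp (- lam n * t) - 1) / t) * coef n f - coef n h) \<longlongrightarrow> of_real (- lam n) * coef n f - coef n h) (at_right 0)"
      by (intro tendsto_intros exp_quotient_tendsto)
    moreover have "eventually (\<lambda>t. coef n (q t) = of_real ((exp (- lam n * t) - 1) / t) * coef n f - coef n h) (at_right 0)"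
      using pos by eventually_elim (rule q(2))
    ultimately show ?thesis by (simp only: tendsto_cong)
  qed
  have "?lim \<longleftrightarrow> (\<forall>n. coef n h = - of_real (lam n) * coef n f)"
  proof
    assume l: ?lim
    show "\<forall>n. coef n h = - of_real (lam n) * coef n f"
    proof
      fix n
      have "eventually (\<lambda>t. norm (coef n (q t)) \<le> L2_norm (q t)) (at_right 0)"
        using pos by eventually_elim (intro cmod_coef_le q)
      from Lim_null_comparison[OF this] l have "((\<lambda>t. coef n (q t)) \<longlongrightarrow> 0) (at_right 0)"
        unfolding q_def by blast
      from tendsto_unique[OF _ lim this] show "coef n h = - of_real (lam n) * coef n f" by simp
    qed
  next
    assume hn: "\<forall>n. coef n h = - of_real (lam n) * coef n f"
    have "((\<lambda>t. L2_norm (q t)) \<longlongrightarrow> 0) (at_right 0)"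
    proof (rule L2_norm_tendsto_0)
      show "eventually (\<lambda>t. L2 (q t)) (at_right 0)" using pos by eventually_elim (rule q(1))
      show "((\<lambda>t. coef n (q t)) \<longlongrightarrow> 0) (at_right 0)" for n using lim[of n] hn by simp
      show "summable (\<lambda>n. (cmod (coef n h))\<^sup>2)" using Parseval[OF h] by (simp add: sums_iff)
      show "eventually (\<lambda>t. \<forall>n. (cmod (coef n (q t)))\<^sup>2 \<le> (cmod (coef n h))\<^sup>2) (at_right 0)"
        using pos
      proof eventually_elim
        case (elim t)
        show ?case
        proof
          fix n
          \<comment> \<open>The real factor lies between 0 and \<open>lam n\<close>, by
            \<open>exp s \<ge> 1 + s\<close> and by
            \<open>exp (- lam n * t) \<le> 1\<close>.\<close>
          have "coef n (q t) = of_real ((exp (- lam n * t) - 1) / t + lam n) * coef n f"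
            using q(2)[OF elim, of n] hn by (simp add: algebra_simps)
          moreover have "0 \<le> (exp (- lam n * t) - 1) / t + lam n"
            using exp_ge_add_one_self[of "- lam n * t"] elim by (simp add: field_simps)
          moreover have "(exp (- lam n * t) - 1) / t \<le> 0"
            using elim lam_pos[of n] by (intro divide_nonpos_pos) auto
          ultimately have "cmod (coef n (q t)) \<le> lam n * cmod (coef n f)"
            by (simp add: norm_mult mult_right_mono del: of_real_add of_real_diff of_real_divide)
          then show "(cmod (coef n (q t)))\<^sup>2 \<le> (cmod (coef n h))\<^sup>2"
            using hn lam_pos[of n] by (intro power_mono) (auto simp: norm_mult)
        qed
      qed
    qed simp
    then show ?lim by (simp add: q_def[abs_def])
  qed
  also have "\<dots> \<longleftrightarrow> opA f (\<lambda>x. - h x)"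
  proof -
    have "coef n h = - of_real (lam n) * coef n f \<longleftrightarrow> coef n (\<lambda>x. - h x) = of_real (lam n) * coef n f" for n
      using h by (simp add: coef_uminus) (metis minus_minus)
    then show ?thesis using f h L2_uminus[OF h] unfolding opA_iff_coef by blast
  qed
  finally show ?thesis .
qed

theorem semigroup_C0: "C0_semigroup_gen_negA semigroup"
  unfolding C0_semigroup_gen_negA_def
proof (intro conjI allI impI; (elim conjE)?)
  note sg = semigroup(1)
  fix f g :: "real \<Rightarrow> complex" and s t :: real and a b :: complex
  show "0 \<le> t \<Longrightarrow> L2 f \<Longrightarrow> L2 (semigroup t f)" by (rule sg)
  show "0 \<le> t \<Longrightarrow> L2 f \<Longrightarrow> L2 g \<Longrightarrow> ae_eq f g \<Longrightarrow> ae_eq (semigroup t f) (semigroup t g)"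
    by (simp add: ae_eq_iff_coef semigroup)
  show "0 \<le> t \<Longrightarrow> L2 f \<Longrightarrow> L2 g \<Longrightarrow>
      ae_eq (semigroup t (\<lambda>x. a * f x + b * g x)) (\<lambda>x. a * semigroup t f x + b * semigroup t g x)"
    by (subst ae_eq_iff_coef) (auto simp: coef_lincomb semigroup L2_lincomb algebra_simps)
  show "0 \<le> t \<Longrightarrow> \<exists>C. \<forall>f. L2 f \<longrightarrow> L2_norm (semigroup t f) \<le> C * L2_norm f"
  proof (intro exI[of _ 1] allI impI)
    fix f assume t: "0 \<le> t" and f: "L2 f"
    show "L2_norm (semigroup t f) \<le> 1 * L2_norm f"
    proof (rule L2_norm_le_of_coef[OF sg[OF f t] f])
      show "cmod (coef n (semigroup t f)) \<le> 1 * cmod (coef n f)" for n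
        unfolding semigroup(2)[OF f t] norm_mult using lam_pos[of n] t by (intro mult_right_mono) auto
    qed simp
  qed
  show "L2 f \<Longrightarrow> ae_eq (semigroup 0 f) f" by (simp add: ae_eq_iff_coef semigroup)
  show "0 \<le> s \<Longrightarrow> 0 \<le> t \<Longrightarrow> L2 f \<Longrightarrow> ae_eq (semigroup (s + t) f) (semigroup s (semigroup t f))"
    by (simp add: ae_eq_iff_coef semigroup distrib_left exp_add exp_diff divide_inverse exp_minus)
  show "L2 f \<Longrightarrow> ((\<lambda>t. L2_norm (\<lambda>x. semigroup t f x - f x)) \<longlongrightarrow> 0) (at_right 0)"
  proof -
    assume f: "L2 f"
    have pos: "eventually (\<lambda>t::real. 0 < t) (at_right 0)" by (simp add: eventually_at_right_less)
    have c: "coef n (\<lambda>x. semigroup t f x - f x) = of_real (exp (- lam n * t) - 1) * coef n f" if "0 < t" for n t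
      using that f by (simp add: coef_diff semigroup algebra_simps)
    show ?thesis
    proof (rule L2_norm_tendsto_0)
      show "eventually (\<lambda>t. L2 (\<lambda>x. semigroup t f x - f x)) (at_right 0)"
        using pos by eventually_elim (simp add: L2_diff semigroup f)
      show "((\<lambda>t. coef n (\<lambda>x. semigroup t f x - f x)) \<longlongrightarrow> 0) (at_right 0)" for n
      proof -
        have "((\<lambda>t. of_real (exp (- lam n * t) - 1) * coef n f) \<longlongrightarrow> of_real (exp (- lam n * 0) - 1) * coef n f) (at_right 0)"
          by (intro tendsto_intros)
        moreover have "eventually (\<lambda>t. coef n (\<lambda>x. semigroup t f x - f x) = of_real (exp (- lam n * t) - 1) * coef n f) (at_right 0)"
          using pos by eventually_elim (rule c)
        ultimately show ?thesis by (simp add: tendsto_cong)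
      qed
      show "summable (\<lambda>n. (cmod (coef n f))\<^sup>2)" using Parseval[OF f] by (simp add: sums_iff)
      show "eventually (\<lambda>t. \<forall>n. (cmod (coef n (\<lambda>x. semigroup t f x - f x)))\<^sup>2 \<le> (cmod (coef n f))\<^sup>2) (at_right 0)"
        using pos
      proof eventually_elim
        case (elim t)
        have "\<bar>exp (- lam n * t) - 1\<bar> * cmod (coef n f) \<le> 1 * cmod (coef n f)" for n
          using lam_pos[of n] elim by (intro mult_right_mono) auto
        then show ?case
          by (auto simp: c[OF elim] norm_mult simp del: of_real_diff intro!: power_mono)
      qed
    qed simp
  qed
  show "L2 f \<Longrightarrow> L2 g \<Longrightarrow>
    (((\<lambda>t. L2_norm (\<lambda>x. (semigroup t f x - f x) / of_real t - g x)) \<longlongrightarrow> 0) (at_right 0) \<longleftrightarrow> opA f (\<lambda>x. - g x))"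
    by (rule semigroup_generator)
qed

end

text \<open>\<open>opA f g\<close> means that \<open>f\<close> is \<open>R(0, -A) g\<close>, which
  is \<open>green g\<close> almost everywhere. The imaginary part of \<open>g\<close> vanishes, so
  the real estimate for the kernel applies.\<close>

lemma resolvent_strongly_pos:
  assumes "opA f g" "nonneg g" "\<not> ae_eq g (\<lambda>x. 0)"
  shows "strongly_pos f"
proof -
  have g: "L2 g" and eq: "ae_eq f (green g)" using assms(1) by (auto simp: opA_iff_green)
  have s: "integrable I01 (\<lambda>x. Re (g x))" "integrable I01 (\<lambda>x. Im (g x))"
    using g by (auto simp: L2_iff intro: square_integrable_integrable)
  have nn: "AE x in I01. 0 \<le> Re (g x)" and im: "AE x in I01. Im (g x) = 0"
    using assms(2) by (auto simp: nonneg_def)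
  have "\<not> (AE x in I01. Re (g x) = 0)"
  proof
    assume "AE x in I01. Re (g x) = 0"
    with im have "ae_eq g (\<lambda>x. 0)" unfolding ae_eq_def by eventually_elim (simp add: complex_eq_iff)
    then show False using assms(3) by simp
  qed
  then obtain c where c: "c > 0" "\<And>x. x \<in> {0..1} \<Longrightarrow> c \<le> green (\<lambda>x. Re (g x)) x"
    using green_strongly_positive[OF s(1) nn] by blast
  have "green (\<lambda>x. Im (g x)) = green (\<lambda>x. 0)"
    by (rule green_cong_AE[OF s(2) _ im]) simp
  then have im: "Im (green g x) = 0" for x unfolding Re_Im_green(2)[OF g] by (simp add: green_def)
  have re: "c \<le> Re (green g x)" if "x \<in> {0..1}" for x using c(2)[OF that] by (simp add: Re_Im_green[OF g])
  have "AE x in I01. Im (f x) = 0 \<and> c \<le> Re (f x)"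
    using eq[unfolded ae_eq_def] AE_space by eventually_elim (use im re in auto)
  then show ?thesis using c(1) by (auto simp: strongly_pos_def)
qed

subsection \<open>Uniqueness of the semigroup\<close>

text \<open>A discrete Gronwall estimate for a vector whose relative change per step is at most
  \<open>\<delta>\<close> in the sum norm.\<close>

lemma perturbed_iteration:
  fixes y :: "nat \<Rightarrow> 'a \<Rightarrow> complex"
  assumes J: "finite J" and \<delta>: "0 \<le> \<delta>"
    and step: "\<And>k. (\<Sum>n\<in>J. cmod (y (Suc k) n - y k n)) \<le> \<delta> * (\<Sum>n\<in>J. cmod (y k n))"
  shows "(\<Sum>n\<in>J. cmod (y k n - y 0 n)) \<le> ((1 + \<delta>) ^ k - 1) * (\<Sum>n\<in>J. cmod (y 0 n))"
proof -
  define Y where "Y k = (\<Sum>n\<in>J. cmod (y k n))" for k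
  have Y: "Y k \<le> (1 + \<delta>) ^ k * Y 0" for k
  proof (induction k)
    case (Suc k)
    have "Y (Suc k) \<le> (\<Sum>n\<in>J. cmod (y (Suc k) n - y k n) + cmod (y k n))"
      unfolding Y_def
    proof (rule sum_mono)
      fix n show "cmod (y (Suc k) n) \<le> cmod (y (Suc k) n - y k n) + cmod (y k n)"
        using norm_triangle_ineq[of "y (Suc k) n - y k n" "y k n"] by simp
    qed
    also have "\<dots> \<le> (1 + \<delta>) * Y k" using step[of k] by (simp add: sum.distrib Y_def algebra_simps)
    also have "\<dots> \<le> (1 + \<delta>) * ((1 + \<delta>) ^ k * Y 0)" using Suc \<delta> by (intro mult_left_mono) auto
    finally show ?case by simp
  qed simp
  have "(\<Sum>n\<in>J. cmod (y k n - y 0 n)) \<le> ((1 + \<delta>) ^ k - 1) * Y 0"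
  proof (induction k)
    case (Suc k)
    have "(\<Sum>n\<in>J. cmod (y (Suc k) n - y 0 n)) \<le> (\<Sum>n\<in>J. cmod (y (Suc k) n - y k n) + cmod (y k n - y 0 n))"
    proof (rule sum_mono)
      fix n show "cmod (y (Suc k) n - y 0 n) \<le> cmod (y (Suc k) n - y k n) + cmod (y k n - y 0 n)"
        using norm_triangle_ineq[of "y (Suc k) n - y k n" "y k n - y 0 n"] by simp
    qed
    also have "\<dots> \<le> \<delta> * Y k + ((1 + \<delta>) ^ k - 1) * Y 0"
      using step[of k] Suc by (simp add: sum.distrib Y_def)
    also have "\<dots> \<le> \<delta> * ((1 + \<delta>) ^ k * Y 0) + ((1 + \<delta>) ^ k - 1) * Y 0"
      using mult_left_mono[OF Y \<delta>, of k] by simp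
    finally show ?case by (simp add: algebra_simps)
  qed simp
  then show ?thesis by (simp add: Y_def)
qed

context green_spectrum
begin

definition psi :: "nat \<Rightarrow> real \<Rightarrow> complex" where
  "psi m = (SOME f. L2 f \<and> (\<forall>n. coef n f = (if n = m then 1 else 0)))"

lemma psi: "L2 (psi m)" "coef n (psi m) = (if n = m then 1 else 0)"
proof -
  have "summable (\<lambda>n. (cmod (if n = m then 1 else 0))\<^sup>2)"
    by (rule summable_finite[of "{m}"]) auto
  from someI_ex[OF coef_exists[OF this]]
  show "L2 (psi m)" "coef n (psi m) = (if n = m then 1 else 0)" unfolding psi_def by auto
qed

text \<open>Infinitely many indices would contradict
  \<open>\<kappa> \<longlonglongrightarrow> 0\<close>. Finiteness lets the uniqueness proof work
  with matrices.\<close>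

lemma finite_eigenspace: "finite {n. lam n = l}"
proof (cases "\<exists>n. lam n = l")
  case True
  then have l: "l > 0" using lam_pos by auto
  then have "eventually (\<lambda>n. \<kappa> n < inverse l) sequentially"
    by (intro order_tendstoD[OF \<kappa>_tendsto]) simp
  then obtain N where N: "\<And>n. n \<ge> N \<Longrightarrow> \<kappa> n < inverse l" by (auto simp: eventually_sequentially)
  have "n < N" if "lam n = l" for n
  proof (rule ccontr)
    assume "\<not> n < N"
    then have "\<kappa> n < inverse l" using N by simp
    then show False using that by (auto simp: lam_def)
  qed
  then have "{n. lam n = l} \<subseteq> {..<N}" by blast
  then show ?thesis by (rule finite_subset) simp
next
  case False
  then have "{n. lam n = l} = {}" by blast
  then show ?thesis by simp
qed

lemma opA_psi: "opA (psi m) (\<lambda>x. of_real (lam m) * psi m x)"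
  unfolding opA_iff_coef by (intro conjI allI L2_scale psi(1)) (auto simp: psi(2) coef_scale[OF psi(1)])

lemma head_exists: "L2 f \<Longrightarrow> \<exists>s. L2 s \<and> (\<forall>n. coef n s = (if n < N then coef n f else 0))"
  by (rule coef_exists_dominated[of f _ 1]) auto

text \<open>\<open>T\<close> is an arbitrary family satisfying the semigroup axioms. Its values are
  representatives, so the axioms are first translated into identities of coordinates; the goal is
  \<open>T_coef\<close>.\<close>

context
  fixes T assumes T: "C0_semigroup_gen_negA T"
begin

lemmas T_L2 = T[unfolded C0_semigroup_gen_negA_def, THEN conjunct1, rule_format]
lemmas T_ae_cong = T[unfolded C0_semigroup_gen_negA_def, THEN conjunct2, THEN conjunct1, rule_format]
lemmas T_ae_lincomb = T[unfolded C0_semigroup_gen_negA_def, THEN conjunct2, THEN conjunct2, THEN conjunct1, rule_format]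
lemmas T_ae_bounded = T[unfolded C0_semigroup_gen_negA_def, THEN conjunct2, THEN conjunct2, THEN conjunct2, THEN conjunct1, rule_format]
lemmas T_ae_zero = T[unfolded C0_semigroup_gen_negA_def, THEN conjunct2, THEN conjunct2, THEN conjunct2, THEN conjunct2, THEN conjunct1, rule_format]
lemmas T_ae_add = T[unfolded C0_semigroup_gen_negA_def, THEN conjunct2, THEN conjunct2, THEN conjunct2, THEN conjunct2, THEN conjunct2, THEN conjunct1, rule_format]
lemmas T_generator = T[unfolded C0_semigroup_gen_negA_def, THEN conjunct2, THEN conjunct2, THEN conjunct2, THEN conjunct2, THEN conjunct2, THEN conjunct2, THEN conjunct2, rule_format]

lemma T_cong: "0 \<le> t \<Longrightarrow> L2 f \<Longrightarrow> L2 g \<Longrightarrow> (\<And>n. coef n f = coef n g) \<Longrightarrow> coef n (T t f) = coef n (T t g)"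
proof -
  assume *: "0 \<le> t" "L2 f" "L2 g" "\<And>n. coef n f = coef n g"
  then have "ae_eq f g" by (simp add: ae_eq_iff_coef)
  then have "ae_eq (T t f) (T t g)" using * by (intro T_ae_cong) auto
  then show ?thesis using * T_L2 by (simp add: ae_eq_iff_coef)
qed

lemma T_lincomb:
  assumes "0 \<le> t" "L2 f" "L2 g"
  shows "coef n (T t (\<lambda>x. a * f x + b * g x)) = a * coef n (T t f) + b * coef n (T t g)"
proof -
  have "ae_eq (T t (\<lambda>x. a * f x + b * g x)) (\<lambda>x. a * T t f x + b * T t g x)"
    using assms by (intro T_ae_lincomb) auto
  then have "coef n (T t (\<lambda>x. a * f x + b * g x)) = coef n (\<lambda>x. a * T t f x + b * T t g x)"
    using assms T_L2 by (subst (asm) ae_eq_iff_coef) auto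
  then show ?thesis using assms by (simp add: coef_lincomb T_L2)
qed

lemma T_scale: "0 \<le> t \<Longrightarrow> L2 f \<Longrightarrow> coef n (T t (\<lambda>x. a * f x)) = a * coef n (T t f)"
  using T_lincomb[of t f f n a 0] by simp

lemma T_bounded: "0 \<le> t \<Longrightarrow> \<exists>C\<ge>0. \<forall>f. L2 f \<longrightarrow> L2_norm (T t f) \<le> C * L2_norm f"
proof -
  assume "0 \<le> t"
  then obtain C where C: "\<And>f. L2 f \<Longrightarrow> L2_norm (T t f) \<le> C * L2_norm f"
    using T_ae_bounded by blast
  have "L2_norm (T t f) \<le> \<bar>C\<bar> * L2_norm f" if "L2 f" for f
    using C[OF that] mult_right_mono[OF abs_ge_self[of C] L2_norm_nonneg[of f]] by linarith
  then show ?thesis by (intro exI[of _ "\<bar>C\<bar>"]) auto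
qed

lemma T_zero: "L2 f \<Longrightarrow> coef n (T 0 f) = coef n f"
proof -
  assume f: "L2 f"
  then have "ae_eq (T 0 f) f" by (rule T_ae_zero)
  then show ?thesis using f T_L2[of 0 f] by (simp add: ae_eq_iff_coef)
qed

lemma T_add: "0 \<le> s \<Longrightarrow> 0 \<le> t \<Longrightarrow> L2 f \<Longrightarrow> coef n (T (s + t) f) = coef n (T s (T t f))"
proof -
  assume *: "0 \<le> s" "0 \<le> t" "L2 f"
  then have "ae_eq (T (s + t) f) (T s (T t f))" by (intro T_ae_add)
  then show ?thesis using * by (simp add: ae_eq_iff_coef T_L2)
qed

text \<open>\<open>T t\<close> commutes with \<open>T s\<close>, hence maps the difference quotient
  of \<open>f\<close> to that of \<open>T t f\<close>; being bounded, it carries the limit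
  along.\<close>

lemma T_generator_commute:
  assumes op: "opA f g" and t: "0 \<le> t"
  shows "opA (T t f) (T t g)"
proof -
  have f: "L2 f" and g: "L2 g" using op by (auto simp: opA_iff_coef)
  define h where "h x = - g x" for x
  have h: "L2 h" using L2_uminus[OF g] by (simp add: h_def[abs_def])
  define q where "q s x = (T s f x - f x) / of_real s - h x" for s x
  define r where "r s x = (T s (T t f) x - T t f x) / of_real s - T t h x" for s x
  have q0: "((\<lambda>s. L2_norm (q s)) \<longlongrightarrow> 0) (at_right 0)"
    using T_generator[OF conjI[OF f h]] op by (simp add: q_def[abs_def] h_def)
  obtain C where C: "\<And>f. L2 f \<Longrightarrow> L2_norm (T t f) \<le> C * L2_norm f" using T_bounded[OF t] by blast
  have pos: "eventually (\<lambda>s::real. 0 < s) (at_right 0)" by (simp add: eventually_at_right_less)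
  have le: "L2_norm (r s) \<le> C * L2_norm (q s)" if s: "0 < s" for s
  proof -
    have Tf: "L2 (T s f)" "L2 (T t f)" "L2 (T t h)" "L2 (T s (T t f))" using s t f h by (auto intro!: T_L2)
    have qL: "L2 (q s)" unfolding q_def by (rule generator_quotient_coef(1)[OF f Tf(1) h])
    have rL: "L2 (r s)" unfolding r_def by (rule generator_quotient_coef(1)[OF Tf(2,4,3)])
    \<comment> \<open>Nested two-term combinations, the shape in which \<open>T_lincomb\<close> can
      distribute \<open>T t\<close>.\<close>
    have q_eq: "q s = (\<lambda>x. (1 / of_real s) * T s f x + 1 * ((- 1 / of_real s) * f x + (- 1) * h x))"
      by (auto simp: q_def diff_divide_distrib)
    have swap: "coef n (T t (T s f)) = coef n (T s (T t f))" for n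
      using T_add[of t s f n] T_add[of s t f n] s t f by (simp add: add.commute)
    have "coef n (T t (q s)) = (1 / of_real s) * coef n (T t (T s f))
        + 1 * ((- 1 / of_real s) * coef n (T t f) + (- 1) * coef n (T t h))" for n
      unfolding q_eq using L2_lincomb[OF f h, of "- 1 / of_real s" "-1"]
      by (simp only: T_lincomb[OF t] Tf f h)
    then have "coef n (r s) = coef n (T t (q s))" for n
      unfolding r_def generator_quotient_coef(2)[OF Tf(2,4,3)] by (simp add: swap diff_divide_distrib)
    then have "L2_norm (r s) \<le> 1 * L2_norm (T t (q s))"
      by (intro L2_norm_le_of_coef rL T_L2 t qL) auto
    also have "\<dots> \<le> C * L2_norm (q s)" using C[OF qL] by simp
    finally show ?thesis .
  qed
  have "((\<lambda>s. C * L2_norm (q s)) \<longlongrightarrow> 0) (at_right 0)" using tendsto_mult_right_zero[OF q0] .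
  moreover have "eventually (\<lambda>s. norm (L2_norm (r s)) \<le> C * L2_norm (q s)) (at_right 0)"
    using pos by eventually_elim (use le in simp)
  ultimately have "((\<lambda>s. L2_norm (r s)) \<longlongrightarrow> 0) (at_right 0)" by (rule Lim_null_comparison[rotated])
  then have "opA (T t f) (\<lambda>x. - T t h x)"
    using T_generator[OF conjI[OF T_L2[OF t f] T_L2[OF t h]]] by (simp add: r_def[abs_def])
  moreover have "coef n (\<lambda>x. - T t h x) = coef n (T t g)" for n
  proof -
    have "h = (\<lambda>x. (-1) * g x)" by (simp add: h_def[abs_def])
    then have "coef n (T t h) = - coef n (T t g)" using T_scale[OF t g, of n "-1"] by simp
    then show ?thesis by (simp add: coef_uminus T_L2[OF t h])
  qed
  ultimately show ?thesis using T_L2[OF t g] by (simp add: opA_iff_coef)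
qed

text \<open>\<open>T t (psi m)\<close> satisfies the eigenvalue equation for \<open>lam m\<close>,
  while \<open>A\<close> multiplies its coordinate \<open>n\<close> by \<open>lam n\<close>.\<close>

lemma T_psi_eigenspace:
  assumes t: "0 \<le> t" and neq: "lam n \<noteq> lam m"
  shows "coef n (T t (psi m)) = 0"
proof -
  have "coef n (T t (\<lambda>x. of_real (lam m) * psi m x)) = of_real (lam n) * coef n (T t (psi m))"
    using T_generator_commute[OF opA_psi t, of m] by (simp add: opA_iff_coef)
  then have "(complex_of_real (lam m) - of_real (lam n)) * coef n (T t (psi m)) = 0"
    unfolding T_scale[OF t psi(1)] by (simp add: left_diff_distrib)
  then show ?thesis using neq by simp
qed

lemma T_finite_expansion:
  assumes "finite A" and t: "0 \<le> t" and "L2 f" "\<And>j. j \<notin> A \<Longrightarrow> coef j f = 0"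
  shows "coef n (T t f) = (\<Sum>j\<in>A. coef j f * coef n (T t (psi j)))"
  using assms(1,3,4)
proof (induction A arbitrary: f rule: finite_induct)
  case empty
  have "coef n (T t f) = coef n (T t (\<lambda>x. 0 * psi 0 x))"
    by (rule T_cong[OF t]) (use empty in auto)
  then show ?case using T_scale[OF t psi(1), of n 0 0] by simp
next
  case (insert i A)
  define g where "g x = f x - coef i f * psi i x" for x
  have g: "L2 g" unfolding g_def using insert.prems by (intro L2_diff L2_scale psi)
  have cg: "coef j g = (if j = i then 0 else coef j f)" for j
    unfolding g_def using insert.prems by (simp add: coef_diff coef_scale psi L2_scale)
  have "f = (\<lambda>x. coef i f * psi i x + 1 * g x)" by (simp add: g_def)
  then have "coef n (T t f) = coef i f * coef n (T t (psi i)) + coef n (T t g)"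
    using T_lincomb[OF t psi(1) g, of n "coef i f" i 1] by simp
  also have "coef n (T t g) = (\<Sum>j\<in>A. coef j g * coef n (T t (psi j)))"
    by (rule insert.IH[OF g]) (use insert.prems cg in auto)
  also have "\<dots> = (\<Sum>j\<in>A. coef j f * coef n (T t (psi j)))"
    using insert.hyps by (intro sum.cong) (auto simp: cg)
  finally show ?case using insert.hyps by simp
qed

lemma T_psi_derivative:
  "((\<lambda>t. (coef n (T t (psi m)) - coef n (psi m)) / of_real t) \<longlongrightarrow> - of_real (lam m) * coef n (psi m)) (at_right 0)"
proof -
  define h where "h x = (- of_real (lam m)) * psi m x" for x
  have h: "L2 h" unfolding h_def by (intro L2_scale psi)
  have ch: "coef n h = - of_real (lam m) * coef n (psi m)" unfolding h_def by (rule coef_scale[OF psi(1)])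
  have "opA (psi m) (\<lambda>x. - h x)" using opA_psi[of m] by (simp add: h_def)
  then have lim: "((\<lambda>t. L2_norm (\<lambda>x. (T t (psi m) x - psi m x) / of_real t - h x)) \<longlongrightarrow> 0) (at_right 0)"
    using T_generator[OF conjI[OF psi(1) h]] by simp
  have pos: "eventually (\<lambda>s::real. 0 < s) (at_right 0)" by (simp add: eventually_at_right_less)
  then have "eventually (\<lambda>t. norm ((coef n (T t (psi m)) - coef n (psi m)) / of_real t - coef n h)
      \<le> L2_norm (\<lambda>x. (T t (psi m) x - psi m x) / of_real t - h x)) (at_right 0)"
  proof eventually_elim
    case (elim t)
    have TL: "L2 (T t (psi m))" using elim by (intro T_L2 psi) simp
    show ?case
      using cmod_coef_le[OF generator_quotient_coef(1)[OF psi(1) TL h, where t = t], of n]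
      unfolding generator_quotient_coef(2)[OF psi(1) TL h] .
  qed
  from Lim_null_comparison[OF this lim]
  have "((\<lambda>t. (coef n (T t (psi m)) - coef n (psi m)) / of_real t - coef n h) \<longlongrightarrow> 0) (at_right 0)" .
  then have "((\<lambda>t. (coef n (T t (psi m)) - coef n (psi m)) / of_real t) \<longlongrightarrow> coef n h) (at_right 0)"
    by (rule Lim_null[THEN iffD2])
  then show ?thesis unfolding ch .
qed

text \<open>The operators \<open>T t\<close> leave each (finite-dimensional) eigenspace invariant. There
  \<open>d t = exp (\<lambda> t) T t\<close> is a matrix semigroup with \<open>d h = I + o(h)\<close>, so that
  \<open>d t = (d (t / N))\<^sup>N \<rightarrow> I\<close>.\<close>
lemma T_psi:
  assumes t: "0 \<le> t"
  shows "coef n (T t (psi m)) = exp (- lam m * t) * coef n (psi m)"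
proof (cases "lam n = lam m \<and> t \<noteq> 0")
  case False
  then consider "lam n \<noteq> lam m" | "t = 0" by blast
  then show ?thesis
  proof cases
    case 1 then show ?thesis using T_psi_eigenspace[OF t 1] by (auto simp: psi)
  next
    case 2 then show ?thesis by (simp add: T_zero psi)
  qed
next
  case True
  then have t: "t > 0" using t by simp
  define l where "l = lam m"
  define J where "J = {n. lam n = l}"
  have J: "finite J" unfolding J_def by (rule finite_eigenspace)
  have n: "n \<in> J" and m: "m \<in> J" using True by (auto simp: J_def l_def)
  \<comment> \<open>The matrix of \<open>exp (l h) T h\<close> on the eigenspace. As
    \<open>coef i (psi j)\<close> is the Kronecker symbol, \<open>E h\<close> below is its entrywise
    distance from the identity.\<close>
  define d where "d h i j = of_real (exp (l * h)) * coef i (T h (psi j))" for h i j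
  define E where "E h = (\<Sum>i\<in>J. \<Sum>j\<in>J. cmod (d h i j - coef i (psi j)))" for h
  have E0: "0 \<le> E h" for h unfolding E_def by (intro sum_nonneg) simp
  \<comment> \<open>The semigroup law becomes matrix multiplication, because
    \<open>T k (psi m)\<close> has no coordinates outside \<open>J\<close>.\<close>
  have d_add: "d (h + k) i m = (\<Sum>j\<in>J. d h i j * d k j m)" if "0 \<le> h" "0 \<le> k" for h k i
  proof -
    have "coef i (T (h + k) (psi m)) = coef i (T h (T k (psi m)))" using that by (intro T_add psi)
    also have "\<dots> = (\<Sum>j\<in>J. coef j (T k (psi m)) * coef i (T h (psi j)))"
      using that T_psi_eigenspace[OF that(2), of _ m]
      by (intro T_finite_expansion J T_L2 psi) (auto simp: J_def l_def)
    finally show ?thesis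
      by (simp add: d_def sum_distrib_left distrib_left exp_add mult_ac)
  qed
  \<comment> \<open>The exponential factor contributes the derivative \<open>l\<close> and
    \<open>T\<close> contributes \<open>- l\<close>, so the derivative at 0 cancels.\<close>
  have d_lim: "((\<lambda>h. cmod (d h i j - coef i (psi j)) / h) \<longlongrightarrow> 0) (at_right 0)" if "j \<in> J" for i j
  proof -
    have lj: "lam j = l" using that by (simp add: J_def)
    have e1: "((\<lambda>h. exp (l * h)) \<longlongrightarrow> exp (l * 0)) (at_right (0::real))" by (intro tendsto_intros)
    have e2: "((\<lambda>h. (exp (l * h) - 1) / h) \<longlongrightarrow> l) (at_right (0::real))"
      using exp_quotient_tendsto[of "- l"] by simp
    have "((\<lambda>h. of_real (exp (l * h)) * ((coef i (T h (psi j)) - coef i (psi j)) / of_real h)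
        + of_real ((exp (l * h) - 1) / h) * coef i (psi j))
        \<longlongrightarrow> of_real (exp (l * 0)) * (- of_real (lam j) * coef i (psi j)) + of_real l * coef i (psi j)) (at_right 0)"
      by (intro tendsto_intros e1 e2 T_psi_derivative)
    then have "((\<lambda>h. of_real (exp (l * h)) * ((coef i (T h (psi j)) - coef i (psi j)) / of_real h)
        + of_real ((exp (l * h) - 1) / h) * coef i (psi j)) \<longlongrightarrow> 0) (at_right 0)" by (simp add: lj)
    moreover have "of_real (exp (l * h)) * ((coef i (T h (psi j)) - coef i (psi j)) / of_real h)
        + of_real ((exp (l * h) - 1) / h) * coef i (psi j) = (d h i j - coef i (psi j)) / of_real h" for h
      by (cases "h = 0") (simp_all add: d_def field_simps)
    ultimately have "((\<lambda>h. (d h i j - coef i (psi j)) / of_real h) \<longlongrightarrow> 0) (at_right 0)" by simp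
    from tendsto_norm_zero[OF this] have "((\<lambda>h. cmod (d h i j - coef i (psi j)) / \<bar>h\<bar>) \<longlongrightarrow> 0) (at_right 0)"
      by (simp add: norm_divide)
    moreover have "eventually (\<lambda>h::real. 0 < h) (at_right 0)" by (simp add: eventually_at_right_less)
    then have "eventually (\<lambda>h. cmod (d h i j - coef i (psi j)) / \<bar>h\<bar> = cmod (d h i j - coef i (psi j)) / h) (at_right 0)"
      by eventually_elim simp
    ultimately show ?thesis by (simp add: tendsto_cong)
  qed
  have E_lim: "((\<lambda>h. E h / h) \<longlongrightarrow> 0) (at_right 0)"
  proof -
    have "((\<lambda>h. \<Sum>i\<in>J. \<Sum>j\<in>J. cmod (d h i j - coef i (psi j)) / h) \<longlongrightarrow> (\<Sum>i\<in>J. \<Sum>j\<in>J. 0)) (at_right 0)"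
      by (intro tendsto_sum d_lim)
    then show ?thesis by (simp add: E_def sum_divide_distrib)
  qed
  \<comment> \<open>Splitting \<open>t\<close> into \<open>N\<close> steps of length
    \<open>h\<close> bounds the deviation by \<open>(1 + E h) ^ N - 1\<close>, which is at most
    \<open>exp (N * E h) - 1\<close> with \<open>N * E h = t * (E h / h)\<close>.\<close>
  have bound: "cmod (d t n m - coef n (psi m)) \<le> exp (t * (E (t / real N) / (t / real N))) - 1" if N: "N > 0" for N
  proof -
    define h where "h = t / real N"
    have h: "h > 0" "real N * h = t" using t N by (auto simp: h_def)
    define y where "y k i = d (real k * h) i m" for k :: nat and i
    have y0: "y 0 i = coef i (psi m)" for i by (simp add: y_def d_def T_zero psi)
    have step: "(\<Sum>i\<in>J. cmod (y (Suc k) i - y k i)) \<le> E h * (\<Sum>i\<in>J. cmod (y k i))" for k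
    proof -
      have ysuc: "y (Suc k) i - y k i = (\<Sum>j\<in>J. (d h i j - coef i (psi j)) * y k j)" if "i \<in> J" for i
      proof -
        have "y (Suc k) i = (\<Sum>j\<in>J. d h i j * y k j)"
          using d_add[of h "real k * h" i] h by (simp add: y_def distrib_right)
        moreover have "y k i = (\<Sum>j\<in>J. coef i (psi j) * y k j)"
          using that J by (simp add: psi if_distrib[of "\<lambda>c. c * _"] cong: if_cong)
        ultimately show ?thesis by (simp add: left_diff_distrib sum_subtractf)
      qed
      have "cmod (y (Suc k) i - y k i) \<le> (\<Sum>j\<in>J. cmod (d h i j - coef i (psi j))) * (\<Sum>j\<in>J. cmod (y k j))" if "i \<in> J" for i
      proof -
        have "cmod (y (Suc k) i - y k i) \<le> (\<Sum>j\<in>J. cmod (d h i j - coef i (psi j)) * cmod (y k j))"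
          unfolding ysuc[OF that] by (rule order_trans[OF norm_sum]) (simp add: norm_mult)
        also have "\<dots> \<le> (\<Sum>j\<in>J. cmod (d h i j - coef i (psi j)) * (\<Sum>j\<in>J. cmod (y k j)))"
          using J by (intro sum_mono mult_left_mono member_le_sum) auto
        finally show ?thesis by (simp add: sum_distrib_right)
      qed
      then have "(\<Sum>i\<in>J. cmod (y (Suc k) i - y k i))
          \<le> (\<Sum>i\<in>J. (\<Sum>j\<in>J. cmod (d h i j - coef i (psi j))) * (\<Sum>j\<in>J. cmod (y k j)))" by (rule sum_mono)
      then show ?thesis by (simp add: E_def sum_distrib_right)
    qed
    have Y0: "(\<Sum>i\<in>J. cmod (y 0 i)) = 1" using J m by (simp add: y0 psi if_distrib cong: if_cong)
    have "cmod (y N n - y 0 n) \<le> (\<Sum>i\<in>J. cmod (y N i - y 0 i))"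
      using J n by (intro member_le_sum[of n J "\<lambda>i. cmod (y N i - y 0 i)"]) auto
    also have "\<dots> \<le> ((1 + E h) ^ N - 1) * (\<Sum>i\<in>J. cmod (y 0 i))"
      by (rule perturbed_iteration[where y = y, OF J E0[of h] step])
    also have "\<dots> = (1 + E h) ^ N - 1" using Y0 by simp
    also have "\<dots> \<le> exp (E h) ^ N - 1"
      using E0[of h] exp_ge_add_one_self[of "E h"] by (intro diff_right_mono power_mono) auto
    also have "exp (E h) ^ N = exp (t * (E h / h))"
      using h by (simp add: exp_of_nat_mult[symmetric] field_simps flip: h(2))
    finally show ?thesis unfolding h_def[symmetric] by (simp add: y0) (simp add: y_def h(2))
  qed
  have hN: "filterlim (\<lambda>N. t / real N) (at_right 0) sequentially"
  proof (rule tendsto_imp_filterlim_at_right)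
    show "(\<lambda>N. t / real N) \<longlonglongrightarrow> 0" by (rule lim_const_over_n)
    show "eventually (\<lambda>N. 0 < t / real N) sequentially"
      using eventually_gt_at_top[of 0] by eventually_elim (use t in simp)
  qed
  have "(\<lambda>N. exp (t * (E (t / real N) / (t / real N))) - 1) \<longlonglongrightarrow> exp (t * 0) - 1"
    by (intro tendsto_intros filterlim_compose[OF E_lim hN])
  then have "(\<lambda>N. exp (t * (E (t / real N) / (t / real N))) - 1) \<longlonglongrightarrow> 0" by simp
  then have "cmod (d t n m - coef n (psi m)) \<le> 0"
    by (rule LIMSEQ_le_const) (intro exI[of _ 1] allI impI bound, simp)
  then have "of_real (exp (l * t)) * coef n (T t (psi m)) = coef n (psi m)" by (simp add: d_def)
  then have "of_real (exp (- l * t)) * (of_real (exp (l * t)) * coef n (T t (psi m))) = of_real (exp (- l * t)) * coef n (psi m)"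
    by simp
  then show ?thesis
    by (simp add: l_def exp_minus field_simps flip: of_real_mult)
qed

text \<open>\<open>T\<close> is linear on finite combinations only, so \<open>f\<close> is split
  into a spectral truncation and a remainder; boundedness of \<open>T t\<close> makes the
  contribution of the remainder vanish in the limit.\<close>

theorem T_coef:
  assumes t: "0 \<le> t" and f: "L2 f"
  shows "coef n (T t f) = exp (- lam n * t) * coef n f"
proof -
  obtain C where C: "\<And>f. L2 f \<Longrightarrow> L2_norm (T t f) \<le> C * L2_norm f" using T_bounded[OF t] by blast
  have "\<exists>s. L2 s \<and> (\<forall>n. coef n s = (if n < N then coef n f else 0))" for N by (rule head_exists[OF f])
  then obtain s where s: "\<And>N. L2 (s N)" "\<And>N n. coef n (s N) = (if n < N then coef n f else 0)" by metis
  define r where "r N x = f x - s N x" for N x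
  have r: "L2 (r N)" "coef k (r N) = (if k < N then 0 else coef k f)" for N k
    using f s unfolding r_def by (auto intro: L2_diff simp: coef_diff)
  have "(\<lambda>N. L2_norm (r N)) \<longlonglongrightarrow> 0"
  proof (rule L2_norm_tendsto_0)
    show "(\<lambda>N. coef k (r N)) \<longlonglongrightarrow> 0" for k
      by (rule tendsto_eventually, rule eventually_mono[OF eventually_gt_at_top[of k]]) (simp add: r)
    show "summable (\<lambda>n. (cmod (coef n f))\<^sup>2)" using Parseval[OF f] by (simp add: sums_iff)
  qed (use r in auto)
  then have lim: "(\<lambda>N. C * L2_norm (r N)) \<longlonglongrightarrow> 0" by (rule tendsto_mult_right_zero)
  have "cmod (coef n (T t f) - exp (- lam n * t) * coef n f) \<le> C * L2_norm (r N)" if N: "N \<ge> Suc n" for N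
  proof -
    have "f = (\<lambda>x. 1 * s N x + 1 * r N x)" by (simp add: r_def)
    then have "coef n (T t f) = coef n (T t (s N)) + coef n (T t (r N))"
      using T_lincomb[OF t s(1) r(1), of n 1 N 1 N] by simp
    also have "coef n (T t (s N)) = (\<Sum>j<N. coef j (s N) * coef n (T t (psi j)))"
      by (rule T_finite_expansion[OF _ t s(1)]) (auto simp: s)
    also have "\<dots> = (\<Sum>j<N. if j = n then exp (- lam n * t) * coef n f else 0)"
      by (intro sum.cong) (auto simp: s T_psi[OF t] psi)
    also have "\<dots> = exp (- lam n * t) * coef n f" using N by simp
    finally have "coef n (T t f) - exp (- lam n * t) * coef n f = coef n (T t (r N))" by simp
    then show ?thesis using cmod_coef_le[OF T_L2[OF t r(1)], of n N] C[OF r(1), of N] by simp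
  qed
  then have "cmod (coef n (T t f) - exp (- lam n * t) * coef n f) \<le> 0"
    by (intro LIMSEQ_le_const[OF lim]) blast
  then show ?thesis by simp
qed

end

end

subsection \<open>Eventual positivity and failure of positivity\<close>

lemma mult_exp_minus_le_1: "x * exp (- x) \<le> (1::real)"
proof -
  have "x \<le> exp x" using exp_ge_add_one_self[of x] by linarith
  then show ?thesis by (simp add: exp_minus field_simps)
qed

text \<open>A polynomial in \<open>1 - x\<close> satisfying the boundary conditions \<open>u'(0) = u(0) + u(1) = - u'(1)\<close>, with
  \<open>u(1) < 0\<close> but also \<open>u''(1) < 0\<close>, so that \<open>z u - u'' \<ge> 0\<close> for a suitable \<open>z\<close>: the resolvent
  \<open>R(z, -A)\<close> is not positive for \<open>z = 100\<close>.\<close>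
definition barrier :: "real \<Rightarrow> real" where
  "barrier x = (let s = 1 - x in s - s\<^sup>2 + 4 * s ^ 3 - 3 * s ^ 4 - (1 - 6 * s\<^sup>2 + 4 * s ^ 3) / 100)"

definition barrier_A :: "real \<Rightarrow> real" where
  "barrier_A x = (let s = 1 - x in 2 - 24 * s + 36 * s\<^sup>2 - (12 - 24 * s) / 100)"

text \<open>With \<open>s = 1 - x\<close>, both \<open>s - s\<^sup>2 + 4 * s ^ 3 - 3 * s ^ 4\<close>
  and \<open>1 - 6 * s\<^sup>2 + 4 * s ^ 3\<close> satisfy the boundary conditions. The first is 0
  at \<open>s = 0\<close>, where minus its second derivative is 2; subtracting 1/100 of the second
  lowers the value there to -1/100 but leaves the combination at 22/25. Away from
  \<open>s = 0\<close> the bounds \<open>s\<^sup>2 \<le> s\<close> and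
  \<open>s ^ 4 \<le> s ^ 3\<close> absorb the negative terms.\<close>

lemma barrier_resolvent_nonneg:
  assumes "x \<in> {0..1}"
  shows "0 \<le> 100 * barrier x + barrier_A x"
proof -
  define s where "s = 1 - x"
  have s: "0 \<le> s" "s \<le> 1" using assms by (auto simp: s_def)
  have "s\<^sup>2 \<le> s" using s by (simp add: power2_eq_square mult_left_le)
  moreover have "s ^ 4 \<le> s ^ 3" using s by (intro power_decreasing) auto
  moreover have "0 \<le> s ^ 3" using s by simp
  moreover have "100 * barrier x + barrier_A x = 22/25 + 1906/25 * s - 58 * s\<^sup>2 + 396 * s ^ 3 - 300 * s ^ 4"
    by (simp add: barrier_def barrier_A_def Let_def s_def[symmetric] field_simps)
  ultimately show ?thesis using s by linarith
qed

text \<open>Negativity is needed on a set of positive measure, since only classes modulo null sets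
  are tested.\<close>

lemma barrier_negative:
  assumes "x \<in> {999/1000..1}" shows "barrier x \<le> - 1 / 1000"
proof -
  define s where "s = 1 - x"
  have s: "0 \<le> s" "s \<le> 1/1000" using assms by (auto simp: s_def)
  have "s ^ 3 \<le> s ^ 1" using s by (intro power_decreasing) auto
  moreover have "s\<^sup>2 \<le> s" using s by (simp add: power2_eq_square mult_left_le)
  moreover have "0 \<le> s\<^sup>2" "0 \<le> s ^ 3" "0 \<le> s ^ 4" "s ^ 1 = s" using s by simp_all
  moreover have "barrier x = s - s\<^sup>2 + 4 * s ^ 3 - 3 * s ^ 4 - 1/100 + 6/100 * s\<^sup>2 - 4/100 * s ^ 3"
    by (simp add: barrier_def Let_def s_def[symmetric] field_simps)
  ultimately show ?thesis using s by linarith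
qed

lemma integral_initial_FTC:
  fixes w W :: "real \<Rightarrow> real"
  assumes x: "x \<in> {0..1}" and w: "continuous_on UNIV w" and W: "\<And>t. (W has_real_derivative w t) (at t)"
  shows "(LINT t|I01. indicat_real {..x} t *\<^sub>R complex_of_real (w t)) = complex_of_real (W x - W 0)"
proof -
  have "integrable (lebesgue_on {0..x}) w"
    by (rule continuous_imp_integrable_real) (rule continuous_on_subset[OF w], simp)
  then have "(LINT t|lebesgue_on {0..x}. w t) = integral {0..x} w"
    by (rule lebesgue_integral_eq_integral) simp
  also have "\<dots> = W x - W 0"
  proof (rule integral_unique, rule fundamental_theorem_of_calculus)
    show "0 \<le> x" using x by simp
    fix t show "(W has_vector_derivative w t) (at t within {0..x})"
      using W[of t] by (simp add: has_real_derivative_iff_has_vector_derivative has_vector_derivative_at_within)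
  qed
  finally show ?thesis
    unfolding integral_lebesgue_on_initial[OF x, symmetric] by (simp add: integral_complex_of_real)
qed

text \<open>With \<open>g = - u''\<close>, the boundary conditions and the fundamental theorem of
  calculus identify \<open>green_deriv g\<close> with \<open>u'\<close>, so
  \<open>green g - u\<close> is constant; \<open>green_boundary\<close> forces the constant to be
  0.\<close>

lemma opA_C2:
  fixes u u' u'' :: "real \<Rightarrow> real"
  assumes u: "\<And>t. (u has_real_derivative u' t) (at t)" and u': "\<And>t. (u' has_real_derivative u'' t) (at t)"
    and cont: "continuous_on UNIV u''" and bc: "u' 0 = u 0 + u 1" "u' 1 = - (u 0 + u 1)"
  shows "opA (\<lambda>x. complex_of_real (u x)) (\<lambda>x. complex_of_real (- u'' x))"
proof -
  define g where "g x = complex_of_real (- u'' x)" for x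
  have cu': "continuous_on UNIV u'" using u' DERIV_continuous_on by (metis has_field_derivative_at_within)
  have cu: "continuous_on UNIV u" using u DERIV_continuous_on by (metis has_field_derivative_at_within)
  have sq: "L2 (\<lambda>x. complex_of_real (f x))" if f: "continuous_on UNIV f" for f
  proof -
    have "continuous_on {0..1} f" by (rule continuous_on_subset[OF f]) simp
    then obtain B where B: "\<And>x. x \<in> {0..1} \<Longrightarrow> norm (f x) \<le> B"
      using compact_continuous_image[of "{0..1}" f] compact_imp_bounded bounded_iff by (metis compact_Icc imageI)
    have "f \<in> borel_measurable I01"
      using \<open>continuous_on {0..1} f\<close> by (intro continuous_imp_measurable_on_sets_lebesgue) auto
    then show ?thesis using B by (intro L2_bounded[of _ B]) auto
  qed
  have g: "L2 g" unfolding g_def by (intro sq continuous_intros cont)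
  have initial: "(LINT t|I01. indicat_real {..x} t *\<^sub>R g t) = complex_of_real (u' 0 - u' x)" if "x \<in> {0..1}" for x
    unfolding g_def using integral_initial_FTC[OF that, of "\<lambda>t. - u'' t" "\<lambda>t. - u' t"] cont u'
    by (auto intro!: continuous_intros derivative_eq_intros)
  have tot: "(LINT t|I01. g t) / 2 = complex_of_real (u 0 + u 1)"
  proof -
    have "(LINT t|I01. g t) = (LINT t|I01. indicat_real {..1} t *\<^sub>R g t)"
      by (rule Bochner_Integration.integral_cong[OF refl]) simp
    then show ?thesis using initial[of 1] bc by simp
  qed
  have deriv: "green_deriv g t = complex_of_real (u' t)" if "t \<in> {0..1}" for t
    unfolding green_deriv_def tot initial[OF that] using bc by simp
  have step: "green g x = green g 0 + complex_of_real (u x - u 0)" if x: "x \<in> {0..1}" for x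
  proof -
    have "(LINT t|I01. indicat_real {..x} t *\<^sub>R green_deriv g t) = (LINT t|I01. indicat_real {..x} t *\<^sub>R complex_of_real (u' t))"
      by (rule Bochner_Integration.integral_cong[OF refl]) (simp add: deriv)
    also have "\<dots> = complex_of_real (u x - u 0)" by (rule integral_initial_FTC[OF x cu' u])
    finally show ?thesis using H1_green[OF g] x unfolding H1_eq by metis
  qed
  have "2 * green g 0 = complex_of_real (2 * u 0)"
    using green_boundary[OF g] tot step[of 1] by (simp add: algebra_simps)
  then have "green g 0 = complex_of_real (u 0)" by simp
  then have "green g x = complex_of_real (u x)" if "x \<in> {0..1}" for x using step[OF that] by simp
  then have "ae_eq (\<lambda>x. complex_of_real (u x)) (green g)" unfolding ae_eq_def by (intro AE_I2) auto
  then show ?thesis using g sq[OF cu] unfolding opA_iff_green g_def[abs_def] by blast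
qed

lemma opA_barrier: "opA (\<lambda>x. complex_of_real (barrier x)) (\<lambda>x. complex_of_real (barrier_A x))"
proof -
  define u' where "u' x = (let s = 1 - x in - (1 - 2 * s + 12 * s\<^sup>2 - 12 * s ^ 3 - (- 12 * s + 12 * s\<^sup>2) / 100))" for x :: real
  have "opA (\<lambda>x. complex_of_real (barrier x)) (\<lambda>x. complex_of_real (- (- barrier_A x)))"
  proof (rule opA_C2)
    show "(barrier has_real_derivative u' t) (at t)" for t
      unfolding barrier_def[abs_def] u'_def Let_def
      by (rule derivative_eq_intros refl | simp)+ (simp add: field_simps)
    show "(u' has_real_derivative - barrier_A t) (at t)" for t
      unfolding barrier_A_def u'_def[abs_def] Let_def
      by (rule derivative_eq_intros refl | simp)+
    show "continuous_on UNIV (\<lambda>x. - barrier_A x)"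
      unfolding barrier_A_def[abs_def] Let_def by (intro continuous_intros) simp
  qed (simp_all add: u'_def barrier_def Let_def)
  then show ?thesis by simp
qed

text \<open>The function \<open>H\<close> has derivative minus the nonnegative series and tends to 0
  at infinity, so it is decreasing and nonnegative; its limit at 0 is the sum of
  \<open>a\<close>.\<close>

lemma decaying_exponential_sum_nonneg:
  fixes a \<mu> :: "nat \<Rightarrow> real"
  assumes \<mu>: "\<And>n. 0 < \<mu> n" and a: "summable (\<lambda>n. \<bar>a n\<bar>)" and b: "summable (\<lambda>n. \<bar>\<mu> n * a n\<bar>)"
    and nonneg: "\<And>t. 0 < t \<Longrightarrow> 0 \<le> (\<Sum>n. exp (- \<mu> n * t) * (\<mu> n * a n))"
  shows "0 \<le> (\<Sum>n. a n)"
proof -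
  define H where "H t = (\<Sum>n. a n * exp (- \<mu> n * t))" for t
  have dom: "\<bar>c * exp (- \<mu> n * t)\<bar> \<le> \<bar>c\<bar>" if "0 \<le> t" for c n t
    using that \<mu>[of n] by (simp add: abs_mult mult_left_le)
  have sm: "summable (\<lambda>n. a n * exp (- \<mu> n * t))" if "0 \<le> t" for t
    by (rule summable_comparison_test'[OF a]) (use dom[OF that] in simp)
  have deriv: "(H has_real_derivative (\<Sum>n. - (\<mu> n * a n) * exp (- \<mu> n * t))) (at t)" if t: "0 < t" for t
    unfolding H_def
  proof (rule has_field_derivative_series'(2)[of "{0..}" _ _ 0])
    show "((\<lambda>t. a n * exp (- \<mu> n * t)) has_real_derivative - (\<mu> n * a n) * exp (- \<mu> n * t)) (at t within {0..})" for n t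
      by (auto intro!: derivative_eq_intros)
    show "uniformly_convergent_on {0..} (\<lambda>n x. \<Sum>i<n. - (\<mu> i * a i) * exp (- \<mu> i * x))"
      by (rule Weierstrass_m_test'[OF _ b]) (use dom[of _ "- (\<mu> _ * a _)"] in auto)
    show "summable (\<lambda>n. a n * exp (- \<mu> n * 0))" using sm[of 0] by simp
    show "t \<in> interior {0..}" using t by simp
  qed auto
  have anti: "H s \<le> H t" if "0 < t" "t \<le> s" for s t
  proof (rule DERIV_nonpos_imp_nonincreasing[OF that(2)])
    fix x assume "t \<le> x" "x \<le> s"
    then have x: "0 < x" using that by simp
    have "(\<Sum>n. - (\<mu> n * a n) * exp (- \<mu> n * x)) = - (\<Sum>n. exp (- \<mu> n * x) * (\<mu> n * a n))"
    proof -
      have "summable (\<lambda>n. exp (- \<mu> n * x) * (\<mu> n * a n))"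
        by (rule summable_comparison_test'[OF b]) (use dom[of x "\<mu> _ * a _"] x in \<open>simp add: mult.commute\<close>)
      from suminf_minus[OF this] show ?thesis by (simp add: mult.commute)
    qed
    then show "\<exists>y. (H has_real_derivative y) (at x) \<and> y \<le> 0" using deriv[OF x] nonneg[OF x] by auto
  qed
  have top: "(H \<longlongrightarrow> 0) at_top"
    unfolding H_def
  proof (rule dominated_sum_tendsto_0[OF _ _ a])
    show "((\<lambda>t. a n * exp (- \<mu> n * t)) \<longlongrightarrow> 0) at_top" for n
      using \<mu>[of n] by real_asymp
    show "eventually (\<lambda>t. \<forall>n. \<bar>a n * exp (- \<mu> n * t)\<bar> \<le> \<bar>a n\<bar>) at_top"
      using eventually_ge_at_top[of 0] by eventually_elim (use dom in blast)
  qed simp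
  have H_nonneg: "0 \<le> H t" if "0 < t" for t
  proof (rule tendsto_upperbound[OF top])
    show "eventually (\<lambda>s. H s \<le> H t) at_top"
      using eventually_ge_at_top[of t] by eventually_elim (rule anti[OF that])
  qed simp
  \<comment> \<open>Right continuity of \<open>H\<close> at 0, obtained by dominated convergence
    with majorant \<open>\<bar>a n\<bar>\<close>.\<close>
  have "((\<lambda>t. \<Sum>n. a n * (exp (- \<mu> n * t) - 1)) \<longlongrightarrow> 0) (at_right 0)"
  proof (rule dominated_sum_tendsto_0[OF _ _ a])
    show "((\<lambda>t. a n * (exp (- \<mu> n * t) - 1)) \<longlongrightarrow> 0) (at_right 0)" for n
      by (rule tendsto_eq_intros refl | simp)+
    have "eventually (\<lambda>t::real. 0 < t) (at_right 0)" by (simp add: eventually_at_right_less)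
    then show "eventually (\<lambda>t. \<forall>n. \<bar>a n * (exp (- \<mu> n * t) - 1)\<bar> \<le> \<bar>a n\<bar>) (at_right 0)"
    proof eventually_elim
      case (elim t)
      have "\<bar>exp (- \<mu> n * t) - 1\<bar> \<le> 1" for n using elim \<mu>[of n] by simp
      then show ?case by (simp add: abs_mult mult_left_le)
    qed
  qed simp
  moreover have "eventually (\<lambda>t. (\<Sum>n. a n * (exp (- \<mu> n * t) - 1)) = H t - (\<Sum>n. a n)) (at_right 0)"
  proof -
    have "eventually (\<lambda>t::real. 0 < t) (at_right 0)" by (simp add: eventually_at_right_less)
    then show ?thesis
    proof eventually_elim
      case (elim t)
      then show ?case
        using suminf_diff[OF sm summable_rabs_cancel[OF a], of t] by (simp add: H_def algebra_simps)
    qed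
  qed
  ultimately have "((\<lambda>t. H t - (\<Sum>n. a n)) \<longlongrightarrow> 0) (at_right 0)" by (simp add: tendsto_cong)
  then have lim: "(H \<longlongrightarrow> (\<Sum>n. a n)) (at_right 0)" by (rule Lim_null[THEN iffD2])
  show ?thesis
  proof (rule tendsto_lowerbound[OF lim])
    have "eventually (\<lambda>t::real. 0 < t) (at_right 0)" by (simp add: eventually_at_right_less)
    then show "eventually (\<lambda>t. 0 \<le> H t) (at_right 0)" by eventually_elim (rule H_nonneg)
  qed simp
qed

context green_spectrum
begin

lemma Parseval_inner: "(\<lambda>n. (x \<bullet> \<phi> n) * (y \<bullet> \<phi> n)) sums (x \<bullet> y)"
  using bounded_linear.sums[OF bounded_linear_inner_left expansion[of x], of y]
  by (simp add: inner_commute)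

lemma summable_coord_prod: "summable (\<lambda>n. \<bar>(x \<bullet> \<phi> n) * (y \<bullet> \<phi> n)\<bar>)"
proof (rule summable_comparison_test'[of "\<lambda>n. (x \<bullet> \<phi> n)\<^sup>2 + (y \<bullet> \<phi> n)\<^sup>2"])
  show "summable (\<lambda>n. (x \<bullet> \<phi> n)\<^sup>2 + (y \<bullet> \<phi> n)\<^sup>2)"
    using Parseval_real[of x] Parseval_real[of y] by (intro summable_add) (auto simp: sums_iff)
  fix n
  have "2 * \<bar>x \<bullet> \<phi> n\<bar> * \<bar>y \<bullet> \<phi> n\<bar> \<le> (x \<bullet> \<phi> n)\<^sup>2 + (y \<bullet> \<phi> n)\<^sup>2"
    using sum_squares_bound[of "\<bar>x \<bullet> \<phi> n\<bar>" "\<bar>y \<bullet> \<phi> n\<bar>"] by simp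
  then show "norm \<bar>(x \<bullet> \<phi> n) * (y \<bullet> \<phi> n)\<bar> \<le> (x \<bullet> \<phi> n)\<^sup>2 + (y \<bullet> \<phi> n)\<^sup>2"
    using abs_ge_zero[of "(x \<bullet> \<phi> n) * (y \<bullet> \<phi> n)"]
    unfolding real_norm_def abs_abs abs_mult by linarith
qed

lemma norm_le_of_coords:
  assumes "\<And>n. \<bar>x \<bullet> \<phi> n\<bar> \<le> C * \<bar>y \<bullet> \<phi> n\<bar>" "0 \<le> C"
  shows "norm x \<le> C * norm y"
proof (rule power2_le_imp_le)
  have "(x \<bullet> \<phi> n)\<^sup>2 \<le> C\<^sup>2 * (y \<bullet> \<phi> n)\<^sup>2" for n
    using power_mono[OF assms(1)[of n], of 2] by (simp add: power_mult_distrib)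
  from sums_le[OF this Parseval_real sums_mult[OF Parseval_real]]
  show "(norm x)\<^sup>2 \<le> (C * norm y)\<^sup>2" by (simp add: power_mult_distrib)
qed (use assms(2) in simp)

text \<open>\<open>exp (lam 0 * t)\<close> times the real part of \<open>T t f\<close> is
  \<open>(X \<bullet> \<phi> 0) *\<^sub>R \<phi> 0 + green_op Y\<close>. The first summand is
  bounded below by a positive constant, because \<open>f\<close> has a positive coordinate along the
  ground state; the second is uniformly small as soon as \<open>Y\<close> is small in L2.\<close>

lemma eventually_strongly_pos:
  assumes T: "C0_semigroup_gen_negA T" and f: "L2 f" and nn: "nonneg f" and nz: "\<not> ae_eq f (\<lambda>x. 0)"
  shows "\<exists>t0>0. \<forall>t\<ge>t0. strongly_pos (T t f)"
proof -
  define X where "X = abs_rL2 (\<lambda>x. Re (f x))"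
  have sR: "square_integrable (\<lambda>x. Re (f x))" and sI: "square_integrable (\<lambda>x. Im (f x))" using f by (auto simp: L2_iff)
  have aeI: "AE x in I01. Im (f x) = 0" and aeR: "AE x in I01. 0 \<le> Re (f x)" using nn by (auto simp: nonneg_def)
  have "abs_rL2 (\<lambda>x. Im (f x)) = 0" using aeI sI by (simp add: abs_rL2_eq_0_iff)
  then have coef_f: "coef n f = of_real (X \<bullet> \<phi> n)" for n by (simp add: coef_def X_def complex_eq_iff)
  obtain e c where e: "square_integrable e" "\<phi> 0 = abs_rL2 e" "0 < c" "AE x in I01. c \<le> e x" using ground by blast
  have Xe: "X \<bullet> \<phi> 0 = (LINT x|I01. Re (f x) * e x)" using sR e by (simp add: X_def inner_abs_rL2)
  have nn': "AE x in I01. 0 \<le> Re (f x) * e x"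
    using aeR e(4) by eventually_elim (use e(3) in auto)
  have X0: "0 < X \<bullet> \<phi> 0"
  proof (rule ccontr)
    assume "\<not> 0 < X \<bullet> \<phi> 0"
    moreover have "0 \<le> X \<bullet> \<phi> 0" unfolding Xe by (rule integral_nonneg_AE[OF nn'])
    ultimately have "(LINT x|I01. Re (f x) * e x) = 0" using Xe by simp
    then have "AE x in I01. Re (f x) * e x = 0"
      using nn' sR e(1) by (subst (asm) integral_nonneg_eq_0_iff_AE) (auto intro: integrable_mult_square)
    then have "AE x in I01. f x = 0"
      using e(4) aeI by eventually_elim (use e(3) in \<open>auto simp: complex_eq_iff\<close>)
    then show False using nz by (simp add: ae_eq_def)
  qed
  define \<delta> where "\<delta> = lam 1 - lam 0"
  have \<delta>: "\<delta> > 0" using lam_gap(1) by (simp add: \<delta>_def)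
  have "((\<lambda>t. exp (- \<delta> * (t - 1))) \<longlongrightarrow> 0) at_top" using \<delta> by real_asymp
  then have "((\<lambda>t. exp (lam 0) * exp (- \<delta> * (t - 1)) * norm X) \<longlongrightarrow> 0) at_top"
    by (intro tendsto_mult_left_zero tendsto_mult_right_zero)
  then have "eventually (\<lambda>t. exp (lam 0) * exp (- \<delta> * (t - 1)) * norm X < (X \<bullet> \<phi> 0) * c) at_top"
    using X0 e(3) by (intro order_tendstoD) auto
  then obtain t1 where t1: "\<And>t. t \<ge> t1 \<Longrightarrow> exp (lam 0) * exp (- \<delta> * (t - 1)) * norm X < (X \<bullet> \<phi> 0) * c"
    by (auto simp: eventually_at_top_linorder)
  have "strongly_pos (T t f)" if t: "max 1 t1 \<le> t" for t
  proof -
    have t0: "0 \<le> t" "1 \<le> t" using t by auto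
    have TL: "L2 (T t f)" by (rule T_L2[OF T t0(1) f])
    have sTR: "square_integrable (\<lambda>x. Re (T t f x))" and sTI: "square_integrable (\<lambda>x. Im (T t f x))"
      using TL by (auto simp: L2_iff)
    define R where "R = abs_rL2 (\<lambda>x. Re (T t f x))"
    have cT: "coef n (T t f) = of_real (exp (- lam n * t) * (X \<bullet> \<phi> n))" for n
      using T_coef[OF T t0(1) f, of n] by (simp add: coef_f)
    have R: "R \<bullet> \<phi> n = exp (- lam n * t) * (X \<bullet> \<phi> n)" for n
      using arg_cong[OF cT[of n], of Re] by (simp add: coef_def R_def)
    have "abs_rL2 (\<lambda>x. Im (T t f x)) \<bullet> \<phi> n = 0 \<bullet> \<phi> n" for n
      using arg_cong[OF cT[of n], of Im] by (simp add: coef_def)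
    then have "abs_rL2 (\<lambda>x. Im (T t f x)) = 0" by (rule rL2_eqI)
    then have im: "AE x in I01. Im (T t f x) = 0" using sTI by (simp add: abs_rL2_eq_0_iff)
    \<comment> \<open>The coordinates of \<open>Y\<close>: those of the remainder multiplied by
      \<open>lam n\<close>, to compensate for the factor \<open>\<kappa> n\<close> of the Green
      operator.\<close>
    define b where "b n = (if n = 0 then 0 else lam n * exp (- (lam n - lam 0) * t) * (X \<bullet> \<phi> n))" for n
    define C where "C = exp (lam 0) * exp (- \<delta> * (t - 1))"
    have b_le: "\<bar>b n\<bar> \<le> C * \<bar>X \<bullet> \<phi> n\<bar>" for n
    proof (cases "n = 0")
      case False
      \<comment> \<open>One unit of time pays for the unbounded factor, through
        \<open>lam n * exp (- lam n) \<le> 1\<close>; the remaining time \<open>t - 1\<close>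
        provides decay at the rate of the spectral gap.\<close>
      have "lam n * exp (- (lam n - lam 0) * t) = exp (lam 0) * (lam n * exp (- lam n)) * exp (- (lam n - lam 0) * (t - 1))"
        by (simp add: algebra_simps flip: exp_add)
      also have "\<dots> \<le> exp (lam 0) * 1 * exp (- \<delta> * (t - 1))"
      proof (intro mult_mono mult_left_mono mult_exp_minus_le_1)
        have "\<delta> * (t - 1) \<le> (lam n - lam 0) * (t - 1)"
          using lam_gap(2)[of n] False t0 by (intro mult_right_mono) (auto simp: \<delta>_def)
        then show "exp (- (lam n - lam 0) * (t - 1)) \<le> exp (- \<delta> * (t - 1))" by (simp only: exp_le_cancel_iff)
      qed (use lam_pos[of n] in simp_all)
      finally have "lam n * exp (- (lam n - lam 0) * t) \<le> C" by (simp add: C_def)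
      then show ?thesis
        using False lam_pos[of n] by (simp add: b_def abs_mult mult_right_mono)
    qed (simp add: b_def C_def)
    have "summable (\<lambda>n. (b n)\<^sup>2)"
    proof (rule summable_comparison_test'[of "\<lambda>n. C\<^sup>2 * (X \<bullet> \<phi> n)\<^sup>2"])
      show "summable (\<lambda>n. C\<^sup>2 * (X \<bullet> \<phi> n)\<^sup>2)"
        using Parseval_real[of X] by (intro summable_mult) (simp add: sums_iff)
      fix n show "norm ((b n)\<^sup>2) \<le> C\<^sup>2 * (X \<bullet> \<phi> n)\<^sup>2"
        using power_mono[OF b_le[of n], of 2] by (simp add: power_mult_distrib)
    qed
    then obtain Y where Y: "\<And>n. Y \<bullet> \<phi> n = b n" using Riesz_Fischer[OF orthonormal] by blast
    obtain h where h: "square_integrable h" "Y = abs_rL2 h" by (rule rL2_cases)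
    have "norm Y \<le> C * norm X" by (rule norm_le_of_coords) (use Y b_le in \<open>auto simp: C_def\<close>)
    also have "\<dots> < (X \<bullet> \<phi> 0) * c" using t1[of t] t by (simp add: C_def)
    finally have normY: "norm Y < (X \<bullet> \<phi> 0) * c" .
    have "exp (lam 0 * t) *\<^sub>R R = (X \<bullet> \<phi> 0) *\<^sub>R \<phi> 0 + green_op Y"
    proof (rule rL2_eqI)
      fix n
      have "exp (lam 0 * t) * exp (- lam n * t) = exp (- (lam n - lam 0) * t)"
        by (simp add: algebra_simps flip: exp_add)
      moreover have "\<kappa> n * lam n = 1" using \<kappa>_pos[of n] by (simp add: lam_def)
      ultimately show "(exp (lam 0 * t) *\<^sub>R R) \<bullet> \<phi> n = ((X \<bullet> \<phi> 0) *\<^sub>R \<phi> 0 + green_op Y) \<bullet> \<phi> n"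
        unfolding inner_add_left inner_scaleR_left eigen_coord Y R b_def
        by (simp add: orthonormal mult.assoc[symmetric])
    qed
    then have "abs_rL2 (\<lambda>x. exp (lam 0 * t) * Re (T t f x)) = abs_rL2 (\<lambda>x. (X \<bullet> \<phi> 0) * e x + green h x)"
      using sTR e h by (simp add: R_def abs_rL2_scale abs_rL2_add green_op_abs)
    then have ae: "AE x in I01. exp (lam 0 * t) * Re (T t f x) = (X \<bullet> \<phi> 0) * e x + green h x"
      using sTR e h by (simp add: abs_rL2_eq_iff)
    \<comment> \<open>The factor 1/2 of \<open>green_norm_le\<close> leaves half of the lower bound
      of the ground state term.\<close>
    have gh: "\<bar>green h x\<bar> \<le> (X \<bullet> \<phi> 0) * c / 2" if "x \<in> {0..1}" for x
      using green_norm_le[OF square_integrable_integrable[OF h(1)] that] integral_abs_le_norm[OF h(1)] normY h(2)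
      by simp
    define c' where "c' = exp (- lam 0 * t) * ((X \<bullet> \<phi> 0) * c / 2)"
    have "c' > 0" using X0 e(3) by (simp add: c'_def)
    moreover have "AE x in I01. Im (T t f x) = 0 \<and> c' \<le> Re (T t f x)"
      using im ae e(4) AE_space
    proof eventually_elim
      case (elim x)
      have "(X \<bullet> \<phi> 0) * c \<le> (X \<bullet> \<phi> 0) * e x" using elim X0 by (intro mult_left_mono) auto
      moreover have "\<bar>green h x\<bar> \<le> (X \<bullet> \<phi> 0) * c / 2" using gh elim by simp
      ultimately have "(X \<bullet> \<phi> 0) * c / 2 \<le> exp (lam 0 * t) * Re (T t f x)" using elim by linarith
      then have "c' \<le> exp (- lam 0 * t) * (exp (lam 0 * t) * Re (T t f x))"
        unfolding c'_def by (rule mult_left_mono) simp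
      also have "\<dots> = Re (T t f x)" by (simp add: exp_minus)
      finally show ?case using elim by simp
    qed
    ultimately show ?thesis unfolding strongly_pos_def by blast
  qed
  then show ?thesis by (intro exI[of _ "max 1 t1"]) auto
qed

text \<open>If \<open>T\<close> were positive, then so would be \<open>(100 + A)\<^sup>-\<^sup>1 = \<integral>\<^sub>0\<^sup>\<infinity> e\<^sup>-\<^sup>1\<^sup>0\<^sup>0\<^sup>t T t dt\<close>.\<close>
lemma not_positive:
  assumes T: "C0_semigroup_gen_negA T"
  shows "\<not> (\<forall>t\<ge>0. \<forall>f. L2 f \<and> nonneg f \<longrightarrow> nonneg (T t f))"
proof
  assume pos: "\<forall>t\<ge>0. \<forall>f. L2 f \<and> nonneg f \<longrightarrow> nonneg (T t f)"
  define U where "U = abs_rL2 barrier"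
  define W where "W = abs_rL2 barrier_A"
  have op: "L2 (\<lambda>x. complex_of_real (barrier x))" "L2 (\<lambda>x. complex_of_real (barrier_A x))"
    "coef n (\<lambda>x. complex_of_real (barrier_A x)) = lam n * coef n (\<lambda>x. complex_of_real (barrier x))" for n
    using opA_barrier by (auto simp: opA_iff_coef)
  have sq: "square_integrable barrier" "square_integrable barrier_A" using op(1,2) by (simp_all add: L2_iff)
  have W: "W \<bullet> \<phi> n = lam n * (U \<bullet> \<phi> n)" for n
    using arg_cong[OF op(3)[of n], of Re] by (simp add: coef_def U_def W_def)
  define p where "p x = 100 * barrier x + barrier_A x" for x
  have sp: "square_integrable p" unfolding p_def[abs_def] using sq by simp
  define F where "F x = complex_of_real (p x)" for x
  have F: "L2 F" unfolding F_def[abs_def] by (rule L2_of_real[OF sp])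
  have "abs_rL2 p = 100 *\<^sub>R U + W"
    using sq unfolding p_def[abs_def] U_def W_def by (simp add: abs_rL2_add abs_rL2_scale)
  then have P: "abs_rL2 p \<bullet> \<phi> n = (100 + lam n) * (U \<bullet> \<phi> n)" for n
    by (simp add: inner_add_left W distrib_right)
  have cF: "Re (coef n F) = (100 + lam n) * (U \<bullet> \<phi> n)" for n
    by (simp add: coef_def F_def P)
  have nF: "nonneg F"
    unfolding nonneg_def F_def p_def by (intro AE_I2) (use barrier_resolvent_nonneg in auto)
  \<comment> \<open>A nonnegative test function living where \<open>barrier\<close> is
    negative.\<close>
  define v where "v = indicat_real {999/1000..1::real}"
  have sv: "square_integrable v" unfolding v_def
    by (rule square_integrable_bounded[of _ 1]) (auto simp: indicator_def)
  define V where "V = abs_rL2 v"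
  define a where "a n = (U \<bullet> \<phi> n) * (V \<bullet> \<phi> n)" for n
  have "0 \<le> (\<Sum>n. a n)"
  \<comment> \<open>Here \<open>p\<close> is \<open>(100 + A) barrier\<close>, so the hypothesis to
    check is that \<open>exp (- 100 * t) T t p\<close> has nonnegative inner product with
    \<open>v\<close>; the conclusion is that \<open>barrier\<close> has one as well.\<close>
  proof (rule decaying_exponential_sum_nonneg[of "\<lambda>n. 100 + lam n"])
    show "0 < 100 + lam n" for n using lam_pos[of n] by simp
    show "summable (\<lambda>n. \<bar>a n\<bar>)" unfolding a_def by (rule summable_coord_prod)
    show "summable (\<lambda>n. \<bar>(100 + lam n) * a n\<bar>)"
      using summable_coord_prod[of "abs_rL2 p" V] by (simp add: P a_def mult.assoc)
    fix t :: real assume t: "0 < t"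
    then have t0: "0 \<le> t" by simp
    have TL: "L2 (T t F)" by (rule T_L2[OF T t0 F])
    then have sT: "square_integrable (\<lambda>x. Re (T t F x))" by (simp add: L2_iff)
    define R where "R = abs_rL2 (\<lambda>x. Re (T t F x))"
    have R: "R \<bullet> \<phi> n = exp (- lam n * t) * ((100 + lam n) * (U \<bullet> \<phi> n))" for n
      using arg_cong[OF T_coef[OF T t0 F, of n], of Re] cF[of n] by (simp add: coef_def R_def)
    have "0 \<le> R \<bullet> V"
    proof -
      have "nonneg (T t F)" using pos t0 F nF by blast
      then have "AE x in I01. 0 \<le> Re (T t F x) * v x"
        unfolding nonneg_def by eventually_elim (simp add: v_def)
      then have "0 \<le> (LINT x|I01. Re (T t F x) * v x)" by (rule integral_nonneg_AE)
      then show ?thesis using sT sv by (simp add: R_def V_def inner_abs_rL2)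
    qed
    also have "R \<bullet> V = (\<Sum>n. (R \<bullet> \<phi> n) * (V \<bullet> \<phi> n))" using Parseval_inner[of R V] by (simp add: sums_iff)
    finally have "0 \<le> exp (- 100 * t) * (\<Sum>n. (R \<bullet> \<phi> n) * (V \<bullet> \<phi> n))" by simp
    also have "\<dots> = (\<Sum>n. exp (- 100 * t) * ((R \<bullet> \<phi> n) * (V \<bullet> \<phi> n)))"
      using Parseval_inner[of R V] by (intro suminf_mult[symmetric]) (simp add: sums_iff)
    also have "\<dots> = (\<Sum>n. exp (- (100 + lam n) * t) * ((100 + lam n) * a n))"
    proof (rule suminf_cong)
      fix n
      have "exp (- (100 + lam n) * t) = exp (- 100 * t) * exp (- lam n * t)"
        by (simp add: algebra_simps flip: exp_add)
      then show "exp (- 100 * t) * ((R \<bullet> \<phi> n) * (V \<bullet> \<phi> n)) = exp (- (100 + lam n) * t) * ((100 + lam n) * a n)"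
        by (simp add: R a_def)
    qed
    finally show "0 \<le> (\<Sum>n. exp (- (100 + lam n) * t) * ((100 + lam n) * a n))" .
  qed
  also have "(\<Sum>n. a n) = U \<bullet> V" using Parseval_inner[of U V] by (simp add: sums_iff a_def)
  also have "\<dots> = (LINT x|I01. barrier x * v x)" using sq sv by (simp add: U_def V_def inner_abs_rL2)
  also have "\<dots> \<le> (LINT x|I01. (- 1 / 1000) * v x)"
  proof (rule integral_mono)
    show "integrable I01 (\<lambda>x. barrier x * v x)" by (rule integrable_mult_square[OF sq(1) sv])
    show "integrable I01 (\<lambda>x. (- 1 / 1000) * v x)" using square_integrable_integrable[OF sv] by simp
    show "barrier x * v x \<le> (- 1 / 1000) * v x" for x
      using barrier_negative[of x] by (auto simp: v_def indicator_def)
  qed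
  also have "\<dots> = (- 1 / 1000) * measure I01 {999/1000..1}"
    unfolding v_def by (simp add: sets_restrict_space_iff Int_absorb2)
  also have "measure I01 {999/1000..1::real} = 1 / 1000"
    by (subst measure_restrict_space) auto
  finally show False by simp
qed

end

theorem theorem6p11:
  shows "spectrum_negA \<subseteq> complex_of_real ` {..<0}
    \<and> (\<forall>f g. L2 g \<and> nonneg g \<and> \<not> ae_eq g (\<lambda>x. 0) \<and> opA f g \<longrightarrow> strongly_pos f)
    \<and> (\<exists>T. C0_semigroup_gen_negA T)
    \<and> (\<forall>T. C0_semigroup_gen_negA T \<longrightarrow>
         (\<forall>f. L2 f \<and> nonneg f \<and> \<not> ae_eq f (\<lambda>x. 0) \<longrightarrow>
            (\<exists>t0>0. \<forall>t\<ge>t0. strongly_pos (T t f)))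
       \<and> \<not> (\<forall>t\<ge>0. \<forall>f. L2 f \<and> nonneg f \<longrightarrow> nonneg (T t f)))"
proof -
  obtain \<phi> \<kappa> where "green_spectrum \<phi> \<kappa>" using green_spectrum_exists by blast
  then interpret green_spectrum \<phi> \<kappa> .
  show ?thesis
    using spectrum_negative resolvent_strongly_pos semigroup_C0 eventually_strongly_pos not_positive by blast
qed

end
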